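(* Let $H\in(1/2,1)$, let $B^H$ be a fractional Brownian motion with Hurst parameter $H$, let $x_0>0$, and let $f$ satisfy assumptions (i), (ii) and (iii) stated in the context. Let $X=(X_t)_{t\ge0}$ be the unique positive pathwise solution of $$X_t=x_0+\int_0^t f(s,X_s)\,ds+B^H_t,\qquad t\ge0.$$ Then for any $t\ge0$, $X_t\in\mathbb{D}^{1,2}$. Furthermore, for any $t>0$ the law of $X_t$ is absolutely continuous with respect to the Lebesgue measure on $\mathbb{R}$.
   Context: A fractional Brownian motion with Hurst parameter $H$ is a mean zero Gaussian process $(B^H_t)_{t\ge0}$ with continuous paths and covariance $\mathbb{E}(B^H_tB^H_s)=R_H(t,s)=\frac12\left(t^{2H}+s^{2H}-|t-s|^{2H}\right)$. Assumptions on $f$: (i) $f:[0,\infty)\times(0,\infty)\to[0,\infty)$ is a nonnegative continuous function which has a continuous partial derivative with respect to $x$ such that $\partial_x f(t,x)\le 0$ for all $t>0$, $x>0$. (ii) There exist $x_1>0$ and $\alpha>\frac1H-1$ such that $f(t,x)\ge g(t)x^{-\alpha}$ for all $t\ge0$ and $x\in(0,x_1)$, where $g$ is a nonnegative continuous function on $[0,\infty)$ with $g(t)>0$ for all $t>0$. (iii) $f(t,x)\le h(t)\left(1+\frac1x\right)$ for all $t\ge0$ and $x>0$, where $h$ is a nonnegative locally bounded function on $[0,\infty)$. Under (i)–(iii) the equation has a unique pathwise solution that is almost surely strictly positive on $[0,\infty)$. Malliavin calculus setting: fix a time interval $[0,T]$ (with $T\ge t$, $T>0$). The underlying probability space is assumed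 canonical: $\Omega=C_0([0,T])$ (continuous functions on $[0,T]$ vanishing at $0$) with the Borel $\sigma$-field (completed) and $P$ the law of the fractional Brownian motion on $[0,T]$. Let $\mathcal{E}$ be the set of real-valued step functions on $[0,T]$ and let $\mathcal{H}$ be the Hilbert space obtained as the closure (completion) of $\mathcal{E}$ with respect to the scalar product determined by $\langle\mathbf{1}_{[0,t]},\mathbf{1}_{[0,s]}\rangle_{\mathcal{H}}=R_H(t,s)$. The map $\mathbf{1}_{[0,t]}\mapsto B^H_t$ extends to an isometry $\varphi\mapsto B^H(\varphi)$ from $\mathcal{H}$ onto the Gaussian space spanned by $B^H$. Let $\mathcal{S}$ be the space of random variables $F=\phi(B^H(\varphi_1),\dots,B^H(\varphi_n))$ with $n\ge1$, $\varphi_i\in\mathcal{H}$ and $\phi\in C_b^\infty(\mathbb{R}^n)$ ($\phi$ and all its partial derivatives bounded), and define the $\mathcal{H}$-valued random variable $DF=\sum_{i=1}^n\frac{\partial\phi}{\partial x_i}(B^H(\varphi_1),\dots,B^H(\varphi_n))\varphi_i$. The space $\mathbb{D}^{1,2}$ is the completion of $\mathcal{S}$ with respect to the norm $\|F\|_{1,2}=\left[\mathbb{E}(F^2)+\mathbb{E}(\|DF\|_{\mathcal{H}}^2)\right]^{1/2}$. *)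

theory Defs
  imports "HOL-Probability.Probability"
begin

section \<open>Fractional Brownian motion\<close>

definition fbm_cov :: "real \<Rightarrow> real \<Rightarrow> real \<Rightarrow> real" where
  "fbm_cov H t s = (t powr (2 * H) + s powr (2 * H) - \<bar>t - s\<bar> powr (2 * H)) / 2"

text \<open>Degenerate (almost surely constant) variables count as Gaussian.\<close>

definition gaussian_rv :: "'a measure \<Rightarrow> ('a \<Rightarrow> real) \<Rightarrow> bool" where
  "gaussian_rv M Y \<longleftrightarrow> Y \<in> borel_measurable M \<and>
     (\<exists>\<mu> \<sigma>. (\<sigma> = 0 \<and> (AE \<omega> in M. Y \<omega> = \<mu>)) \<or>
            (\<sigma> > 0 \<and> distributed M lborel Y (normal_density \<mu> \<sigma>)))"

definition gaussian_process :: "'a measure \<Rightarrow> real set \<Rightarrow> (real \<Rightarrow> 'a \<Rightarrow> real) \<Rightarrow> bool" where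
  "gaussian_process M I B \<longleftrightarrow>
     (\<forall>A c. finite A \<and> A \<subseteq> I \<longrightarrow> gaussian_rv M (\<lambda>\<omega>. \<Sum>t\<in>A. c t * B t \<omega>))"

text \<open>The time set \<open>I\<close> is \<open>[0,\<infinity>)\<close>, or \<open>[0,T]\<close> when the process lives on a finite horizon; the
  latter includes the coordinate process on the canonical space \<open>C\<^sub>0([0,T])\<close>.\<close>

definition is_fbm :: "'a measure \<Rightarrow> real \<Rightarrow> real set \<Rightarrow> (real \<Rightarrow> 'a \<Rightarrow> real) \<Rightarrow> bool" where
  "is_fbm M H I B \<longleftrightarrow>
     gaussian_process M I B \<and>
     (\<forall>t\<in>I. (\<integral>\<omega>. B t \<omega> \<partial>M) = 0) \<and>
     (\<forall>t\<in>I. \<forall>s\<in>I. (\<integral>\<omega>. B t \<omega> * B s \<omega> \<partial>M) = fbm_cov H t s) \<and>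
     (\<forall>\<omega>\<in>space M. continuous_on I (\<lambda>t. B t \<omega>))"

section \<open>The coefficient and the equation\<close>

definition drift_i :: "(real \<Rightarrow> real \<Rightarrow> real) \<Rightarrow> bool" where
  "drift_i f \<longleftrightarrow>
     (\<forall>t\<ge>0. \<forall>x>0. f t x \<ge> 0) \<and>
     continuous_on ({0..} \<times> {0<..}) (\<lambda>(t, x). f t x) \<and>
     (\<exists>f'. (\<forall>t\<ge>0. \<forall>x>0. ((\<lambda>y. f t y) has_real_derivative f' t x) (at x)) \<and>
           continuous_on ({0..} \<times> {0<..}) (\<lambda>(t, x). f' t x) \<and>
           (\<forall>t>0. \<forall>x>0. f' t x \<le> 0))"

definition drift_ii :: "real \<Rightarrow> (real \<Rightarrow> real \<Rightarrow> real) \<Rightarrow> bool" where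
  "drift_ii H f \<longleftrightarrow>
     (\<exists>x1 \<alpha> g. x1 > 0 \<and> \<alpha> > 1 / H - 1 \<and>
        continuous_on {0..} g \<and> (\<forall>t\<ge>0. g t \<ge> 0) \<and> (\<forall>t>0. g t > 0) \<and>
        (\<forall>t\<ge>0. \<forall>x\<in>{0<..<x1}. f t x \<ge> g t * x powr (- \<alpha>)))"

definition drift_iii :: "(real \<Rightarrow> real \<Rightarrow> real) \<Rightarrow> bool" where
  "drift_iii f \<longleftrightarrow>
     (\<exists>h. (\<forall>t\<ge>0. h t \<ge> 0) \<and> (\<forall>T\<ge>0. bounded (h ` {0..T})) \<and>
          (\<forall>t\<ge>0. \<forall>x>0. f t x \<le> h t * (1 + 1 / x)))"

definition positive_solution ::
  "'a measure \<Rightarrow> real set \<Rightarrow> (real \<Rightarrow> 'a \<Rightarrow> real) \<Rightarrow> (real \<Rightarrow> real \<Rightarrow> real) \<Rightarrow> real \<Rightarrow>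
    (real \<Rightarrow> 'a \<Rightarrow> real) \<Rightarrow> bool" where
  "positive_solution M I B f x0 X \<longleftrightarrow>
     (\<forall>t\<in>I. X t \<in> borel_measurable M) \<and>
     (AE \<omega> in M. \<forall>t\<in>I. X t \<omega> > 0 \<and>
        set_integrable lborel {0..t} (\<lambda>s. f s (X s \<omega>)) \<and>
        X t \<omega> = x0 + (LINT s:{0..t}|lborel. f s (X s \<omega>)) + B t \<omega>)"

section \<open>The Hilbert space of the process\<close>

text \<open>Step functions are the linear combinations of the indicators of \<open>[0,t]\<close>, \<open>t \<in> [0,T]\<close>.
  These indicators are linearly independent; the coefficient of the indicator of \<open>[0,t]\<close>
  is the jump \<open>\<phi>(t) - \<phi>(t+)\<close>, so the formulas for \<open>step_inner\<close> and \<open>step_integral\<close> are the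
  (bi)linear extensions of \<open>\<langle>1\<^bsub>[0,t]\<^esub>, 1\<^bsub>[0,s]\<^esub>\<rangle> = R\<^sub>H(t,s)\<close> and of \<open>1\<^bsub>[0,t]\<^esub> \<mapsto> B\<^sub>t\<close>.\<close>

definition step_functions :: "real \<Rightarrow> (real \<Rightarrow> real) set" where
  "step_functions T =
     {\<phi>. \<exists>A c. finite A \<and> A \<subseteq> {0..T} \<and> \<phi> = (\<lambda>s. \<Sum>t\<in>A. c t * indicator {0..t} s)}"

definition step_jump :: "(real \<Rightarrow> real) \<Rightarrow> real \<Rightarrow> real" where
  "step_jump \<phi> t = \<phi> t - Lim (at_right t) \<phi>"

definition step_inner :: "real \<Rightarrow> (real \<Rightarrow> real) \<Rightarrow> (real \<Rightarrow> real) \<Rightarrow> real" where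
  "step_inner H \<phi> \<psi> =
     (\<Sum>t\<in>{t. step_jump \<phi> t \<noteq> 0}. \<Sum>s\<in>{s. step_jump \<psi> s \<noteq> 0}.
        step_jump \<phi> t * step_jump \<psi> s * fbm_cov H t s)"

definition step_integral :: "(real \<Rightarrow> 'a \<Rightarrow> real) \<Rightarrow> (real \<Rightarrow> real) \<Rightarrow> 'a \<Rightarrow> real" where
  "step_integral B \<phi> \<omega> = (\<Sum>t\<in>{t. step_jump \<phi> t \<noteq> 0}. step_jump \<phi> t * B t \<omega>)"

lemma step_jump_sum:
  assumes A: "finite A" "A \<subseteq> {0..}"
  shows "step_jump (\<lambda>s. \<Sum>t\<in>A. c t * indicator {0..t} s) r = (if r \<in> A then c r else 0)"
proof (cases "r < 0")
  case True
  have "\<forall>\<^sub>F s in at_right r. r < s \<and> s < 0"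
    using True eventually_at_right_field by blast
  then have "\<forall>\<^sub>F s in at_right r. (\<Sum>t\<in>A. c t * indicator {0..t} s) = 0"
    by eventually_elim (auto intro!: sum.neutral)
  then have "Lim (at_right r) (\<lambda>s. \<Sum>t\<in>A. c t * indicator {0..t} s) = 0"
    by (intro tendsto_Lim tendsto_eventually) auto
  then show ?thesis
    using True A by (auto simp: step_jump_def intro!: sum.neutral)
next
  case False
  have ev: "\<forall>\<^sub>F s in at_right r. c t * indicator {0..t} s = c t * indicator {0..<t} r" for t
  proof (cases "r < t")
    case True
    have "\<forall>\<^sub>F s in at_right r. r < s \<and> s < t"
      using True eventually_at_right_field by blast
    then show ?thesis
      by eventually_elim (use False True in \<open>auto simp: indicator_def\<close>)
  next
    case F: False
    show ?thesis
      using eventually_at_right_less[of r]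
      by eventually_elim (use False F in \<open>auto simp: indicator_def\<close>)
  qed
  have "Lim (at_right r) (\<lambda>s. \<Sum>t\<in>A. c t * indicator {0..t} s)
      = (\<Sum>t\<in>A. c t * indicator {0..<t} r)"
    by (intro tendsto_Lim tendsto_sum tendsto_eventually ev) auto
  then have "step_jump (\<lambda>s. \<Sum>t\<in>A. c t * indicator {0..t} s) r
      = (\<Sum>t\<in>A. c t * indicator {0..t} r - c t * indicator {0..<t} r)"
    by (simp add: step_jump_def sum_subtractf)
  also have "\<dots> = (\<Sum>t\<in>A. if t = r then c t else 0)"
    using False by (intro sum.cong) (auto simp: indicator_def)
  also have "\<dots> = (if r \<in> A then c r else 0)"
    using A by (simp add: sum.delta)
  finally show ?thesis .
qed

lemma step_jump_indicator:
  assumes "t \<ge> 0"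
  shows "step_jump (indicator {0..t}) r = (if r = t then 1 else 0)"
  using step_jump_sum[of "{t}" "\<lambda>_. 1" r] assms by simp

lemma step_inner_indicator:
  assumes "t \<ge> 0" "s \<ge> 0"
  shows "step_inner H (indicator {0..t}) (indicator {0..s}) = fbm_cov H t s"
  using assms by (simp add: step_inner_def step_jump_indicator)

lemma step_integral_indicator:
  assumes "t \<ge> 0"
  shows "step_integral B (indicator {0..t}) = B t"
  using assms by (simp add: step_integral_def step_jump_indicator fun_eq_iff)

text \<open>An element of the completion is represented by a Cauchy sequence of step functions.
  Representatives at distance zero are not identified: everything below depends on them only
  through inner products and limits in \<open>L\<^sup>2\<close>.\<close>

definition hilbert_carrier :: "real \<Rightarrow> real \<Rightarrow> (nat \<Rightarrow> real \<Rightarrow> real) set" where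
  "hilbert_carrier H T =
     {\<Phi>. (\<forall>m. \<Phi> m \<in> step_functions T) \<and>
         (\<forall>e>0. \<exists>N. \<forall>k\<ge>N. \<forall>l\<ge>N.
            sqrt (step_inner H (\<lambda>s. \<Phi> k s - \<Phi> l s) (\<lambda>s. \<Phi> k s - \<Phi> l s)) < e)}"

definition hilbert_inner ::
  "real \<Rightarrow> (nat \<Rightarrow> real \<Rightarrow> real) \<Rightarrow> (nat \<Rightarrow> real \<Rightarrow> real) \<Rightarrow> real" where
  "hilbert_inner H \<Phi> \<Psi> = lim (\<lambda>m. step_inner H (\<Phi> m) (\<Psi> m))"

definition hilbert_norm :: "real \<Rightarrow> (nat \<Rightarrow> real \<Rightarrow> real) \<Rightarrow> real" where
  "hilbert_norm H \<Phi> = sqrt (hilbert_inner H \<Phi> \<Phi>)"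

definition square_integrable :: "'a measure \<Rightarrow> ('a \<Rightarrow> real) \<Rightarrow> bool" where
  "square_integrable M F \<longleftrightarrow> F \<in> borel_measurable M \<and> integrable M (\<lambda>\<omega>. (F \<omega>)\<^sup>2)"

text \<open>\<open>Y\<close> is a version of \<open>B(\<Phi>)\<close>, the image of \<open>\<Phi>\<close> under the isometry extending
  \<open>1\<^bsub>[0,t]\<^esub> \<mapsto> B\<^sub>t\<close>.\<close>

definition is_wiener_integral ::
  "'a measure \<Rightarrow> (real \<Rightarrow> 'a \<Rightarrow> real) \<Rightarrow> (nat \<Rightarrow> real \<Rightarrow> real) \<Rightarrow> ('a \<Rightarrow> real) \<Rightarrow> bool" where
  "is_wiener_integral M B \<Phi> Y \<longleftrightarrow>
     square_integrable M Y \<and>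
     (\<lambda>m. \<integral>\<omega>. (step_integral B (\<Phi> m) \<omega> - Y \<omega>)\<^sup>2 \<partial>M) \<longlonglongrightarrow> 0"

section \<open>Smooth functionals, the derivative, and the Sobolev space\<close>

text \<open>Functions on \<open>\<real>\<^sup>n\<close> are functions of \<open>x :: nat \<Rightarrow> real\<close> that depend on \<open>x 0, \<dots>, x (n - 1)\<close>
  only; for those, continuity in the product topology is continuity on \<open>\<real>\<^sup>n\<close>.\<close>

definition partial :: "nat \<Rightarrow> ((nat \<Rightarrow> real) \<Rightarrow> real) \<Rightarrow> (nat \<Rightarrow> real) \<Rightarrow> real" where
  "partial i \<psi> x = deriv (\<lambda>u. \<psi> (x(i := u))) (x i)"

definition Cb_smooth :: "nat \<Rightarrow> ((nat \<Rightarrow> real) \<Rightarrow> real) \<Rightarrow> bool" where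
  "Cb_smooth n \<psi> \<longleftrightarrow>
     (\<forall>x y. (\<forall>i<n. x i = y i) \<longrightarrow> \<psi> x = \<psi> y) \<and>
     (\<forall>is. set is \<subseteq> {..<n} \<longrightarrow>
        continuous_on UNIV (foldr partial is \<psi>) \<and>
        bounded (range (foldr partial is \<psi>)) \<and>
        (\<forall>i<n. \<forall>x. (\<lambda>u. foldr partial is \<psi> (x(i := u))) differentiable (at (x i))))"

text \<open>Pairs \<open>(F, DF)\<close> with \<open>F\<close> a smooth functional; \<open>DF \<omega>\<close> is a representative of the derivative
  at \<open>\<omega>\<close>, the linear combination of the sequences \<open>\<Phi> i\<close> being formed termwise.\<close>

definition smooth_functionals ::
  "'a measure \<Rightarrow> real \<Rightarrow> real \<Rightarrow> (real \<Rightarrow> 'a \<Rightarrow> real) \<Rightarrow>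
    (('a \<Rightarrow> real) \<times> ('a \<Rightarrow> nat \<Rightarrow> real \<Rightarrow> real)) set" where
  "smooth_functionals M H T B =
     {(F, DF). \<exists>n \<psi> \<Phi> Y. n \<ge> 1 \<and> Cb_smooth n \<psi> \<and>
        (\<forall>i<n. \<Phi> i \<in> hilbert_carrier H T \<and> is_wiener_integral M B (\<Phi> i) (Y i)) \<and>
        F = (\<lambda>\<omega>. \<psi> (\<lambda>i. Y i \<omega>)) \<and>
        DF = (\<lambda>\<omega> m s. \<Sum>i<n. partial i \<psi> (\<lambda>j. Y j \<omega>) * \<Phi> i m s)}"

definition norm_1_2 ::
  "'a measure \<Rightarrow> real \<Rightarrow> ('a \<Rightarrow> real) \<Rightarrow> ('a \<Rightarrow> nat \<Rightarrow> real \<Rightarrow> real) \<Rightarrow> real" where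
  "norm_1_2 M H F DF =
     sqrt ((\<integral>\<omega>. (F \<omega>)\<^sup>2 \<partial>M) + (\<integral>\<omega>. (hilbert_norm H (DF \<omega>))\<^sup>2 \<partial>M))"

text \<open>The completion is realised inside \<open>L\<^sup>2\<close>: its elements are the \<open>L\<^sup>2\<close> limits of sequences of
  smooth functionals that are Cauchy for the norm above. The differences of two smooth functionals
  and of their derivatives are bounded, so the integrals in the norm are finite.\<close>

definition D_1_2 ::
  "'a measure \<Rightarrow> real \<Rightarrow> real \<Rightarrow> (real \<Rightarrow> 'a \<Rightarrow> real) \<Rightarrow> ('a \<Rightarrow> real) set" where
  "D_1_2 M H T B =
     {F. square_integrable M F \<and>
        (\<exists>Fs DFs. (\<forall>k. (Fs k, DFs k) \<in> smooth_functionals M H T B) \<and>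
           (\<forall>e>0. \<exists>N. \<forall>k\<ge>N. \<forall>l\<ge>N.
              norm_1_2 M H (\<lambda>\<omega>. Fs k \<omega> - Fs l \<omega>) (\<lambda>\<omega> m s. DFs k \<omega> m s - DFs l \<omega> m s) < e) \<and>
           (\<lambda>k. \<integral>\<omega>. (Fs k \<omega> - F \<omega>)\<^sup>2 \<partial>M) \<longlonglongrightarrow> 0)}"

end

theory Submission
  imports Defs
begin

text \<open>Since \<open>f\<close> is decreasing in \<open>x\<close>, the difference of two solutions driven by \<open>b\<close> and \<open>b'\<close> is at
  most \<open>2 sup |b - b'|\<close>: after the last time at which the solutions cross, the drift only brings them
  together. So \<open>X\<^sub>t\<close> is a Lipschitz functional of the path, and McShane's extension makes it a limit
  of Lipschitz functions of finitely many values of \<open>B\<close>, which can be mollified without increasing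
  the \<open>l\<^sup>1\<close> norm of the gradient. The functionals obtained in this way converge to \<open>X\<^sub>t\<close> in \<open>L\<^sup>2\<close>
  and are bounded in \<open>D\<^sup>1\<^sup>,\<^sup>2\<close>, and suitable convex combinations of them are Cauchy.

  For absolute continuity, write \<open>B = (B - Z h) + Z h\<close> with \<open>Z\<close> a normalisation of \<open>B\<^sub>t\<close>, which is
  independent of \<open>B - Z h\<close>. The direction \<open>h\<close> is increasing, so the Euler scheme for the drift truncated
  to a compact subset of \<open>(0,\<infinity>)\<close> is an expanding function of the value of \<open>Z\<close>, uniformly in the mesh.
  Hence its limit, which is \<open>X\<^sub>t\<close> as long as \<open>X\<close> stays in the compact set, hits a null set only for a
  null set of values of \<open>Z\<close>.\<close>

section \<open>Mollification of Lipschitz functions of finitely many variables\<close>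


text \<open>The sup norm fits because the covariance is bounded on [0,T]: a gradient with
  \<open>l^1\<close> norm at most \<open>L\<close> has squared Hilbert norm at most
  \<open>2 * L^2 * T^(2H)\<close>, whatever the number and the position of the times. No derivative
  along the solution has to be computed, where the derivative of \<open>f\<close> may blow up near
  zero.

  For the law of \<open>X t\<close> the obstacle is that the probability space is arbitrary, so a
  shift of the path cannot act on sample points; it acts on the law of \<open>B\<close> on the
  product sigma-algebra. A functional used there must be defined for every function on [0,t] and be
  measurable in countably many coordinates, whereas solutions are known only along almost every path
  of \<open>B\<close>. The Euler scheme meets both demands. The direction \<open>h\<close> is the
  covariance with \<open>B t\<close> divided by the standard deviation \<open>t powr H\<close>.

  The bound \<open>H > 1/2\<close> enters through the integrability of the running supremum: the
  squared dyadic increments of one level have a total mean that decays geometrically with the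
  level.\<close>

definition sech2 :: "real \<Rightarrow> real" where "sech2 u = 1 - (tanh u)\<^sup>2"

lemma sech2_eq: "sech2 u = 1 / (cosh u)\<^sup>2"
proof -
  have c: "(cosh u)\<^sup>2 \<noteq> 0" using cosh_real_pos[of u] by simp
  then have "1 - (sinh u)\<^sup>2 / (cosh u)\<^sup>2 = ((cosh u)\<^sup>2 - (sinh u)\<^sup>2) / (cosh u)\<^sup>2"
    by (simp add: diff_divide_distrib)
  then show ?thesis using hyperbolic_pythagoras[of u]
    by (simp add: sech2_def tanh_def power_divide)
qed

lemma sech2_pos: "sech2 u > 0"
  by (simp add: sech2_eq)

text \<open>Each exponential in \<open>cosh\<close> changes by at most the factor
  \<open>exp \<bar>v\<bar>\<close>, and squaring doubles the exponent. This gives one integrable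
  envelope for all translates by a bounded amount.\<close>

lemma sech2_shift: "sech2 (a + v) \<le> exp (2 * \<bar>v\<bar>) * sech2 a"
proof -
  have "exp a \<le> exp \<bar>v\<bar> * exp (a + v)" "exp (- a) \<le> exp \<bar>v\<bar> * exp (- (a + v))"
    by (simp_all flip: exp_add)
  then have "cosh a \<le> exp \<bar>v\<bar> * cosh (a + v)"
    unfolding cosh_def by (simp add: field_simps)
  then have "(cosh a)\<^sup>2 \<le> (exp \<bar>v\<bar> * cosh (a + v))\<^sup>2"
    by (intro power_mono) auto
  then have "(cosh a)\<^sup>2 \<le> exp (2 * \<bar>v\<bar>) * (cosh (a + v))\<^sup>2"
    by (simp add: power_mult_distrib exp_double)
  moreover have "cosh a > 0" "cosh (a + v) > 0" by (simp_all add: cosh_real_pos)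
  ultimately show ?thesis unfolding sech2_eq by (simp add: field_simps)
qed

lemma has_field_derivative_tanh_scaled:
  "((\<lambda>u. tanh (l * u)) has_real_derivative l * sech2 (l * u)) (at u)"
  using cosh_real_pos[of "l * u"]
  by (auto intro!: derivative_eq_intros simp: sech2_def)

lemma continuous_sech2 [continuous_intros]: "continuous_on A f \<Longrightarrow> continuous_on A (\<lambda>u. sech2 (f u))"
  unfolding sech2_def using cosh_real_pos by (intro continuous_intros) (auto simp: less_imp_neq[symmetric])

text \<open>The antiderivative \<open>tanh (l * u) / l\<close> has the limits \<open>1 / l\<close>
  and \<open>- 1 / l\<close> at the two ends. The mass \<open>2 / l\<close> is the reason for the
  constant \<open>l / 2\<close> in the normalised kernel.\<close>

lemma integrable_sech2_scaled:
  assumes "l > 0"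
  shows "integrable lborel (\<lambda>u. sech2 (l * u))" and "(\<integral>u. sech2 (l * u) \<partial>lborel) = 2 / l"
proof -
  have lim: "((\<lambda>u. tanh (l * u) / l) \<longlongrightarrow> 1 / l) at_top" "((\<lambda>u. tanh (l * u) / l) \<longlongrightarrow> - 1 / l) at_bot"
    using assms
    by (intro tendsto_divide filterlim_compose[OF tanh_real_at_top] filterlim_compose[OF tanh_real_at_bot]
        filterlim_tendsto_pos_mult_at_top[OF tendsto_const] filterlim_tendsto_pos_mult_at_bot[OF tendsto_const] filterlim_ident tendsto_const; simp)+
  have lim': "(((\<lambda>u. tanh (l * u) / l) \<circ> real_of_ereal) \<longlongrightarrow> 1 / l) (at_left \<infinity>)"
     "(((\<lambda>u. tanh (l * u) / l) \<circ> real_of_ereal) \<longlongrightarrow> - 1 / l) (at_right (-\<infinity>))"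
    using lim by (simp_all only: ereal_tendsto_simps)
  have d: "((\<lambda>u. tanh (l * u) / l) has_real_derivative sech2 (l * u)) (at u)" for u
    using DERIV_cdivide[OF has_field_derivative_tanh_scaled[of l u], of l] assms by simp
  have c: "isCont (\<lambda>u. sech2 (l * u)) u" for u
    by (rule continuous_on_interior[of UNIV]) (auto intro!: continuous_intros)
  have "set_integrable lborel (einterval (-\<infinity>) \<infinity>) (\<lambda>u. sech2 (l * u))"
    by (rule interval_integral_FTC_nonneg(1)[where F="\<lambda>u. tanh (l * u) / l" and A="-1/l" and B="1/l"])
      (use d c lim' sech2_pos in \<open>auto intro!: less_imp_le\<close>)
  then show "integrable lborel (\<lambda>u. sech2 (l * u))"
    by (simp add: set_integrable_def)
  have "(LBINT u=-\<infinity>..\<infinity>. sech2 (l * u)) = 1 / l - (-1 / l)"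
    by (rule interval_integral_FTC_nonneg(2)[where F="\<lambda>u. tanh (l * u) / l"])
      (use d c lim' sech2_pos in \<open>auto intro!: less_imp_le\<close>)
  then show "(\<integral>u. sech2 (l * u) \<partial>lborel) = 2 / l"
    by (simp add: interval_lebesgue_integral_def set_lebesgue_integral_def)
qed

text \<open>These kernels are closed under differentiation, and small translations change their envelope
  \<open>sech2\<close> only by a constant factor, which allows differentiation under the integral sign.\<close>

definition kern :: "real \<Rightarrow> real poly \<Rightarrow> real \<Rightarrow> real" where
  "kern l p u = poly p (tanh (l * u)) * sech2 (l * u)"

text \<open>With \<open>T = tanh (l * u)\<close> one has \<open>T' = l * (1 - T\<^sup>2)\<close>, so
  differentiating \<open>p(T) * (1 - T\<^sup>2)\<close> reproduces one factor
  \<open>1 - T\<^sup>2\<close>; the cofactor is this polynomial in \<open>T\<close>.\<close>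

definition kderiv :: "real \<Rightarrow> real poly \<Rightarrow> real poly" where
  "kderiv l p = smult l (pderiv p * [:1, 0, -1:] - [:0, 2:] * p)"

lemma kern_DERIV: "(kern l p has_real_derivative kern l (kderiv l p) u) (at u)"
proof -
  let ?t = "tanh (l * u)"
  note [derivative_intros] = has_field_derivative_tanh_scaled
  have 1: "((\<lambda>u. poly p (tanh (l * u))) has_real_derivative poly (pderiv p) ?t * (l * sech2 (l * u))) (at u)"
    by (rule DERIV_chain2[OF poly_DERIV has_field_derivative_tanh_scaled])
  have "((\<lambda>u. poly p (tanh (l * u)) * (1 - (tanh (l * u))\<^sup>2)) has_real_derivative
     poly (pderiv p) ?t * (l * sech2 (l * u)) * (1 - ?t\<^sup>2) + poly p ?t * (0 - 2 * ?t * (l * sech2 (l * u)))) (at u)"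
    by (auto intro!: derivative_eq_intros 1)
  moreover have "poly (pderiv p) ?t * (l * sech2 (l * u)) * (1 - ?t\<^sup>2) + poly p ?t * (0 - 2 * ?t * (l * sech2 (l * u)))
     = kern l (kderiv l p) u"
    unfolding kern_def kderiv_def sech2_def by (simp add: algebra_simps power2_eq_square)
  ultimately show ?thesis unfolding kern_def[abs_def] sech2_def by simp
qed

lemma kern_bound: obtains K where "K \<ge> 0" "\<And>u. \<bar>kern l p u\<bar> \<le> K * sech2 (l * u)"
proof -
  have "compact (poly p ` {-1..1})"
    by (intro compact_continuous_image continuous_intros) auto
  then obtain K where K: "\<And>y. y \<in> {-1..1} \<Longrightarrow> \<bar>poly p y\<bar> \<le> K"
    using bounded_real compact_imp_bounded by (metis imageI)
  have "K \<ge> 0" using K[of 0] by auto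
  moreover have "\<bar>kern l p u\<bar> \<le> K * sech2 (l * u)" for u
  proof -
    have "tanh (l * u) \<in> {-1..1}" using tanh_real_bounds[of "l * u"] by auto
    then show ?thesis using K sech2_pos[of "l * u"]
      by (auto simp: kern_def abs_mult intro!: mult_right_mono)
  qed
  ultimately show ?thesis using that by blast
qed

lemma continuous_kern [continuous_intros]: "continuous_on A f \<Longrightarrow> continuous_on A (\<lambda>u. kern l p (f u))"
  unfolding kern_def
  by (intro continuous_intros) (auto simp: cosh_real_pos less_imp_neq[symmetric])

lemma integrable_kern:
  assumes "l > 0"
  shows "integrable lborel (kern l p)"
proof -
  obtain K where K: "\<And>u. \<bar>kern l p u\<bar> \<le> K * sech2 (l * u)" using kern_bound by metis
  show ?thesis
    by (rule Bochner_Integration.integrable_bound[where f="\<lambda>u. K * sech2 (l * u)"])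
      (use K integrable_sech2_scaled(1)[OF assms] in \<open>auto intro!: borel_measurable_continuous_onI continuous_intros AE_I2 order_trans[OF K]\<close>)
qed

text \<open>Dominated convergence along sequences: by the mean value inequality on the convex ball
  of radius 1, the difference quotients inherit the bound \<open>w\<close> from the
  derivative.\<close>

lemma DERIV_integral:
  fixes F F' :: "real \<Rightarrow> 'b \<Rightarrow> real"
  assumes F: "\<And>x. integrable N (F x)"
    and meas: "F' a \<in> borel_measurable N"
    and D: "\<And>x u. \<bar>x - a\<bar> < 1 \<Longrightarrow> ((\<lambda>x. F x u) has_real_derivative F' x u) (at x)"
    and bd: "\<And>x u. \<bar>x - a\<bar> < 1 \<Longrightarrow> \<bar>F' x u\<bar> \<le> w u" and w: "integrable N w"
  shows "((\<lambda>x. \<integral>u. F x u \<partial>N) has_real_derivative (\<integral>u. F' a u \<partial>N)) (at a)"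
proof -
  have "((\<lambda>x. \<integral>u. F x u \<partial>N) has_real_derivative (\<integral>u. F' a u \<partial>N)) (at a within ball a 1)"
    unfolding has_field_derivative_iff tendsto_at_iff_sequentially
  proof (intro allI impI)
    fix X assume X: "\<forall>i. X i \<in> ball a 1 - {a}" "X \<longlonglongrightarrow> a"
    have q: "\<bar>(F (X i) u - F a u) / (X i - a)\<bar> \<le> w u" for i u
    proof -
      have Xi: "\<bar>X i - a\<bar> < 1" "X i \<noteq> a" using X(1) by (auto simp: dist_real_def abs_minus_commute)
      have "\<bar>F (X i) u - F a u\<bar> \<le> w u * \<bar>X i - a\<bar>"
        using field_differentiable_bound[of "ball a 1" "\<lambda>x. F x u" "\<lambda>x. F' x u" "w u" a "X i"] Xi D[THEN DERIV_subset] bd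
        by (auto simp: dist_real_def abs_minus_commute)
      then show ?thesis using Xi by (simp add: abs_divide field_simps)
    qed
    have "(\<lambda>i. \<integral>u. (F (X i) u - F a u) / (X i - a) \<partial>N) \<longlonglongrightarrow> (\<integral>u. F' a u \<partial>N)"
    proof (rule integral_dominated_convergence[where w=w])
      show "AE u in N. (\<lambda>i. (F (X i) u - F a u) / (X i - a)) \<longlonglongrightarrow> F' a u"
      proof (intro AE_I2)
        fix u
        have "((\<lambda>x. F x u) has_real_derivative F' a u) (at a within ball a 1)"
          using D[of a u] by (auto intro: DERIV_subset)
        then show "(\<lambda>i. (F (X i) u - F a u) / (X i - a)) \<longlonglongrightarrow> F' a u"
          unfolding has_field_derivative_iff tendsto_at_iff_sequentially using X by (auto simp: comp_def)
      qed
    qed (use F w meas q in \<open>auto simp: borel_measurable_integrable\<close>)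
    then show "((\<lambda>y. ((\<integral>u. F y u \<partial>N) - (\<integral>u. F a u \<partial>N)) / (y - a)) \<circ> X) \<longlonglongrightarrow> (\<integral>u. F' a u \<partial>N)"
      using F by (simp add: comp_def Bochner_Integration.integral_diff)
  qed
  then show ?thesis
    by (simp add: at_within_open[OF _ open_ball])
qed

section \<open>Convolution in one coordinate at a time\<close>

definition bcont :: "((nat \<Rightarrow> real) \<Rightarrow> real) \<Rightarrow> bool" where
  "bcont \<phi> \<longleftrightarrow> continuous_on UNIV \<phi> \<and> bounded (range \<phi>)"

lemma bcont_bound: assumes "bcont \<phi>" obtains C where "C \<ge> 0" "\<And>x. \<bar>\<phi> x\<bar> \<le> C"
proof -
  obtain C where "\<And>x. \<bar>\<phi> x\<bar> \<le> C" using assms unfolding bcont_def bounded_real by auto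
  then show ?thesis using that[of C] by (meson abs_ge_zero order_trans)
qed

lemma continuous_on_fun_upd:
  fixes x :: "'b::topological_space \<Rightarrow> nat \<Rightarrow> real"
  assumes "continuous_on A x" "continuous_on A g"
  shows "continuous_on A (\<lambda>s. (x s)(i := g s))"
proof (rule continuous_on_coordinatewise_then_product)
  fix j
  have "continuous_on A (\<lambda>s. x s j)" using assms(1) by (rule continuous_on_product_then_coordinatewise)
  then show "continuous_on A (\<lambda>s. ((x s)(i := g s)) j)" using assms(2) by (cases "j = i") auto
qed

lemma bcont_slice:
  assumes "bcont \<phi>" "continuous_on A x"
  shows "continuous_on A (\<lambda>s. \<phi> (x s))"
  using assms continuous_on_compose2[of UNIV \<phi> A x] unfolding bcont_def by auto

definition conv :: "real \<Rightarrow> nat \<Rightarrow> real poly \<Rightarrow> ((nat \<Rightarrow> real) \<Rightarrow> real) \<Rightarrow> (nat \<Rightarrow> real) \<Rightarrow> real" where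
  "conv l i p \<phi> x = (\<integral>u. \<phi> (x(i := u)) * kern l p (x i - u) \<partial>lborel)"

text \<open>Two forms of one integral with different uses. In the definition the variable
  \<open>x i\<close> sits in the kernel, which can be differentiated; here it sits in
  \<open>\<phi>\<close>, which yields boundedness, continuity and Lipschitz constants.\<close>

lemma conv_shift: "conv l i p \<phi> x = (\<integral>u. \<phi> (x(i := x i - u)) * kern l p u \<partial>lborel)"
  unfolding conv_def
  by (subst lborel_integral_real_affine[where c="-1" and t="x i"]) auto

lemma integrable_shift:
  fixes f :: "real \<Rightarrow> real"
  assumes "integrable lborel f" shows "integrable lborel (\<lambda>u. f (a - u))"
  using lborel_integrable_real_affine[OF assms, of "-1" a] by simp

lemma integrable_conv:
  assumes "l > 0" "bcont \<phi>"
  shows "integrable lborel (\<lambda>u. \<phi> (x(i := u)) * kern l p (a - u))"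
    and "integrable lborel (\<lambda>u. \<phi> (x(i := a - u)) * kern l p u)"
proof -
  obtain C where C: "\<And>x. \<bar>\<phi> x\<bar> \<le> C" using bcont_bound[OF assms(2)] by metis
  show 1: "integrable lborel (\<lambda>u. \<phi> (x(i := u)) * kern l p (a - u))" for a
  proof (rule Bochner_Integration.integrable_bound[where f="\<lambda>u. C * \<bar>kern l p (a - u)\<bar>"])
    show "integrable lborel (\<lambda>u. C * \<bar>kern l p (a - u)\<bar>)"
      using integrable_shift[OF integrable_kern[OF assms(1), of p], of a] by simp
    have "continuous_on UNIV (\<lambda>u. \<phi> (x(i := u)) * kern l p (a - u))"
      by (intro continuous_intros bcont_slice[OF assms(2)] continuous_on_fun_upd)
    then show "(\<lambda>u. \<phi> (x(i := u)) * kern l p (a - u)) \<in> borel_measurable lborel"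
      by (simp add: borel_measurable_continuous_onI)
    show "AE u in lborel. norm (\<phi> (x(i := u)) * kern l p (a - u)) \<le> norm (C * \<bar>kern l p (a - u)\<bar>)"
    proof (intro AE_I2)
      fix u show "norm (\<phi> (x(i := u)) * kern l p (a - u)) \<le> norm (C * \<bar>kern l p (a - u)\<bar>)"
        using C[of "x(i := u)"] mult_right_mono[of "\<bar>\<phi> (x(i := u))\<bar>" "\<bar>C\<bar>" "\<bar>kern l p (a - u)\<bar>"]
        by (simp add: abs_mult)
    qed
  qed
  show "integrable lborel (\<lambda>u. \<phi> (x(i := a - u)) * kern l p u)"
    using integrable_shift[OF 1[of a], of a] by simp
qed

lemma conv_bcont:
  assumes "l > 0" "bcont \<phi>"
  shows "bcont (conv l i p \<phi>)"
proof -
  obtain C where C: "\<And>x. \<bar>\<phi> x\<bar> \<le> C" "C \<ge> 0" using bcont_bound[OF assms(2)] by metis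
  note k = integrable_kern[OF assms(1), of p]
  have b: "\<bar>\<phi> (x(i := x i - u)) * kern l p u\<bar> \<le> C * \<bar>kern l p u\<bar>" for x u
    using C by (auto simp: abs_mult intro!: mult_right_mono)
  have "\<bar>conv l i p \<phi> x\<bar> \<le> (\<integral>u. C * \<bar>kern l p u\<bar> \<partial>lborel)" for x
    unfolding conv_shift using b integrable_conv(2)[OF assms] k
    by (intro integral_abs_bound_integral) auto
  then have 1: "bounded (range (conv l i p \<phi>))" unfolding bounded_real by auto
  have 2: "continuous_on UNIV (conv l i p \<phi>)"
    unfolding continuous_on_sequentially
  proof (intro allI ballI impI, elim conjE)
    fix x :: "nat \<Rightarrow> nat \<Rightarrow> real" and a assume x: "x \<longlonglongrightarrow> a"
    have "(\<lambda>n. \<integral>u. \<phi> ((x n)(i := x n i - u)) * kern l p u \<partial>lborel) \<longlonglongrightarrow> (\<integral>u. \<phi> (a(i := a i - u)) * kern l p u \<partial>lborel)"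
    proof (rule integral_dominated_convergence[where w="\<lambda>u. C * \<bar>kern l p u\<bar>"])
      have "(\<lambda>n. \<phi> ((x n)(i := x n i - u))) \<longlonglongrightarrow> \<phi> (a(i := a i - u))" for u
      proof -
        have "continuous_on UNIV (\<lambda>x. \<phi> (x(i := x i - u)))"
          by (intro bcont_slice[OF assms(2)] continuous_on_fun_upd continuous_intros continuous_on_id continuous_on_product_then_coordinatewise)
        then show ?thesis using x unfolding continuous_on_sequentially by (auto simp: comp_def)
      qed
      then show "AE u in lborel. (\<lambda>n. \<phi> ((x n)(i := x n i - u)) * kern l p u) \<longlonglongrightarrow> \<phi> (a(i := a i - u)) * kern l p u"
        by (auto intro!: tendsto_intros)
    qed (use b k integrable_conv(2)[OF assms] in \<open>auto simp: borel_measurable_integrable\<close>)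
    then show "(conv l i p \<phi> \<circ> x) \<longlonglongrightarrow> conv l i p \<phi> a" by (simp add: comp_def conv_shift)
  qed
  from 1 2 show ?thesis by (simp add: bcont_def)
qed

text \<open>The derivative falls on the kernel, since \<open>\<phi>\<close> is only continuous and
  bounded.\<close>

lemma conv_DERIV_same:
  assumes "l > 0" "bcont \<phi>"
  shows "((\<lambda>v. conv l i p \<phi> (x(i := v))) has_real_derivative conv l i (kderiv l p) \<phi> (x(i := a))) (at a)"
proof -
  obtain C where C: "\<And>x. \<bar>\<phi> x\<bar> \<le> C" "C \<ge> 0" using bcont_bound[OF assms(2)] by metis
  obtain K where K: "\<And>u. \<bar>kern l (kderiv l p) u\<bar> \<le> K * sech2 (l * u)" "K \<ge> 0" using kern_bound by metis
  \<comment> \<open>For \<open>\<bar>v - a\<bar> < 1\<close> the argument of \<open>sech2\<close>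
    moves by at most \<open>l\<close>, so the translation estimate costs the factor
    \<open>exp (2 * l)\<close>.\<close>
  define w where "w u = C * (K * (exp (2 * l) * sech2 (l * (a - u))))" for u
  have "((\<lambda>v. \<integral>u. \<phi> (x(i := u)) * kern l p (v - u) \<partial>lborel) has_real_derivative
      (\<integral>u. \<phi> (x(i := u)) * kern l (kderiv l p) (a - u) \<partial>lborel)) (at a)"
  proof (rule DERIV_integral[where w=w])
    show "integrable lborel (\<lambda>u. \<phi> (x(i := u)) * kern l p (v - u))" for v
      by (rule integrable_conv[OF assms])
    show "(\<lambda>u. \<phi> (x(i := u)) * kern l (kderiv l p) (a - u)) \<in> borel_measurable lborel"
      using integrable_conv[OF assms] borel_measurable_integrable by blast
    show "((\<lambda>v. \<phi> (x(i := u)) * kern l p (v - u)) has_real_derivative \<phi> (x(i := u)) * kern l (kderiv l p) (v - u)) (at v)" for v u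
      by (auto intro!: derivative_eq_intros DERIV_chain2[OF kern_DERIV])
    show "\<bar>\<phi> (x(i := u)) * kern l (kderiv l p) (v - u)\<bar> \<le> w u" if "\<bar>v - a\<bar> < 1" for v u
    proof -
      have "sech2 (l * (v - u)) = sech2 (l * (a - u) + l * (v - a))" by (simp add: algebra_simps)
      also have "\<dots> \<le> exp (2 * \<bar>l * (v - a)\<bar>) * sech2 (l * (a - u))" by (rule sech2_shift)
      also have "\<dots> \<le> exp (2 * l) * sech2 (l * (a - u))"
        using assms(1) less_imp_le[OF that] mult_left_mono[of "\<bar>v - a\<bar>" 1 l]
        by (intro mult_right_mono less_imp_le[OF sech2_pos]) (simp add: abs_mult)
      finally have "\<bar>kern l (kderiv l p) (v - u)\<bar> \<le> K * (exp (2 * l) * sech2 (l * (a - u)))"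
        using K(1)[of "v - u"] K(2) by (meson mult_left_mono order_trans)
      then show ?thesis unfolding w_def abs_mult using C by (intro mult_mono) auto
    qed
    show "integrable lborel w"
      unfolding w_def using integrable_shift[OF integrable_sech2_scaled(1)[OF assms(1)], of a]
      by (auto)
  qed
  then show ?thesis by (simp add: conv_def)
qed

text \<open>The kernel does not involve coordinate \<open>j\<close>, so the derivative passes to
  \<open>\<phi>\<close>. This case carries derivatives through the convolutions in the later
  coordinates.\<close>

lemma conv_DERIV_other:
  assumes "l > 0" "bcont \<phi>" "bcont \<phi>'" "i \<noteq> j"
    and D: "\<And>x a. ((\<lambda>v. \<phi> (x(j := v))) has_real_derivative \<phi>' (x(j := a))) (at a)"
  shows "((\<lambda>v. conv l i p \<phi> (x(j := v))) has_real_derivative conv l i p \<phi>' (x(j := a))) (at a)"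
proof -
  obtain C where C: "\<And>x. \<bar>\<phi>' x\<bar> \<le> C" "C \<ge> 0" using bcont_bound[OF assms(3)] by metis
  have "((\<lambda>v. \<integral>u. \<phi> (x(i := u, j := v)) * kern l p (x i - u) \<partial>lborel) has_real_derivative
      (\<integral>u. \<phi>' (x(i := u, j := a)) * kern l p (x i - u) \<partial>lborel)) (at a)"
  proof (rule DERIV_integral[where w="\<lambda>u. C * \<bar>kern l p (x i - u)\<bar>"])
    show "integrable lborel (\<lambda>u. \<phi> (x(i := u, j := v)) * kern l p (x i - u))" for v
      using integrable_conv(1)[OF assms(1,2), of "x(j := v)" i] assms(4) by (simp add: fun_upd_twist)
    show "(\<lambda>u. \<phi>' (x(i := u, j := a)) * kern l p (x i - u)) \<in> borel_measurable lborel"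
      using integrable_conv(1)[OF assms(1,3), of "x(j := a)" i p "x i"] assms(4) borel_measurable_integrable
      by (auto simp add: fun_upd_twist)
    show "((\<lambda>v. \<phi> (x(i := u, j := v)) * kern l p (x i - u)) has_real_derivative \<phi>' (x(i := u, j := v)) * kern l p (x i - u)) (at v)" for v u
      using DERIV_cmult_right[OF D] .
    show "\<bar>\<phi>' (x(i := u, j := v)) * kern l p (x i - u)\<bar> \<le> C * \<bar>kern l p (x i - u)\<bar>" for v u
      using C by (auto simp: abs_mult intro!: mult_right_mono)
    show "integrable lborel (\<lambda>u. C * \<bar>kern l p (x i - u)\<bar>)"
      using integrable_shift[OF integrable_kern[OF assms(1), of p], of "x i"] by auto
  qed
  then show ?thesis using assms(4) by (simp add: conv_def fun_upd_twist)
qed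

text \<open>Convolution with a product kernel, done coordinate by coordinate so that only
  one-dimensional integrals occur. The polynomial may differ between coordinates because a partial
  derivative in coordinate \<open>i\<close> changes \<open>P i\<close> alone.\<close>

primrec mconv :: "real \<Rightarrow> (nat \<Rightarrow> real poly) \<Rightarrow> ((nat \<Rightarrow> real) \<Rightarrow> real) \<Rightarrow> nat \<Rightarrow> (nat \<Rightarrow> real) \<Rightarrow> real" where
  "mconv l P \<phi> 0 = \<phi>"
| "mconv l P \<phi> (Suc k) = conv l k (P k) (mconv l P \<phi> k)"

lemma mconv_bcont: "l > 0 \<Longrightarrow> bcont \<phi> \<Longrightarrow> bcont (mconv l P \<phi> k)"
  by (induction k) (auto intro: conv_bcont)

lemma mconv_cong: "(\<And>i. i < k \<Longrightarrow> P i = Q i) \<Longrightarrow> mconv l P \<phi> k = mconv l Q \<phi> k"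
  by (induction k) auto

lemma mconv_DERIV:
  assumes "l > 0" "bcont \<phi>" "i < k"
  shows "((\<lambda>v. mconv l P \<phi> k (x(i := v))) has_real_derivative mconv l (P(i := kderiv l (P i))) \<phi> k (x(i := a))) (at a)"
  using assms(3)
proof (induction k arbitrary: x a)
  case (Suc k)
  show ?case
  proof (cases "i = k")
    case True
    have "mconv l (P(i := kderiv l (P i))) \<phi> k = mconv l P \<phi> k" using True by (intro mconv_cong) auto
    then show ?thesis using conv_DERIV_same[OF assms(1) mconv_bcont[OF assms(1,2), of P k], of k "P k" x a]
      by (simp add: True fun_upd_same del: fun_upd_apply)
  next
    case False
    then have "i < k" using Suc by simp
    then show ?thesis
      using conv_DERIV_other[OF assms(1) mconv_bcont[OF assms(1,2)] mconv_bcont[OF assms(1,2)] _ Suc.IH, of k] False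
      by (simp del: fun_upd_apply add: fun_upd_other)
  qed
qed simp

lemma partial_mconv:
  assumes "l > 0" "bcont \<phi>" "i < k"
  shows "partial i (mconv l P \<phi> k) = mconv l (P(i := kderiv l (P i))) \<phi> k"
  unfolding partial_def using DERIV_imp_deriv[OF mconv_DERIV[OF assms]] by fastforce

lemma foldr_partial_mconv:
  assumes "l > 0" "bcont \<phi>" "set is \<subseteq> {..<k}"
  shows "\<exists>Q. foldr partial is (mconv l P \<phi> k) = mconv l Q \<phi> k"
  using assms(3) by (induction "is") (auto simp: partial_mconv[OF assms(1,2)])

lemma conv_depends:
  assumes "\<And>x y. (\<forall>i<n. x i = y i) \<Longrightarrow> \<phi> x = \<phi> y" "k < n" "\<forall>i<n. x i = y i"
  shows "conv l k p \<phi> x = conv l k p \<phi> y"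
proof -
  have "\<phi> (x(k := u)) = \<phi> (y(k := u))" for u by (rule assms(1)) (use assms(3) in auto)
  moreover have "x k = y k" using assms by simp
  ultimately show ?thesis unfolding conv_def by presburger
qed

lemma mconv_depends:
  assumes "\<And>x y. (\<forall>i<n. x i = y i) \<Longrightarrow> \<phi> x = \<phi> y" "k \<le> n" "\<forall>i<n. x i = y i"
  shows "mconv l P \<phi> k x = mconv l P \<phi> k y"
  using assms(2,3)
proof (induction k arbitrary: x y)
  case 0
  then show ?case using assms(1)[of x y] by simp
next
  case (Suc k)
  then show ?case using conv_depends[of n "mconv l P \<phi> k" k x y] by simp
qed

lemma Cb_smooth_mconv:
  assumes "l > 0" "bcont \<phi>" "\<And>x y. (\<forall>i<n. x i = y i) \<Longrightarrow> \<phi> x = \<phi> y"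
  shows "Cb_smooth n (mconv l P \<phi> n)"
  unfolding Cb_smooth_def
proof (intro conjI allI impI)
  show "mconv l P \<phi> n x = mconv l P \<phi> n y" if "\<forall>i<n. x i = y i" for x y
    by (rule mconv_depends[where n=n]) (use assms(3) that in auto)
  fix "is" assume "set is \<subseteq> {..<n}"
  then obtain Q where Q: "foldr partial is (mconv l P \<phi> n) = mconv l Q \<phi> n"
    using foldr_partial_mconv[OF assms(1,2)] by blast
  show "continuous_on UNIV (foldr partial is (mconv l P \<phi> n))" "bounded (range (foldr partial is (mconv l P \<phi> n)))"
    using mconv_bcont[OF assms(1,2)] unfolding Q bcont_def by auto
  show "(\<lambda>u. foldr partial is (mconv l P \<phi> n) (x(i := u))) differentiable at (x i)" if "i < n" for i x
    unfolding Q using mconv_DERIV[OF assms(1,2) that] real_differentiable_def by blast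
qed

section \<open>Lipschitz constants, gradients and the error of mollification\<close>

definition sup_lipschitz :: "nat \<Rightarrow> real \<Rightarrow> ((nat \<Rightarrow> real) \<Rightarrow> real) \<Rightarrow> bool" where
  "sup_lipschitz n L \<phi> \<longleftrightarrow> (\<forall>x y e. (\<forall>i<n. \<bar>x i - y i\<bar> \<le> e) \<longrightarrow> \<bar>\<phi> x - \<phi> y\<bar> \<le> L * e)"

lemma kern_const:
  assumes "l > 0" shows "kern l [:l/2:] u \<ge> 0" "(\<integral>u. kern l [:l/2:] u \<partial>lborel) = 1"
  using assms integrable_sech2_scaled[OF assms] sech2_pos
  by (auto simp: kern_def less_imp_le)

text \<open>Subtracting the same \<open>u\<close> from coordinate \<open>k\<close> of both points
  shifts them in parallel, and averaging against a nonnegative kernel of mass 1 keeps the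
  constant.\<close>

lemma conv_lipschitz:
  assumes "l > 0" "bcont \<phi>" "sup_lipschitz n L \<phi>"
  shows "sup_lipschitz n L (conv l k [:l/2:] \<phi>)"
  unfolding sup_lipschitz_def
proof (intro allI impI)
  fix x y :: "nat \<Rightarrow> real" and e assume e: "\<forall>i<n. \<bar>x i - y i\<bar> \<le> e"
  let ?q = "kern l [:l/2:]"
  have "\<bar>\<phi> (x(k := x k - u)) - \<phi> (y(k := y k - u))\<bar> \<le> L * e" for u
    using assms(3) e unfolding sup_lipschitz_def by auto
  then have b: "\<bar>\<phi> (x(k := x k - u)) * ?q u - \<phi> (y(k := y k - u)) * ?q u\<bar> \<le> L * e * ?q u" for u
    using kern_const(1)[OF assms(1), of u] by (simp flip: left_diff_distrib add: abs_mult mult_right_mono)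
  have "\<bar>conv l k [:l/2:] \<phi> x - conv l k [:l/2:] \<phi> y\<bar> = \<bar>\<integral>u. \<phi> (x(k := x k - u)) * ?q u - \<phi> (y(k := y k - u)) * ?q u \<partial>lborel\<bar>"
    unfolding conv_shift using integrable_conv(2)[OF assms(1,2)] by simp
  also have "\<dots> \<le> (\<integral>u. L * e * ?q u \<partial>lborel)"
    by (intro integral_abs_bound_integral b Bochner_Integration.integrable_diff Bochner_Integration.integrable_mult_right
        integrable_conv(2)[OF assms(1,2)] integrable_kern[OF assms(1)])
  also have "\<dots> = L * e" using kern_const(2)[OF assms(1)] by simp
  finally show "\<bar>conv l k [:l/2:] \<phi> x - conv l k [:l/2:] \<phi> y\<bar> \<le> L * e" .
qed

lemma mconv_lipschitz:
  assumes "l > 0" "bcont \<phi>" "sup_lipschitz n L \<phi>"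
  shows "sup_lipschitz n L (mconv l (\<lambda>_. [:l/2:]) \<phi> k)"
  by (induction k) (auto intro!: conv_lipschitz mconv_bcont assms)

text \<open>The threshold \<open>l0\<close> is uniform over all \<open>\<phi>\<close> with the given
  bounds, because it will be applied to partially mollified functions that themselves depend on
  \<open>l\<close>.\<close>

lemma conv_approx:
  assumes "L \<ge> 0" "C \<ge> 0" "e > 0"
  shows "\<exists>l0. \<forall>l>l0. \<forall>\<phi> k x. l > 0 \<longrightarrow> bcont \<phi> \<longrightarrow> (\<forall>x. \<bar>\<phi> x\<bar> \<le> C) \<longrightarrow> (\<forall>x u. \<bar>\<phi> (x(k := u)) - \<phi> x\<bar> \<le> L * \<bar>u - x k\<bar>) \<longrightarrow>
    \<bar>conv l k [:l/2:] \<phi> x - \<phi> x\<bar> \<le> e"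
proof -
  \<comment> \<open>The error bound after the substitution \<open>u = v / l\<close>. The minimum
    with \<open>2 * C\<close> supplies a dominating function that does not depend on
    \<open>l\<close>.\<close>
  define E where "E l = (\<integral>v. min (2 * C) (L * \<bar>v / l\<bar>) * (sech2 v / 2) \<partial>lborel)" for l
  note s = integrable_sech2_scaled(1)[of 1, simplified]
  have "(E \<longlongrightarrow> (\<integral>v. 0 \<partial>(lborel :: real measure))) at_top"
    unfolding E_def[abs_def]
  proof (rule integral_dominated_convergence_at_top[where w="\<lambda>v. 2 * C * (sech2 v / 2)"])
    show "AE v in lborel. ((\<lambda>l. min (2 * C) (L * \<bar>v / l\<bar>) * (sech2 v / 2)) \<longlongrightarrow> 0) at_top"
    proof (intro AE_I2)
      fix v :: real
      have "((\<lambda>l. v / l) \<longlongrightarrow> 0) at_top" by (intro real_tendsto_divide_at_top[OF tendsto_const] filterlim_ident)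
      then have "((\<lambda>l. min (2 * C) (L * \<bar>v / l\<bar>) * (sech2 v / 2)) \<longlongrightarrow> min (2 * C) (L * \<bar>0\<bar>) * (sech2 v / 2)) at_top"
        by (intro tendsto_intros)
      then show "((\<lambda>l. min (2 * C) (L * \<bar>v / l\<bar>) * (sech2 v / 2)) \<longlongrightarrow> 0) at_top"
        using assms by simp
    qed
    show "\<forall>\<^sub>F l in at_top. AE v in lborel. norm (min (2 * C) (L * \<bar>v / l\<bar>) * (sech2 v / 2)) \<le> 2 * C * (sech2 v / 2)"
      using assms sech2_pos by (intro always_eventually allI AE_I2) (auto simp: abs_mult less_imp_le intro!: mult_right_mono)
    show "(\<lambda>v. min (2 * C) (L * \<bar>v / l\<bar>) * (sech2 v / 2)) \<in> borel_measurable lborel" for l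
      using borel_measurable_integrable[OF s] by auto
  qed (use s in auto)
  then have "\<forall>\<^sub>F l in at_top. E l < e" using assms(3) by (intro order_tendstoD(2)[of E 0]) auto
  then obtain l0 where l0: "\<And>l. l > l0 \<Longrightarrow> E l < e" by (auto simp: eventually_at_top_dense)
  have "\<bar>conv l k [:l/2:] \<phi> x - \<phi> x\<bar> \<le> e" if l: "l > l0" "l > 0" and \<phi>: "bcont \<phi>" "\<forall>x. \<bar>\<phi> x\<bar> \<le> C"
     and Lp: "\<forall>x u. \<bar>\<phi> (x(k := u)) - \<phi> x\<bar> \<le> L * \<bar>u - x k\<bar>" for l \<phi> k x
  proof -
    let ?q = "kern l [:l/2:]"
    have m: "\<bar>\<phi> (x(k := x k - u)) - \<phi> x\<bar> \<le> min (2 * C) (L * \<bar>u\<bar>)" for u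
      using Lp[rule_format, of x "x k - u"] \<phi>(2)[rule_format, of x] \<phi>(2)[rule_format, of "x(k := x k - u)"] by auto
    have b: "\<bar>\<phi> (x(k := x k - u)) * ?q u - \<phi> x * ?q u\<bar> \<le> min (2 * C) (L * \<bar>u\<bar>) * ?q u" for u
      using kern_const(1)[OF l(2), of u] mult_right_mono[OF m[of u], of "?q u"] by (simp flip: left_diff_distrib add: abs_mult)
    have im: "integrable lborel (\<lambda>u. min (2 * C) (L * \<bar>u\<bar>) * ?q u)"
    proof (rule Bochner_Integration.integrable_bound[where f="\<lambda>u. 2 * C * ?q u"])
      show "(\<lambda>u. min (2 * C) (L * \<bar>u\<bar>) * ?q u) \<in> borel_measurable lborel"
        using borel_measurable_integrable[OF integrable_kern[OF l(2)]] by measurable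
      show "AE u in lborel. norm (min (2 * C) (L * \<bar>u\<bar>) * ?q u) \<le> norm (2 * C * ?q u)"
        using assms by (auto simp: abs_mult intro!: mult_right_mono)
    qed (use integrable_kern[OF l(2)] in simp)
    have "\<bar>conv l k [:l/2:] \<phi> x - \<phi> x\<bar> = \<bar>\<integral>u. \<phi> (x(k := x k - u)) * ?q u - \<phi> x * ?q u \<partial>lborel\<bar>"
      unfolding conv_shift using integrable_conv(2)[OF l(2) \<phi>(1)] kern_const(2)[OF l(2)] integrable_kern[OF l(2)] by simp
    also have "\<dots> \<le> (\<integral>u. min (2 * C) (L * \<bar>u\<bar>) * ?q u \<partial>lborel)"
      by (intro integral_abs_bound_integral b im Bochner_Integration.integrable_diff Bochner_Integration.integrable_mult_right
        integrable_conv(2)[OF l(2) \<phi>(1)] integrable_kern[OF l(2)])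
    also have "\<dots> = E l"
      unfolding E_def using l(2)
      by (subst lborel_integral_real_affine[where c="1/l" and t=0])
        (simp_all flip: integral_mult_right_zero add: kern_def mult.left_commute)
    finally show ?thesis using l0[OF l(1)] by simp
  qed
  then show ?thesis by blast
qed


lemma tendsto_product:
  fixes y :: "'c \<Rightarrow> nat \<Rightarrow> real"
  assumes "\<And>j. ((\<lambda>m. y m j) \<longlongrightarrow> x j) F"
  shows "(y \<longlongrightarrow> x) F"
  using assms by (auto simp: limitin_componentwise simp flip: limitin_canonical_iff euclidean_product_topology)

text \<open>Moving every coordinate by \<open>s\<close> in the direction of the sign of its partial
  derivative changes \<open>\<psi>\<close> by about \<open>s\<close> times the \<open>l^1\<close>
  norm of the gradient, while the move has maximum norm at most \<open>s\<close>. Then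
  \<open>s\<close> tends to 0.\<close>

lemma gradient_l1_le:
  assumes D: "\<And>i x a. i < n \<Longrightarrow> ((\<lambda>v. \<psi> (x(i := v))) has_real_derivative g i (x(i := a))) (at a)"
    and g: "\<And>i. i < n \<Longrightarrow> continuous_on UNIV (g i)"
    and Lp: "sup_lipschitz n L \<psi>"
  shows "(\<Sum>i<n. \<bar>g i x\<bar>) \<le> L"
proof -
  define \<sigma> where "\<sigma> i = sgn (g i x)" for i
  define s where "s m = 1 / real (Suc m)" for m
  have s: "s m > 0" for m by (simp add: s_def)
  have s0: "s \<longlonglongrightarrow> 0" unfolding s_def by (rule lim_1_over_n[THEN LIMSEQ_Suc])
  \<comment> \<open>The first \<open>k\<close> coordinates have already been moved, so consecutive
    points differ in coordinate \<open>k\<close> only and the one-dimensional mean value theorem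
    applies.\<close>
  define z where "z m k = (\<lambda>j. if j < k then x j + s m * \<sigma> j else x j)" for m k
  have zS: "z m (Suc k) = (z m k)(k := x k + s m * \<sigma> k)" for m k
    by (auto simp: z_def fun_eq_iff)
  have "\<exists>\<xi>. \<bar>\<xi> - x k\<bar> \<le> s m \<and> \<psi> (z m (Suc k)) - \<psi> (z m k) = s m * \<sigma> k * g k ((z m k)(k := \<xi>))" if "k < n" for m k
  proof -
    let ?f = "\<lambda>v. \<psi> ((z m k)(k := v))"
    have zk: "(z m k)(k := x k) = z m k" by (auto simp: z_def fun_eq_iff)
    have d: "(?f has_real_derivative g k ((z m k)(k := v))) (at v)" for v
      by (rule D[OF that])
    consider "\<sigma> k = 0" | "\<sigma> k = 1" | "\<sigma> k = -1" unfolding \<sigma>_def sgn_if by metis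
    then show ?thesis
    proof cases
      case 1 then show ?thesis using s[of m] zk by (intro exI[of _ "x k"]) (auto simp: zS)
    next
      case 2
      obtain \<xi> where "x k < \<xi>" "\<xi> < x k + s m" "?f (x k + s m) - ?f (x k) = (x k + s m - x k) * g k ((z m k)(k := \<xi>))"
        using MVT2[of "x k" "x k + s m" ?f "\<lambda>v. g k ((z m k)(k := v))"] d s[of m] by auto
      then show ?thesis using 2 zk by (intro exI[of _ \<xi>]) (auto simp: zS)
    next
      case 3
      obtain \<xi> where "x k - s m < \<xi>" "\<xi> < x k" "?f (x k) - ?f (x k - s m) = (x k - (x k - s m)) * g k ((z m k)(k := \<xi>))"
        using MVT2[of "x k - s m" "x k" ?f "\<lambda>v. g k ((z m k)(k := v))"] d s[of m] by auto
      then show ?thesis using 3 zk by (intro exI[of _ \<xi>]) (auto simp: zS)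
    qed
  qed
  then have "\<forall>m k. \<exists>\<xi>. k < n \<longrightarrow> \<bar>\<xi> - x k\<bar> \<le> s m \<and> \<psi> (z m (Suc k)) - \<psi> (z m k) = s m * \<sigma> k * g k ((z m k)(k := \<xi>))"
    by blast
  then obtain \<xi> where "\<forall>m k. k < n \<longrightarrow> \<bar>\<xi> m k - x k\<bar> \<le> s m \<and> \<psi> (z m (Suc k)) - \<psi> (z m k) = s m * \<sigma> k * g k ((z m k)(k := \<xi> m k))"
    by metis
  then have \<xi>: "\<And>m k. k < n \<Longrightarrow> \<bar>\<xi> m k - x k\<bar> \<le> s m"
    "\<And>m k. k < n \<Longrightarrow> \<psi> (z m (Suc k)) - \<psi> (z m k) = s m * \<sigma> k * g k ((z m k)(k := \<xi> m k))"
    by blast+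
  have b: "(\<Sum>k<n. \<sigma> k * g k ((z m k)(k := \<xi> m k))) \<le> L" for m
  proof -
    have "s m * (\<Sum>k<n. \<sigma> k * g k ((z m k)(k := \<xi> m k))) = (\<Sum>k<n. \<psi> (z m (Suc k)) - \<psi> (z m k))"
      using \<xi>(2) by (simp add: sum_distrib_left mult.assoc)
    also have "\<dots> = \<psi> (z m n) - \<psi> (z m 0)" by (rule sum_lessThan_telescope)
    also have "\<dots> \<le> L * s m"
    proof -
      have "\<forall>i<n. \<bar>z m n i - z m 0 i\<bar> \<le> s m" using s[of m] by (auto simp: z_def abs_mult \<sigma>_def sgn_if)
      then have "\<bar>\<psi> (z m n) - \<psi> (z m 0)\<bar> \<le> L * s m" using Lp unfolding sup_lipschitz_def by blast
      then show ?thesis by simp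
    qed
    finally show ?thesis using s[of m] by (simp add: mult.commute)
  qed
  have "(\<lambda>m. \<Sum>k<n. \<sigma> k * g k ((z m k)(k := \<xi> m k))) \<longlonglongrightarrow> (\<Sum>k<n. \<sigma> k * g k x)"
  proof (intro tendsto_intros)
    fix k assume "k \<in> {..<n}" then have k: "k < n" by simp
    have "(\<lambda>m. (z m k)(k := \<xi> m k)) \<longlonglongrightarrow> x"
    proof (rule tendsto_product)
      fix j
      show "(\<lambda>m. ((z m k)(k := \<xi> m k)) j) \<longlonglongrightarrow> x j"
      proof (cases "j = k")
        case True
        have "(\<lambda>m. \<xi> m k - x k) \<longlonglongrightarrow> 0"
          by (rule Lim_null_comparison[OF _ s0]) (use \<xi>(1)[OF k] in auto)
        then show ?thesis using True by (simp add: LIM_zero_iff)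
      next
        case False
        have "(\<lambda>m. if j < k then x j + s m * \<sigma> j else x j) \<longlonglongrightarrow> x j"
          using tendsto_add[OF tendsto_const[of "x j"] tendsto_mult_left_zero[OF s0, of "\<sigma> j"]] by (cases "j < k") auto
        then show ?thesis using False by (simp add: z_def)
      qed
    qed
    then show "(\<lambda>m. g k ((z m k)(k := \<xi> m k))) \<longlonglongrightarrow> g k x"
      using g[OF k] isCont_tendsto_compose[of x "g k"] by (simp add: continuous_on_eq_continuous_at)
  qed
  then have "(\<Sum>k<n. \<sigma> k * g k x) \<le> L" using b by (intro LIMSEQ_le_const2) auto
  then show ?thesis by (simp add: \<sigma>_def abs_sgn mult.commute)
qed

lemma sup_lipschitz_bcont:
  assumes "sup_lipschitz n L \<phi>" "\<And>x. \<bar>\<phi> x\<bar> \<le> C"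
  shows "bcont \<phi>"
proof -
  have "continuous_on UNIV \<phi>"
    unfolding continuous_on_sequentially
  proof (intro allI ballI impI, elim conjE)
    fix y :: "nat \<Rightarrow> nat \<Rightarrow> real" and x assume y: "y \<longlonglongrightarrow> x"
    have c: "(\<lambda>m. y m j) \<longlonglongrightarrow> x j" for j
    proof -
      have "continuous_on UNIV (\<lambda>x :: nat \<Rightarrow> real. x j)" by (rule continuous_on_product_coordinates)
      then have "isCont (\<lambda>x :: nat \<Rightarrow> real. x j) x" using continuous_on_eq_continuous_at[OF open_UNIV] by blast
      then show ?thesis by (rule isCont_tendsto_compose[OF _ y])
    qed
    have "(\<lambda>m. L * (\<Sum>j<n. \<bar>y m j - x j\<bar>)) \<longlonglongrightarrow> L * (\<Sum>j<n. \<bar>x j - x j\<bar>)"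
      by (intro tendsto_intros c)
    then have "(\<lambda>m. L * (\<Sum>j<n. \<bar>y m j - x j\<bar>)) \<longlonglongrightarrow> 0" by simp
    moreover have "\<bar>\<phi> (y m) - \<phi> x\<bar> \<le> L * (\<Sum>j<n. \<bar>y m j - x j\<bar>)" for m
    proof -
      have "\<forall>i<n. \<bar>y m i - x i\<bar> \<le> (\<Sum>j<n. \<bar>y m j - x j\<bar>)"
        by (auto intro!: member_le_sum[where f="\<lambda>j. \<bar>y m j - x j\<bar>"])
      then show ?thesis using assms(1) unfolding sup_lipschitz_def by blast
    qed
    ultimately have "(\<lambda>m. \<phi> (y m) - \<phi> x) \<longlonglongrightarrow> 0"
      by (intro Lim_null_comparison[where f="\<lambda>m. \<phi> (y m) - \<phi> x"]) auto
    then show "(\<phi> \<circ> y) \<longlonglongrightarrow> \<phi> x" by (simp add: LIM_zero_iff comp_def)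
  qed
  then show ?thesis using assms(2) by (auto simp: bcont_def bounded_real)
qed

text \<open>The instance \<open>e = 0\<close>: quantifying over arbitrary bounds \<open>e\<close>
  makes the Lipschitz condition include the dependence on finitely many coordinates.\<close>

lemma sup_lipschitz_depends:
  assumes "sup_lipschitz n L \<phi>" "\<forall>i<n. x i = y i" shows "\<phi> x = \<phi> y"
  using assms(1)[unfolded sup_lipschitz_def, THEN spec, THEN spec, THEN spec, of x y 0] assms(2) by auto

lemma smooth_approx:
  assumes Lp: "sup_lipschitz n L \<phi>" and C: "\<And>x. \<bar>\<phi> x\<bar> \<le> C" and L: "L \<ge> 0" and e: "e > 0"
  shows "\<exists>\<psi>. Cb_smooth n \<psi> \<and> (\<forall>x. (\<Sum>i<n. \<bar>partial i \<psi> x\<bar>) \<le> L) \<and> (\<forall>x. \<bar>\<psi> x - \<phi> x\<bar> \<le> e)"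
proof -
  have bc: "bcont \<phi>" by (rule sup_lipschitz_bcont[OF Lp C])
  have C0: "C \<ge> 0" using C[of undefined] by linarith
  \<comment> \<open>Each of the \<open>n\<close> mollified coordinates may cost \<open>d\<close>;
    dividing by \<open>Suc n\<close> avoids a division by zero.\<close>
  define d where "d = e / real (Suc n)"
  have d: "d > 0" using e by (simp add: d_def)
  obtain l0 where l0: "\<And>l \<phi> k x. l > l0 \<Longrightarrow> l > 0 \<Longrightarrow> bcont \<phi> \<Longrightarrow> (\<forall>x. \<bar>\<phi> x\<bar> \<le> C) \<Longrightarrow> (\<forall>x u. \<bar>\<phi> (x(k := u)) - \<phi> x\<bar> \<le> L * \<bar>u - x k\<bar>) \<Longrightarrow>
    \<bar>conv l k [:l/2:] \<phi> x - \<phi> x\<bar> \<le> d"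
    using conv_approx[OF L C0 d] by metis
  define l where "l = max l0 0 + 1"
  have l: "l > 0" "l > l0" by (auto simp: l_def)
  define \<psi> where "\<psi> = mconv l (\<lambda>_. [:l/2:]) \<phi>"
  have \<psi>bc: "bcont (\<psi> k)" for k unfolding \<psi>_def by (rule mconv_bcont[OF l(1) bc])
  have \<psi>L: "sup_lipschitz n L (\<psi> k)" for k unfolding \<psi>_def by (rule mconv_lipschitz[OF l(1) bc Lp])
  have \<psi>C: "\<bar>\<psi> k x\<bar> \<le> C" for k x
  proof (induction k arbitrary: x)
    case (Suc k)
    have "\<bar>conv l k [:l/2:] (\<psi> k) x\<bar> \<le> (\<integral>u. C * kern l [:l/2:] u \<partial>lborel)"
      unfolding conv_shift
    proof (intro integral_abs_bound_integral integrable_conv(2)[OF l(1) \<psi>bc] Bochner_Integration.integrable_mult_right integrable_kern l)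
      fix u show "\<bar>\<psi> k (x(k := x k - u)) * kern l [:l/2:] u\<bar> \<le> C * kern l [:l/2:] u"
        using Suc kern_const(1)[OF l(1)] by (auto simp: abs_mult intro!: mult_right_mono)
    qed
    then show ?case using kern_const(2)[OF l(1)] by (simp add: \<psi>_def)
  qed (use C in \<open>simp add: \<psi>_def\<close>)
  have "\<bar>\<psi> (Suc k) x - \<psi> k x\<bar> \<le> d" for k x
  proof -
    have "\<bar>\<psi> k (x(k := u)) - \<psi> k x\<bar> \<le> L * \<bar>u - x k\<bar>" for x u
      using \<psi>L[of k, unfolded sup_lipschitz_def, THEN spec, THEN spec, THEN spec, of "x(k := u)" x "\<bar>u - x k\<bar>"] by auto
    then show ?thesis using l0[OF l(2,1) \<psi>bc[of k], of k x] \<psi>C by (simp add: \<psi>_def)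
  qed
  then have "\<bar>\<psi> k x - \<phi> x\<bar> \<le> k * d" for k x
  proof (induction k)
    case (Suc k)
    have "\<bar>\<psi> (Suc k) x - \<psi> k x\<bar> \<le> d" "\<bar>\<psi> k x - \<phi> x\<bar> \<le> k * d" using Suc by auto
    then show ?case by (simp add: algebra_simps)
  qed (simp add: \<psi>_def)
  moreover have "n * d \<le> e" using e by (simp add: d_def field_simps)
  ultimately have 1: "\<bar>\<psi> n x - \<phi> x\<bar> \<le> e" for x using order_trans by blast
  have 2: "Cb_smooth n (\<psi> n)"
    unfolding \<psi>_def by (rule Cb_smooth_mconv[OF l(1) bc]) (rule sup_lipschitz_depends[OF Lp])
  have 3: "(\<Sum>i<n. \<bar>partial i (\<psi> n) x\<bar>) \<le> L" for x
  proof (rule gradient_l1_le[where \<psi>="\<psi> n" and g="\<lambda>i. partial i (\<psi> n)", OF _ _ \<psi>L])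
    fix i assume i: "i < n"
    show "((\<lambda>v. \<psi> n (x(i := v))) has_real_derivative partial i (\<psi> n) (x(i := a))) (at a)" for x a
      unfolding \<psi>_def partial_mconv[OF l(1) bc i] by (rule mconv_DERIV[OF l(1) bc i])
    show "continuous_on UNIV (partial i (\<psi> n))"
      unfolding \<psi>_def partial_mconv[OF l(1) bc i] using mconv_bcont[OF l(1) bc] by (simp add: bcont_def)
  qed
  show ?thesis using 1 2 3 by blast
qed

section \<open>A criterion for Malliavin differentiability\<close>


lemma bcont_const [intro]: "bcont (\<lambda>x. c)"
  by (auto simp: bcont_def intro!: bounded_subset[of "{c}"])

lemma bcont_add [intro]: "bcont f \<Longrightarrow> bcont g \<Longrightarrow> bcont (\<lambda>x. f x + g x)"
  by (auto simp: bcont_def intro!: continuous_intros bounded_plus_comp)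

lemma bcont_mult [intro]: assumes "bcont f" "bcont g" shows "bcont (\<lambda>x. f x * g x)"
proof -
  obtain C D where "\<And>x. \<bar>f x\<bar> \<le> C" "\<And>x. \<bar>g x\<bar> \<le> D" "C \<ge> 0" "D \<ge> 0" using assms[THEN bcont_bound] by metis
  then have "\<bar>f x * g x\<bar> \<le> C * D" for x by (auto simp: abs_mult intro!: mult_mono)
  then show ?thesis using assms by (auto simp: bcont_def bounded_real intro!: continuous_intros)
qed

lemma partial_eq_0:
  assumes "\<And>x y. (\<forall>j<n. x j = y j) \<Longrightarrow> \<psi> x = \<psi> y" "n \<le> i"
  shows "partial i \<psi> = (\<lambda>x. 0)"
proof
  fix x
  have "\<psi> (x(i := u)) = \<psi> x" for u by (rule assms(1)) (use assms(2) in auto)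
  then show "partial i \<psi> x = 0" by (simp add: partial_def)
qed

lemma foldr_partial_depends:
  assumes "\<And>x y. (\<forall>j<n. x j = y j) \<Longrightarrow> \<psi> x = \<psi> y" "set is \<subseteq> {..<n}" "\<forall>j<n. x j = y j"
  shows "foldr partial is \<psi> x = foldr partial is \<psi> y"
  using assms(2,3)
proof (induction "is" arbitrary: x y)
  case Nil
  then show ?case using assms(1)[of x y] by simp
next
  case (Cons i "is")
  have "foldr partial is \<psi> (x(i := u)) = foldr partial is \<psi> (y(i := u))" for u
    by (rule Cons.IH) (use Cons.prems in auto)
  moreover have "x i = y i" using Cons.prems by auto
  ultimately show ?case unfolding foldr.simps comp_apply partial_def[of i] by presburger
qed

lemma foldr_partial_zero: "foldr partial is (\<lambda>x. 0) = (\<lambda>x. 0)"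
  by (induction "is") (auto simp: partial_def fun_eq_iff)

text \<open>A derivative in a coordinate beyond the first \<open>n\<close> is zero, and further
  derivatives of zero vanish. Thus the smoothness conditions for more variables reduce to those for
  \<open>n\<close>.\<close>

lemma foldr_partial_cases:
  assumes "\<And>x y. (\<forall>j<n. x j = y j) \<Longrightarrow> \<psi> x = \<psi> y"
  shows "set is \<subseteq> {..<n} \<or> foldr partial is \<psi> = (\<lambda>x. 0)"
proof (induction "is")
  case (Cons i "is")
  show ?case
  proof (cases "set is \<subseteq> {..<n}")
    case True
    show ?thesis
    proof (cases "i < n")
      case False
      have "partial i (foldr partial is \<psi>) = (\<lambda>x. 0)"
        by (rule partial_eq_0[OF foldr_partial_depends[OF assms True]]) (use False in auto)
      then show ?thesis by simp
    qed (use True in simp)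
  next
    case False
    then have "foldr partial is \<psi> = (\<lambda>x. 0)" using Cons by blast
    then show ?thesis using foldr_partial_zero[of "[i]"] by simp
  qed
qed simp

lemma Cb_smooth_depends: "Cb_smooth n \<psi> \<Longrightarrow> (\<forall>j<n. x j = y j) \<Longrightarrow> \<psi> x = \<psi> y"
  by (simp add: Cb_smooth_def)

lemma Cb_smooth_mono:
  assumes "Cb_smooth n \<psi>" "n \<le> m"
  shows "Cb_smooth m \<psi>"
  unfolding Cb_smooth_def
proof (intro conjI allI impI)
  note dep = Cb_smooth_depends[OF assms(1)]
  show "\<psi> x = \<psi> y" if "\<forall>i<m. x i = y i" for x y using dep[of x y] that assms(2) by auto
  fix "is" assume "set is \<subseteq> {..<m}"
  have c: "set is \<subseteq> {..<n} \<or> foldr partial is \<psi> = (\<lambda>x. 0)" by (rule foldr_partial_cases[OF dep])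
  then show "continuous_on UNIV (foldr partial is \<psi>)" "bounded (range (foldr partial is \<psi>))"
    using assms(1) unfolding Cb_smooth_def by (auto simp: image_constant_conv)
  fix i x assume "i < m"
  show "(\<lambda>u. foldr partial is \<psi> (x(i := u))) differentiable at (x i)"
  proof (cases "foldr partial is \<psi> = (\<lambda>x. 0)")
    case False
    then have s: "set is \<subseteq> {..<n}" using c by blast
    show ?thesis
    proof (cases "i < n")
      case True then show ?thesis using assms(1) s unfolding Cb_smooth_def by blast
    next
      case False
      have "foldr partial is \<psi> (x(i := u)) = foldr partial is \<psi> x" for u
        by (rule foldr_partial_depends[OF dep s]) (use False in auto)
      then show ?thesis by simp
    qed
  qed simp
qed

lemma Cb_smooth_partial:
  assumes "Cb_smooth n \<psi>"
  shows "bcont \<psi>" "bcont (partial i \<psi>)" "(\<lambda>u. \<psi> (x(i := u))) differentiable at (x i)"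
    "n \<le> i \<Longrightarrow> partial i \<psi> x = 0"
proof -
  \<comment> \<open>Viewed as a function of \<open>m\<close> variables, \<open>\<psi>\<close> may be
    differentiated in coordinate \<open>i\<close> even if \<open>i\<close> is not below
    \<open>n\<close>.\<close>
  define m where "m = max n (Suc i)"
  have m: "i < m" by (simp add: m_def)
  have s: "Cb_smooth m \<psi>" by (rule Cb_smooth_mono[OF assms]) (auto simp: m_def)
  have *: "set is \<subseteq> {..<m} \<Longrightarrow> continuous_on UNIV (foldr partial is \<psi>) \<and>
        bounded (range (foldr partial is \<psi>)) \<and>
        (\<forall>i<m. \<forall>x. (\<lambda>u. foldr partial is \<psi> (x(i := u))) differentiable (at (x i)))" for "is"
    by (rule s[unfolded Cb_smooth_def, THEN conjunct2, THEN spec, THEN mp])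
  show "bcont \<psi>" "bcont (partial i \<psi>)" "(\<lambda>u. \<psi> (x(i := u))) differentiable at (x i)"
    using *[of "[]"] *[of "[i]"] m by (simp_all add: bcont_def del: fun_upd_apply)
  show "partial i \<psi> x = 0" if ni: "n \<le> i"
  proof -
    have "partial i \<psi> = (\<lambda>x. 0)" by (rule partial_eq_0[OF Cb_smooth_depends[OF assms] ni])
    then show ?thesis by simp
  qed
qed

lemma Cb_smooth_partial_nonzero: "Cb_smooth n \<psi> \<Longrightarrow> partial i \<psi> x \<noteq> 0 \<Longrightarrow> i < n"
  using Cb_smooth_partial(4) by (meson not_le)

lemma deriv_lincomb:
  assumes "f differentiable at (a::real)" "g differentiable at a"
  shows "deriv (\<lambda>u. c * f u + d * g u) a = c * deriv f a + d * deriv g (a::real)"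
  using assms unfolding DERIV_deriv_iff_real_differentiable[symmetric]
  by (intro DERIV_imp_deriv DERIV_add DERIV_cmult)

lemma partial_lincomb:
  assumes "\<And>x. (\<lambda>u. f (x(i := u))) differentiable at (x i)" "\<And>x. (\<lambda>u. g (x(i := u))) differentiable at (x i)"
  shows "partial i (\<lambda>x. c * f x + d * g x) = (\<lambda>x. c * partial i f x + d * partial i g x)"
  unfolding partial_def by (intro ext deriv_lincomb assms)

lemma Cb_smooth_lincomb:
  assumes "Cb_smooth n f" "Cb_smooth n g"
  shows "Cb_smooth n (\<lambda>x. c * f x + d * g x)"
  unfolding Cb_smooth_def
proof (intro conjI allI impI)
  show "c * f x + d * g x = c * f y + d * g y" if "\<forall>i<n. x i = y i" for x y
    using Cb_smooth_depends[OF assms(1) that] Cb_smooth_depends[OF assms(2) that] by simp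
  note f = assms(1)[unfolded Cb_smooth_def, THEN conjunct2, rule_format]
  note g = assms(2)[unfolded Cb_smooth_def, THEN conjunct2, rule_format]
  have eq: "set is \<subseteq> {..<n} \<Longrightarrow> foldr partial is (\<lambda>x. c * f x + d * g x) = (\<lambda>x. c * foldr partial is f x + d * foldr partial is g x)" for "is"
  proof (induction "is")
    case (Cons i "is")
    then have "foldr partial (i # is) (\<lambda>x. c * f x + d * g x) = partial i (\<lambda>x. c * foldr partial is f x + d * foldr partial is g x)"
      by simp
    also have "\<dots> = (\<lambda>x. c * partial i (foldr partial is f) x + d * partial i (foldr partial is g) x)"
      using Cons.prems f[of "is"] g[of "is"] by (intro partial_lincomb) auto
    finally show ?case by simp
  qed simp
  fix "is" assume s: "set is \<subseteq> {..<n}"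
  have bc: "bcont (foldr partial is f)" "bcont (foldr partial is g)" using f[OF s] g[OF s] by (auto simp: bcont_def)
  then have "bcont (\<lambda>x. c * foldr partial is f x + d * foldr partial is g x)"
    by (intro bcont_add bcont_mult bcont_const)
  then show "continuous_on UNIV (foldr partial is (\<lambda>x. c * f x + d * g x))" "bounded (range (foldr partial is (\<lambda>x. c * f x + d * g x)))"
    unfolding eq[OF s] bcont_def by auto
  show "(\<lambda>u. foldr partial is (\<lambda>x. c * f x + d * g x) (x(i := u))) differentiable at (x i)" if "i < n" for i x
    unfolding eq[OF s] using f[OF s] g[OF s] that by (intro derivative_intros) auto
qed

text \<open>With the parallelogram identity for \<open>d\<close>, this replaces weak compactness when a sequence that
  is merely bounded in the Sobolev norm has to be made convergent.\<close>

lemma near_minimisers_Cauchy: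
  fixes C :: "nat \<Rightarrow> 'b set" and v :: "'b \<Rightarrow> real" and d :: "'b \<Rightarrow> 'b \<Rightarrow> real"
  assumes ne: "\<And>n. C n \<noteq> {}" and dec: "\<And>m n. m \<le> n \<Longrightarrow> C n \<subseteq> C m"
    and mid: "\<And>n x y. x \<in> C n \<Longrightarrow> y \<in> C n \<Longrightarrow> mid x y \<in> C n"
    and v0: "\<And>x. x \<in> C 0 \<Longrightarrow> v x \<ge> 0" and bd: "\<And>x. x \<in> C 0 \<Longrightarrow> v x \<le> K"
    and d: "\<And>x y. x \<in> C 0 \<Longrightarrow> y \<in> C 0 \<Longrightarrow> d x y = 2 * v x + 2 * v y - 4 * v (mid x y)"
  shows "\<exists>y. (\<forall>n. y n \<in> C n) \<and> (\<forall>e>0. \<exists>N. \<forall>k\<ge>N. \<forall>l\<ge>N. d (y k) (y l) < e)"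
proof -
  define \<delta> where "\<delta> n = Inf (v ` C n)" for n
  have C0: "x \<in> C 0" if "x \<in> C n" for x n using dec[OF le0, of n] that by auto
  have bb: "bdd_below (v ` C n)" for n using v0 C0 by (auto intro!: bdd_belowI[of _ 0])
  have le: "\<delta> n \<le> v x" if "x \<in> C n" for x n unfolding \<delta>_def using that bb by (auto intro!: cInf_lower)
  have "\<exists>x\<in>C n. v x < \<delta> n + 1 / real (Suc n)" for n
    using cInf_lessD[of "v ` C n" "\<delta> n + 1 / real (Suc n)"] ne by (auto simp: \<delta>_def)
  then obtain y where y: "\<And>n. y n \<in> C n" "\<And>n. v (y n) < \<delta> n + 1 / real (Suc n)" by metis
  have mono: "\<delta> m \<le> \<delta> n" if "m \<le> n" for m n
    unfolding \<delta>_def using ne[of n] bb dec[OF that] by (intro cInf_superset_mono) auto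
  have K: "\<delta> n \<le> K" for n using le[OF y(1)[of n]] bd[OF C0[OF y(1)]] by (meson order_trans)
  obtain D where D: "\<delta> \<longlonglongrightarrow> D" "\<And>n. \<delta> n \<le> D"
    using incseq_convergent[of \<delta> K] mono K by (auto simp: incseq_def)
  have "\<exists>N. \<forall>k\<ge>N. \<forall>l\<ge>N. d (y k) (y l) < e" if e: "e > 0" for e
  proof -
    \<comment> \<open>For \<open>k, l \<ge> N\<close> the midpoint lies in \<open>C N\<close>, so
      \<open>v\<close> is at least \<open>\<delta> N\<close> there, while \<open>v (y k)\<close> and
      \<open>v (y l)\<close> are below \<open>D + 1 / real (Suc N)\<close>. The identity for
      \<open>d\<close> turns this into the quantity considered here.\<close>
    have "(\<lambda>n. 4 * (D - \<delta> n) + 4 * (1 / real (Suc n))) \<longlonglongrightarrow> 4 * (D - D) + 4 * 0"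
      by (intro tendsto_intros D lim_1_over_n[THEN LIMSEQ_Suc])
    then have "\<forall>\<^sub>F n in sequentially. 4 * (D - \<delta> n) + 4 * (1 / real (Suc n)) < e"
      using e by (intro order_tendstoD) auto
    then obtain N where N: "4 * (D - \<delta> N) + 4 * (1 / real (Suc N)) < e"
      by (auto simp: eventually_sequentially)
    have "d (y k) (y l) < e" if "k \<ge> N" "l \<ge> N" for k l
    proof -
      have "y k \<in> C N" "y l \<in> C N" using y(1) dec that by blast+
      then have "\<delta> N \<le> v (mid (y k) (y l))" by (intro le mid)
      moreover have "1 / real (Suc k) \<le> 1 / real (Suc N)" "1 / real (Suc l) \<le> 1 / real (Suc N)"
        using that by (auto simp: field_simps)
      ultimately show ?thesis using d[OF C0[OF y(1)] C0[OF y(1)], of k l] y(2)[of k] y(2)[of l] D(2)[of k] D(2)[of l] N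
        by simp
    qed
    then show ?thesis by blast
  qed
  then show ?thesis using y(1) by blast
qed

text \<open>The times \<open>\<tau> i\<close> may repeat, whereas \<open>step_jump\<close> sees only
  the total jump at a time; grouping the indices by the value of \<open>\<tau>\<close> reconciles
  the two.\<close>

lemma step_inner_sum:
  assumes K: "finite K" "\<And>i. i \<in> K \<Longrightarrow> \<tau> i \<ge> 0"
  shows "step_inner H (\<lambda>s. \<Sum>i\<in>K. g i * indicator {0..\<tau> i} s) (\<lambda>s. \<Sum>i\<in>K. g i * indicator {0..\<tau> i} s)
    = (\<Sum>i\<in>K. \<Sum>j\<in>K. g i * g j * fbm_cov H (\<tau> i) (\<tau> j))"
proof -
  define c where "c t = (\<Sum>i | i \<in> K \<and> \<tau> i = t. g i)" for t
  let ?A = "\<tau> ` K" let ?f = "\<lambda>s. \<Sum>i\<in>K. g i * indicator {0..\<tau> i} s"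
  have f: "?f = (\<lambda>s. \<Sum>t\<in>?A. c t * indicator {0..t} s)"
    by (rule ext, subst sum.image_gen[OF K(1), of _ \<tau>]) (auto simp: c_def sum_distrib_right intro!: sum.cong)
  have j: "step_jump ?f r = (if r \<in> ?A then c r else 0)" for r
    unfolding f by (rule step_jump_sum) (use K in auto)
  have sub: "{t. step_jump ?f t \<noteq> 0} \<subseteq> ?A" using j by auto
  have fA: "finite ?A" using K by auto
  have swap: "(\<Sum>i\<in>K. g i * h (\<tau> i)) = (\<Sum>t\<in>?A. c t * h t)" for h :: "real \<Rightarrow> real"
    by (subst sum.image_gen[OF K(1), of _ \<tau>]) (auto simp: c_def sum_distrib_right intro!: sum.cong)
  have "step_inner H ?f ?f = (\<Sum>t\<in>{t. step_jump ?f t \<noteq> 0}. step_jump ?f t * (\<Sum>s\<in>{t. step_jump ?f t \<noteq> 0}. step_jump ?f s * fbm_cov H t s))"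
    unfolding step_inner_def by (simp add: sum_distrib_left mult.assoc)
  also have "\<dots> = (\<Sum>t\<in>?A. step_jump ?f t * (\<Sum>s\<in>?A. step_jump ?f s * fbm_cov H t s))"
    by (simp add: sum.mono_neutral_left[OF fA sub])
  also have "\<dots> = (\<Sum>t\<in>?A. c t * (\<Sum>s\<in>?A. c s * fbm_cov H t s))"
    using j by (intro sum.cong refl) simp
  also have "\<dots> = (\<Sum>i\<in>K. g i * (\<Sum>j\<in>K. g j * fbm_cov H (\<tau> i) (\<tau> j)))"
    by (simp flip: swap)
  finally show ?thesis by (simp add: sum_distrib_left mult.assoc)
qed

lemma square_integrable_mult:
  assumes "square_integrable M F" "square_integrable M G"
  shows "integrable M (\<lambda>\<omega>. F \<omega> * G \<omega>)"
proof (rule Bochner_Integration.integrable_bound[where f="\<lambda>\<omega>. (F \<omega>)\<^sup>2 + (G \<omega>)\<^sup>2"])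
  show "AE \<omega> in M. norm (F \<omega> * G \<omega>) \<le> norm ((F \<omega>)\<^sup>2 + (G \<omega>)\<^sup>2)"
  proof (intro AE_I2)
    fix \<omega>
    have "2 * (\<bar>F \<omega>\<bar> * \<bar>G \<omega>\<bar>) \<le> (F \<omega>)\<^sup>2 + (G \<omega>)\<^sup>2"
      using sum_squares_bound[of "\<bar>F \<omega>\<bar>" "\<bar>G \<omega>\<bar>"] by (simp add: mult.assoc)
    moreover have "0 \<le> \<bar>F \<omega>\<bar> * \<bar>G \<omega>\<bar>" by simp
    ultimately have "\<bar>F \<omega>\<bar> * \<bar>G \<omega>\<bar> \<le> (F \<omega>)\<^sup>2 + (G \<omega>)\<^sup>2" by linarith
    then show "norm (F \<omega> * G \<omega>) \<le> norm ((F \<omega>)\<^sup>2 + (G \<omega>)\<^sup>2)"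
      by (simp add: abs_mult)
  qed
qed (use assms in \<open>auto simp: square_integrable_def\<close>)

lemma square_integrable_lincomb:
  assumes "square_integrable M F" "square_integrable M G"
  shows "square_integrable M (\<lambda>\<omega>. c * F \<omega> + d * G \<omega>)"
proof -
  have "integrable M (\<lambda>\<omega>. c\<^sup>2 * (F \<omega>)\<^sup>2 + d\<^sup>2 * (G \<omega>)\<^sup>2 + 2 * c * d * (F \<omega> * G \<omega>))"
    using assms square_integrable_mult[OF assms]
    by (intro Bochner_Integration.integrable_add Bochner_Integration.integrable_mult_right)
       (auto simp: square_integrable_def)
  then have "integrable M (\<lambda>\<omega>. (c * F \<omega> + d * G \<omega>)\<^sup>2)"
    by (simp add: power2_sum power_mult_distrib mult_ac)
  then show ?thesis using assms by (auto simp: square_integrable_def)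
qed

lemma bcont_sum [intro]: "(\<And>i. i \<in> A \<Longrightarrow> bcont (f i)) \<Longrightarrow> bcont (\<lambda>x. \<Sum>i\<in>A. f i x)"
  by (induction A rule: infinite_finite_induct) auto

lemma fbm_cov_bound:
  assumes "s \<in> {0..T}" "t \<in> {0..T}" "H > 0"
  shows "\<bar>fbm_cov H s t\<bar> \<le> 2 * T powr (2 * H)"
proof -
  have "s powr (2 * H) \<le> T powr (2 * H)" "t powr (2 * H) \<le> T powr (2 * H)" "\<bar>s - t\<bar> powr (2 * H) \<le> T powr (2 * H)"
    using assms by (auto intro!: powr_mono2)
  moreover have "0 \<le> s powr (2 * H)" "0 \<le> t powr (2 * H)" "0 \<le> \<bar>s - t\<bar> powr (2 * H)" "0 \<le> T powr (2 * H)"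
    by auto
  moreover have "\<bar>(a + b - c) / 2\<bar> \<le> 2 * K" if "a \<le> K" "b \<le> K" "c \<le> K" "0 \<le> a" "0 \<le> b" "0 \<le> c" for a b c K :: real
    using that by (simp add: abs_le_iff)
  ultimately show ?thesis unfolding fbm_cov_def by blast
qed

text \<open>The covariance form at the times \<open>\<tau> i\<close>, evaluated at a gradient, is
  the squared Hilbert norm of the derivative, and the \<open>l^1\<close> bound \<open>L\<close>
  controls it. So the Sobolev norms of the approximants stay bounded. The functionals with this
  gradient bound and error at most \<open>1 / real (Suc m)\<close> form a convex set, and near
  minimisers of the norm in these shrinking sets are Cauchy while they still converge to
  \<open>X\<close>.\<close>

lemma D_1_2_criterion:
  fixes \<tau> :: "nat \<Rightarrow> real" and M :: "'a measure" and B :: "real \<Rightarrow> 'a \<Rightarrow> real"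
  assumes M: "prob_space M" and H: "H > 0" and \<tau>: "\<And>i. \<tau> i \<in> {0..T}"
    and B: "\<And>s. s \<in> {0..T} \<Longrightarrow> square_integrable M (B s)"
    and cov: "\<And>s r. s \<in> {0..T} \<Longrightarrow> r \<in> {0..T} \<Longrightarrow> (\<integral>\<omega>. B s \<omega> * B r \<omega> \<partial>M) = fbm_cov H s r"
    and X: "square_integrable M X"
    and approx: "\<And>e. e > 0 \<Longrightarrow> \<exists>n\<ge>1. \<exists>\<psi>. Cb_smooth n \<psi> \<and> (\<forall>x. (\<Sum>i<n. \<bar>partial i \<psi> x\<bar>) \<le> L) \<and>
        (\<integral>\<omega>. (\<psi> (\<lambda>i. B (\<tau> i) \<omega>) - X \<omega>)\<^sup>2 \<partial>M) \<le> e"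
  shows "X \<in> D_1_2 M H T B"
proof -
  interpret prob_space M by fact
  define bt where "bt \<omega> = (\<lambda>i. B (\<tau> i) \<omega>)" for \<omega>
  have btm [measurable]: "bt \<in> borel_measurable M"
    unfolding bt_def using B[OF \<tau>] by (intro measurable_coordinatewise_then_product) (auto simp: square_integrable_def)
  have int: "integrable M (\<lambda>\<omega>. \<phi> (bt \<omega>))" if bc: "bcont \<phi>" for \<phi>
  proof -
    obtain C where C: "\<And>x. \<bar>\<phi> x\<bar> \<le> C" using bcont_bound[OF bc] by metis
    have "\<phi> \<in> borel_measurable borel" using bc by (auto simp: bcont_def intro: borel_measurable_continuous_onI)
    then have "(\<lambda>\<omega>. \<phi> (bt \<omega>)) \<in> borel_measurable M" by measurable
    then show ?thesis by (rule integrable_const_bound[where B=C, rotated]) (use C in auto)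
  qed
  have sq: "square_integrable M (\<lambda>\<omega>. \<phi> (bt \<omega>))" if "bcont \<phi>" for \<phi>
    unfolding square_integrable_def power2_eq_square using int[OF that] int[OF bcont_mult[OF that that]] by auto
  define R where "R i j = fbm_cov H (\<tau> i) (\<tau> j)" for i j
  define Q where "Q n g = (\<Sum>i<n. \<Sum>j<n. g i * g j * R i j)" for n and g :: "nat \<Rightarrow> real"
  \<comment> \<open>Truncation at the least \<open>n\<close> beyond which \<open>g\<close> vanishes,
    so that one function serves gradients of any length; its value is arbitrary if there is no such
    \<open>n\<close>.\<close>
  define Qf where "Qf g = Q (LEAST n. \<forall>i\<ge>n. g i = 0) g" for g
  have Qmono: "Q m g = Q n g" if "\<forall>i\<ge>n. g i = 0" "n \<le> m" for m n g
  proof -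
    have "(\<Sum>j<m. g i * g j * R i j) = (\<Sum>j<n. g i * g j * R i j)" for i
      by (rule sum.mono_neutral_right) (use that in auto)
    moreover have "(\<Sum>i<m. h i) = (\<Sum>i<n. h i)" if "\<And>i. g i = 0 \<Longrightarrow> h i = 0" for h :: "nat \<Rightarrow> real"
      by (rule sum.mono_neutral_right) (use that \<open>\<forall>i\<ge>n. g i = 0\<close> \<open>n \<le> m\<close> in auto)
    ultimately show ?thesis unfolding Q_def by simp
  qed
  have Qf: "Qf g = Q n g" if "\<forall>i\<ge>n. g i = 0" for n g
    unfolding Qf_def using that
    by (intro Qmono[symmetric] LeastI[of "\<lambda>n. \<forall>i\<ge>n. g i = 0"] Least_le)
  \<comment> \<open>Positivity comes from the process itself: the form is the second moment of the
    linear combination of the values \<open>B (\<tau> i)\<close> with coefficients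
    \<open>g i\<close>.\<close>
  have Qpos: "Q n g \<ge> 0" for n g
  proof -
    have "Q n g = (\<integral>\<omega>. (\<Sum>i<n. \<Sum>j<n. (g i * g j) * (B (\<tau> i) \<omega> * B (\<tau> j) \<omega>)) \<partial>M)"
      unfolding Q_def R_def using square_integrable_mult[OF B[OF \<tau>] B[OF \<tau>]] cov[OF \<tau> \<tau>] by simp
    also have "\<dots> = (\<integral>\<omega>. (\<Sum>i<n. g i * B (\<tau> i) \<omega>)\<^sup>2 \<partial>M)"
      unfolding power2_eq_square sum_product by (simp add: mult_ac)
    finally show ?thesis by simp
  qed
  have Qpar: "Q n (\<lambda>i. g i - h i) = 2 * Q n g + 2 * Q n h - 4 * Q n (\<lambda>i. 1/2 * g i + 1/2 * h i)" for n g h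
    unfolding Q_def sum_distrib_left sum.distrib[symmetric] sum_subtractf[symmetric]
    by (intro sum.cong refl) (simp add: field_simps)
  have Qbound: "Q n g \<le> L\<^sup>2 * (2 * T powr (2 * H))" if "(\<Sum>i<n. \<bar>g i\<bar>) \<le> L" for n g
  proof -
    have "Q n g \<le> (\<Sum>i<n. \<Sum>j<n. \<bar>g i\<bar> * \<bar>g j\<bar> * (2 * T powr (2 * H)))"
      unfolding Q_def
    proof (intro sum_mono)
      fix i j
      have "g i * g j * R i j \<le> \<bar>g i * g j * R i j\<bar>" by simp
      also have "\<dots> \<le> \<bar>g i\<bar> * \<bar>g j\<bar> * (2 * T powr (2 * H))"
        using fbm_cov_bound[OF \<tau> \<tau> H] unfolding abs_mult R_def by (intro mult_left_mono) auto
      finally show "g i * g j * R i j \<le> \<bar>g i\<bar> * \<bar>g j\<bar> * (2 * T powr (2 * H))" .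
    qed
    also have "\<dots> = (\<Sum>i<n. \<bar>g i\<bar>)\<^sup>2 * (2 * T powr (2 * H))"
      by (simp only: power2_eq_square sum_product) (simp only: sum_distrib_right)
    also have "\<dots> \<le> L\<^sup>2 * (2 * T powr (2 * H))"
      using that by (intro mult_right_mono power_mono) (auto intro: sum_nonneg)
    finally show ?thesis .
  qed
  define err where "err \<psi> = (\<integral>\<omega>. (\<psi> (bt \<omega>) - X \<omega>)\<^sup>2 \<partial>M)" for \<psi>
  \<comment> \<open>The gradient bound is demanded for every number of terms, so that membership
    does not refer to a particular number of variables; this makes midpoints easy to treat.\<close>
  define C where "C m = {\<psi>. (\<exists>n\<ge>1. Cb_smooth n \<psi>) \<and> (\<forall>n x. (\<Sum>i<n. \<bar>partial i \<psi> x\<bar>) \<le> L) \<and> err \<psi> \<le> 1 / real (Suc m)}" for m :: nat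
  define v where "v \<psi> = (\<integral>\<omega>. (\<psi> (bt \<omega>))\<^sup>2 \<partial>M) + (\<integral>\<omega>. Qf (\<lambda>i. partial i \<psi> (bt \<omega>)) \<partial>M)" for \<psi>
  define d where "d f g = (\<integral>\<omega>. (f (bt \<omega>) - g (bt \<omega>))\<^sup>2 \<partial>M) + (\<integral>\<omega>. Qf (\<lambda>i. partial i f (bt \<omega>) - partial i g (bt \<omega>)) \<partial>M)" for f g
  define mid where "mid f g = (\<lambda>x. 1/2 * f x + 1/2 * g x)" for f g :: "(nat \<Rightarrow> real) \<Rightarrow> real"
  have CD: "\<exists>n\<ge>1. Cb_smooth n \<psi>" "(\<Sum>i<n. \<bar>partial i \<psi> x\<bar>) \<le> L" "err \<psi> \<le> 1 / real (Suc m)" if "\<psi> \<in> C m" for \<psi> m n x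
    using that by (simp_all add: C_def)
  have CI: "\<psi> \<in> C m" if "n \<ge> 1" "Cb_smooth n \<psi>" "\<And>n x. (\<Sum>i<n. \<bar>partial i \<psi> x\<bar>) \<le> L" "err \<psi> \<le> 1 / real (Suc m)" for \<psi> m n
    using that unfolding C_def mem_Collect_eq by metis
  have Cbc: "bcont \<psi>" "bcont (partial i \<psi>)" if "\<psi> \<in> C m" for \<psi> m i
  proof -
    obtain n where n: "Cb_smooth n \<psi>" using CD(1)[OF \<open>\<psi> \<in> C m\<close>] by metis
    show "bcont \<psi>" "bcont (partial i \<psi>)" using Cb_smooth_partial(1,2)[OF n] by auto
  qed
  have common: "\<exists>n. Cb_smooth n f \<and> Cb_smooth n g \<and> n \<ge> 1" if "f \<in> C k" "g \<in> C l" for f g k l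
  proof -
    obtain n m where "Cb_smooth n f" "Cb_smooth m g" "n \<ge> 1" using CD(1)[OF \<open>f \<in> C k\<close>] CD(1)[OF \<open>g \<in> C l\<close>] by metis
    then show ?thesis using Cb_smooth_mono[of n f "max n m"] Cb_smooth_mono[of m g "max n m"] by (intro exI[of _ "max n m"]) auto
  qed
  have pmid: "partial i (mid f g) x = 1/2 * partial i f x + 1/2 * partial i g x" if fg: "f \<in> C k" "g \<in> C l" for f g k l i x
  proof -
    obtain n where n: "Cb_smooth n f" "Cb_smooth n g" using common[OF fg] by metis
    show ?thesis unfolding mid_def
      using partial_lincomb[OF Cb_smooth_partial(3)[OF n(1)] Cb_smooth_partial(3)[OF n(2)], of i "1/2" "1/2"] by metis
  qed
  have intQ: "integrable M (\<lambda>\<omega>. Q n (\<lambda>i. partial i f (bt \<omega>)))" if "Cb_smooth m f" for f n m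
  proof -
    have "bcont (\<lambda>x. Q n (\<lambda>i. partial i f x))"
      unfolding Q_def by (intro bcont_sum bcont_mult bcont_const Cb_smooth_partial(2)[OF that])
    then show ?thesis by (rule int)
  qed
  have Qf_smooth: "Qf (\<lambda>i. partial i f x) = Q n (\<lambda>i. partial i f x)" if "Cb_smooth n f" for n f x
    using Cb_smooth_partial(4)[OF that] by (intro Qf) auto
  have sqX: "square_integrable M (\<lambda>\<omega>. \<psi> (bt \<omega>) - X \<omega>)" if "bcont \<psi>" for \<psi>
    using square_integrable_lincomb[OF sq[OF that] X, of 1 "-1"] by simp
  note int2 = sqX[unfolded square_integrable_def, THEN conjunct2]
  have midC: "mid f g \<in> C m" if fg: "f \<in> C m" "g \<in> C m" for f g m
  proof -
    obtain n where n: "Cb_smooth n f" "Cb_smooth n g" "n \<ge> 1" using common[OF fg] by metis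
    have sm: "Cb_smooth n (mid f g)" unfolding mid_def by (rule Cb_smooth_lincomb[OF n(1,2)])
    have "(\<Sum>i<k. \<bar>partial i (mid f g) x\<bar>) \<le> L" for k x
    proof -
      have "(\<Sum>i<k. \<bar>partial i (mid f g) x\<bar>) \<le> (\<Sum>i<k. 1/2 * \<bar>partial i f x\<bar> + 1/2 * \<bar>partial i g x\<bar>)"
        unfolding pmid[OF fg] by (intro sum_mono) linarith
      also have "\<dots> = 1/2 * (\<Sum>i<k. \<bar>partial i f x\<bar>) + 1/2 * (\<Sum>i<k. \<bar>partial i g x\<bar>)"
        by (simp add: sum.distrib sum_divide_distrib)
      also have "\<dots> \<le> 1/2 * L + 1/2 * L" by (intro add_mono mult_left_mono CD(2)[OF fg(1)] CD(2)[OF fg(2)]) auto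
      finally show ?thesis by simp
    qed
    moreover have "err (mid f g) \<le> 1 / real (Suc m)"
    proof -
      have "err (mid f g) \<le> (\<integral>\<omega>. 1/2 * (f (bt \<omega>) - X \<omega>)\<^sup>2 + 1/2 * (g (bt \<omega>) - X \<omega>)\<^sup>2 \<partial>M)"
        unfolding err_def
      proof (intro integral_mono int2 Bochner_Integration.integrable_add Bochner_Integration.integrable_mult_right)
        fix \<omega>
        have "(mid f g (bt \<omega>) - X \<omega>)\<^sup>2 = 1/2 * (f (bt \<omega>) - X \<omega>)\<^sup>2 + 1/2 * (g (bt \<omega>) - X \<omega>)\<^sup>2 - (1/2 * (f (bt \<omega>) - g (bt \<omega>)))\<^sup>2"
          by (simp add: mid_def power2_eq_square field_simps)
        then show "(mid f g (bt \<omega>) - X \<omega>)\<^sup>2 \<le> 1/2 * (f (bt \<omega>) - X \<omega>)\<^sup>2 + 1/2 * (g (bt \<omega>) - X \<omega>)\<^sup>2" by simp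
      qed (use Cbc fg Cb_smooth_partial(1)[OF sm] in auto)
      also have "\<dots> = 1/2 * err f + 1/2 * err g"
        unfolding err_def using int2 Cbc fg by simp
      also have "\<dots> \<le> 1/2 * (1 / real (Suc m)) + 1/2 * (1 / real (Suc m))"
        by (intro add_mono mult_left_mono CD(3)[OF fg(1)] CD(3)[OF fg(2)]) auto
      also have "\<dots> = 1 / real (Suc m)" by (simp only: field_sum_of_halves flip: distrib_right)
      finally show ?thesis .
    qed
    ultimately show ?thesis by (rule CI[OF n(3) sm])
  qed
  have "\<exists>y. (\<forall>n. y n \<in> C n) \<and> (\<forall>e>0. \<exists>N. \<forall>k\<ge>N. \<forall>l\<ge>N. d (y k) (y l) < e)"
  \<comment> \<open>The constant comes from \<open>E f^2 \<le> 2 * E X^2 + 2 * err f\<close> with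
    \<open>err f \<le> 1\<close> on \<open>C 0\<close>, plus the bound of the covariance form by the
    gradient bound.\<close>
  proof (rule near_minimisers_Cauchy[where v=v and mid=mid and K="2 * (\<integral>\<omega>. (X \<omega>)\<^sup>2 \<partial>M) + 2 + L\<^sup>2 * (2 * T powr (2 * H))"])
    fix m
    obtain n \<psi> where \<psi>: "n \<ge> 1" "Cb_smooth n \<psi>" "\<And>x. (\<Sum>i<n. \<bar>partial i \<psi> x\<bar>) \<le> L" "err \<psi> \<le> 1 / real (Suc m)"
      using approx[of "1 / real (Suc m)"] unfolding err_def bt_def by auto
    have "(\<Sum>i<k. \<bar>partial i \<psi> x\<bar>) \<le> L" for k x
    proof -
      have "(\<Sum>i<k. \<bar>partial i \<psi> x\<bar>) = (\<Sum>i\<in>{..<k} \<inter> {..<n}. \<bar>partial i \<psi> x\<bar>)"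
        by (rule sum.mono_neutral_right) (use Cb_smooth_partial_nonzero[OF \<psi>(2)] in auto)
      also have "\<dots> \<le> (\<Sum>i<n. \<bar>partial i \<psi> x\<bar>)" by (rule sum_mono2) auto
      finally show ?thesis using \<psi>(3)[of x] by linarith
    qed
    then have "\<psi> \<in> C m" by (rule CI[OF \<psi>(1,2) _ \<psi>(4)])
    then show "C m \<noteq> {}" by auto
  next
    fix m n :: nat assume "m \<le> n"
    then have "1 / real (Suc n) \<le> 1 / real (Suc m)" by (simp add: field_simps)
    then show "C n \<subseteq> C m" unfolding C_def by (intro Collect_mono impI conjI) (auto elim!: order_trans)
  next
    fix f assume f: "f \<in> C 0"
    obtain n where n: "Cb_smooth n f" using CD(1)[OF f] by metis
    show "v f \<ge> 0" unfolding v_def Qf_smooth[OF n] using Qpos by (intro add_nonneg_nonneg integral_nonneg_AE) auto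
    have "(\<integral>\<omega>. (f (bt \<omega>))\<^sup>2 \<partial>M) \<le> (\<integral>\<omega>. 2 * (X \<omega>)\<^sup>2 + 2 * (f (bt \<omega>) - X \<omega>)\<^sup>2 \<partial>M)"
    proof (intro integral_mono Bochner_Integration.integrable_add Bochner_Integration.integrable_mult_right int2)
      fix \<omega>
      have "2 * (X \<omega>)\<^sup>2 + 2 * (f (bt \<omega>) - X \<omega>)\<^sup>2 = (f (bt \<omega>))\<^sup>2 + (2 * X \<omega> - f (bt \<omega>))\<^sup>2"
        by (simp add: power2_eq_square algebra_simps)
      then show "(f (bt \<omega>))\<^sup>2 \<le> 2 * (X \<omega>)\<^sup>2 + 2 * (f (bt \<omega>) - X \<omega>)\<^sup>2" by simp
    qed (use X sq[OF Cbc(1)[OF f]] Cbc(1)[OF f] in \<open>auto simp: square_integrable_def\<close>)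
    also have "\<dots> = 2 * (\<integral>\<omega>. (X \<omega>)\<^sup>2 \<partial>M) + 2 * err f"
      unfolding err_def using X int2[OF Cbc(1)[OF f]] by (simp add: square_integrable_def)
    also have "\<dots> \<le> 2 * (\<integral>\<omega>. (X \<omega>)\<^sup>2 \<partial>M) + 2" using CD(3)[OF f] by simp
    finally have 1: "(\<integral>\<omega>. (f (bt \<omega>))\<^sup>2 \<partial>M) \<le> 2 * (\<integral>\<omega>. (X \<omega>)\<^sup>2 \<partial>M) + 2" .
    have "(\<integral>\<omega>. Qf (\<lambda>i. partial i f (bt \<omega>)) \<partial>M) \<le> (\<integral>\<omega>. L\<^sup>2 * (2 * T powr (2 * H)) \<partial>M)"
      unfolding Qf_smooth[OF n] by (intro integral_mono intQ[OF n] Qbound CD(2)[OF f]) auto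
    then show "v f \<le> 2 * (\<integral>\<omega>. (X \<omega>)\<^sup>2 \<partial>M) + 2 + L\<^sup>2 * (2 * T powr (2 * H))"
      unfolding v_def using 1 by (simp add: prob_space)
  next
    fix f g assume fg: "f \<in> C 0" "g \<in> C 0"
    obtain n where n: "Cb_smooth n f" "Cb_smooth n g" using common[OF fg] by metis
    have n3: "Cb_smooth n (mid f g)" unfolding mid_def by (rule Cb_smooth_lincomb[OF n])
    have m: "mid f g \<in> C 0" by (rule midC[OF fg])
    have "(\<integral>\<omega>. (f (bt \<omega>) - g (bt \<omega>))\<^sup>2 \<partial>M) = (\<integral>\<omega>. 2 * (f (bt \<omega>))\<^sup>2 + 2 * (g (bt \<omega>))\<^sup>2 - 4 * (mid f g (bt \<omega>))\<^sup>2 \<partial>M)"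
      by (intro Bochner_Integration.integral_cong refl) (simp add: mid_def power2_eq_square field_simps)
    also have "\<dots> = 2 * (\<integral>\<omega>. (f (bt \<omega>))\<^sup>2 \<partial>M) + 2 * (\<integral>\<omega>. (g (bt \<omega>))\<^sup>2 \<partial>M) - 4 * (\<integral>\<omega>. (mid f g (bt \<omega>))\<^sup>2 \<partial>M)"
      using sq[OF Cbc(1)[OF fg(1)]] sq[OF Cbc(1)[OF fg(2)]] sq[OF Cbc(1)[OF m]] by (simp add: square_integrable_def)
    finally have 1: "(\<integral>\<omega>. (f (bt \<omega>) - g (bt \<omega>))\<^sup>2 \<partial>M) = \<dots>" .
    have "Qf (\<lambda>i. partial i f (bt \<omega>) - partial i g (bt \<omega>)) = 2 * Q n (\<lambda>i. partial i f (bt \<omega>)) + 2 * Q n (\<lambda>i. partial i g (bt \<omega>)) - 4 * Q n (\<lambda>i. partial i (mid f g) (bt \<omega>))" for \<omega>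
      using Cb_smooth_partial(4)[OF n(1)] Cb_smooth_partial(4)[OF n(2)]
      by (subst Qf[of n]) (auto simp: Qpar pmid[OF fg])
    then have "(\<integral>\<omega>. Qf (\<lambda>i. partial i f (bt \<omega>) - partial i g (bt \<omega>)) \<partial>M) =
       2 * (\<integral>\<omega>. Q n (\<lambda>i. partial i f (bt \<omega>)) \<partial>M) + 2 * (\<integral>\<omega>. Q n (\<lambda>i. partial i g (bt \<omega>)) \<partial>M) - 4 * (\<integral>\<omega>. Q n (\<lambda>i. partial i (mid f g) (bt \<omega>)) \<partial>M)"
      using intQ[OF n(1)] intQ[OF n(2)] intQ[OF n3] by simp
    then show "d f g = 2 * v f + 2 * v g - 4 * v (mid f g)"
      unfolding d_def v_def Qf_smooth[OF n(1)] Qf_smooth[OF n(2)] Qf_smooth[OF n3] 1 by simp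
  qed (use midC in auto)
  then obtain y where y: "\<And>n. y n \<in> C n" and Cau: "\<And>e. e > 0 \<Longrightarrow> \<exists>N. \<forall>k\<ge>N. \<forall>l\<ge>N. d (y k) (y l) < e" by metis
  have "\<forall>k. \<exists>n\<ge>1. Cb_smooth n (y k)" using CD(1)[OF y] by blast
  then obtain n where n: "\<And>k. n k \<ge> 1" "\<And>k. Cb_smooth (n k) (y k)" by metis
  define Fs where "Fs k \<omega> = y k (bt \<omega>)" for k \<omega>
  \<comment> \<open>The indicator of \<open>{0..\<tau> i}\<close> is represented by a constant
    sequence in the completion, so the limits defining the inner products below are limits of
    constants.\<close>
  define DFs where "DFs k = (\<lambda>\<omega> (m::nat) s. \<Sum>i<n k. partial i (y k) (bt \<omega>) * indicator {0..\<tau> i} s :: real)" for k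
  have hc: "(\<lambda>m. indicator {0..\<tau> i}) \<in> hilbert_carrier H T" for i
  proof -
    have "indicator {0..\<tau> i} \<in> step_functions T"
      unfolding step_functions_def using \<tau>[of i] by (auto intro!: exI[of _ "{\<tau> i}"] exI[of _ "\<lambda>_. 1"])
    moreover have "step_inner H (\<lambda>s. 0) (\<lambda>s. 0) = 0" using step_inner_sum[of "{}" \<tau> H] by simp
    ultimately show ?thesis unfolding hilbert_carrier_def by auto
  qed
  have wi: "is_wiener_integral M B (\<lambda>m. indicator {0..\<tau> i}) (B (\<tau> i))" for i
    unfolding is_wiener_integral_def using B[OF \<tau>] \<tau>[of i] by (simp add: step_integral_indicator)
  have mem: "(Fs k, DFs k) \<in> smooth_functionals M H T B" for k
    unfolding smooth_functionals_def
    by (clarify, intro exI[of _ "n k"] exI[of _ "y k"] exI[of _ "\<lambda>i m. indicator {0..\<tau> i}"] exI[of _ "\<lambda>i. B (\<tau> i)"])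
      (use n hc wi in \<open>auto simp: Fs_def DFs_def bt_def\<close>)
  have norm: "norm_1_2 M H (\<lambda>\<omega>. Fs k \<omega> - Fs l \<omega>) (\<lambda>\<omega> m s. DFs k \<omega> m s - DFs l \<omega> m s) = sqrt (d (y k) (y l))" for k l
  proof -
    define N where "N = max (n k) (n l)"
    have s: "Cb_smooth N (y k)" "Cb_smooth N (y l)" using Cb_smooth_mono[OF n(2)] by (auto simp: N_def)
    have extend: "(\<Sum>i<n j. partial i (y j) x * h i) = (\<Sum>i<N. partial i (y j) x * h i)" if "j = k \<or> j = l" for j x and h :: "nat \<Rightarrow> real"
      by (rule sum.mono_neutral_left) (use that Cb_smooth_partial(4)[OF n(2)[of j]] in \<open>auto simp: N_def\<close>)
    have "(hilbert_norm H (\<lambda>m s. DFs k \<omega> m s - DFs l \<omega> m s))\<^sup>2 = Qf (\<lambda>i. partial i (y k) (bt \<omega>) - partial i (y l) (bt \<omega>))" for \<omega>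
    proof -
      let ?g = "\<lambda>i. partial i (y k) (bt \<omega>) - partial i (y l) (bt \<omega>)"
      have "(\<lambda>m s. DFs k \<omega> m s - DFs l \<omega> m s) = (\<lambda>m s. \<Sum>i<N. ?g i * indicator {0..\<tau> i} s)"
      proof (intro ext)
        fix m s
        show "DFs k \<omega> m s - DFs l \<omega> m s = (\<Sum>i<N. ?g i * indicator {0..\<tau> i} s)"
          unfolding DFs_def extend[of k, OF disjI1[OF refl]] extend[of l, OF disjI2[OF refl]] left_diff_distrib sum_subtractf ..
      qed
      then have "hilbert_inner H (\<lambda>m s. DFs k \<omega> m s - DFs l \<omega> m s) (\<lambda>m s. DFs k \<omega> m s - DFs l \<omega> m s) = Q N ?g"
      proof -
        assume eq: "(\<lambda>m s. DFs k \<omega> m s - DFs l \<omega> m s) = (\<lambda>m s. \<Sum>i<N. ?g i * indicator {0..\<tau> i} s)"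
        have "step_inner H (\<lambda>s. \<Sum>i<N. ?g i * indicator {0..\<tau> i} s) (\<lambda>s. \<Sum>i<N. ?g i * indicator {0..\<tau> i} s) = Q N ?g"
          unfolding Q_def R_def by (rule step_inner_sum) (use \<tau> in auto)
        then show ?thesis unfolding eq hilbert_inner_def by (simp only: limI[OF tendsto_const])
      qed
      moreover have "Qf ?g = Q N ?g"
        using Cb_smooth_partial(4)[OF s(1)] Cb_smooth_partial(4)[OF s(2)] by (intro Qf) auto
      ultimately show ?thesis unfolding hilbert_norm_def using Qpos by simp
    qed
    then show ?thesis unfolding norm_1_2_def d_def Fs_def by simp
  qed
  have "\<exists>N. \<forall>k\<ge>N. \<forall>l\<ge>N. sqrt (d (y k) (y l)) < e" if e: "e > 0" for e
  proof -
    obtain N where "\<forall>k\<ge>N. \<forall>l\<ge>N. d (y k) (y l) < e\<^sup>2" using Cau[of "e\<^sup>2"] e by auto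
    then show ?thesis using e real_less_lsqrt by (intro exI[of _ N]) (metis less_imp_le real_sqrt_less_iff real_sqrt_unique)
  qed
  moreover have "(\<lambda>k. \<integral>\<omega>. (Fs k \<omega> - X \<omega>)\<^sup>2 \<partial>M) \<longlonglongrightarrow> 0"
  proof (rule tendsto_sandwich[OF _ _ tendsto_const lim_1_over_n[THEN LIMSEQ_Suc]])
    show "\<forall>\<^sub>F k in sequentially. (\<integral>\<omega>. (Fs k \<omega> - X \<omega>)\<^sup>2 \<partial>M) \<le> 1 / real (Suc k)"
      using CD(3)[OF y] unfolding err_def Fs_def by simp
  qed simp
  ultimately show ?thesis
    unfolding D_1_2_def using X mem by (auto simp: norm intro!: exI[of _ Fs] exI[of _ DFs])
qed

section \<open>Solutions as Lipschitz functionals of the driving path\<close>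


text \<open>The equation along a single path, stripped of probability, so that paths other than
  those of \<open>B\<close> can compete in an infimum. The value \<open>b 0\<close> is left
  free.\<close>

definition solves :: "(real \<Rightarrow> real \<Rightarrow> real) \<Rightarrow> real \<Rightarrow> real \<Rightarrow> (real \<Rightarrow> real) \<Rightarrow> (real \<Rightarrow> real) \<Rightarrow> bool" where
  "solves f x0 t b x \<longleftrightarrow> continuous_on {0..t} b \<and>
     (\<forall>s\<in>{0..t}. x s > 0 \<and> (\<lambda>r. f r (x r)) integrable_on {0..s} \<and>
        x s = x0 + integral {0..s} (\<lambda>r. f r (x r)) + b s)"

lemma solves_increment:
  assumes "solves f x0 t b x" "0 \<le> s" "s \<le> r" "r \<le> t"
  shows "(\<lambda>u. f u (x u)) integrable_on {s..r}"
    and "x r - x s = integral {s..r} (\<lambda>u. f u (x u)) + (b r - b s)"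
proof -
  have i: "(\<lambda>u. f u (x u)) integrable_on {0..r}" using assms by (auto simp: solves_def)
  then show "(\<lambda>u. f u (x u)) integrable_on {s..r}"
    by (rule integrable_subinterval_real) (use assms in auto)
  have "integral {0..s} (\<lambda>u. f u (x u)) + integral {s..r} (\<lambda>u. f u (x u)) = integral {0..r} (\<lambda>u. f u (x u))"
    by (rule Henstock_Kurzweil_Integration.integral_combine) (use assms i in auto)
  moreover have "x r = x0 + integral {0..r} (\<lambda>r. f r (x r)) + b r" "x s = x0 + integral {0..s} (\<lambda>r. f r (x r)) + b s"
    using assms unfolding solves_def by auto
  ultimately show "x r - x s = integral {s..r} (\<lambda>u. f u (x u)) + (b r - b s)" by simp
qed

lemma solves_continuous:
  assumes "solves f x0 t b x" shows "continuous_on {0..t} x"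
proof (cases "t \<ge> 0")
  case True
  have "continuous_on {0..t} (\<lambda>s. x0 + integral {0..s} (\<lambda>r. f r (x r)) + b s)"
    using assms True unfolding solves_def
    by (intro continuous_intros indefinite_integral_continuous_1) auto
  then show ?thesis using assms unfolding solves_def by (subst continuous_on_cong[OF refl]) auto
qed simp

text \<open>The set where \<open>D s \<le> a\<close> is compact, so it has a largest element unless
  it is empty. The empty case stays separate because with \<open>b 0 \<noteq> 0\<close> the level
  may be exceeded from the start.\<close>

lemma last_time_below:
  fixes D :: "real \<Rightarrow> real"
  assumes "continuous_on {0..t} D" "D t > a" "0 \<le> t"
  obtains "\<forall>s\<in>{0..t}. D s > a" | s where "0 \<le> s" "s < t" "D s \<le> a" "\<forall>u\<in>{s<..t}. D u > a"
proof (cases "\<forall>s\<in>{0..t}. D s > a")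
  case False
  define S where "S = {s \<in> {0..t}. D s \<le> a}"
  have "closed S" unfolding S_def by (rule continuous_on_closed_Collect_le) (use assms in \<open>auto intro: continuous_intros\<close>)
  moreover have "bounded S" by (rule bounded_subset[of "{0..t}"]) (auto simp: S_def)
  ultimately have "compact S" by (simp add: compact_eq_bounded_closed)
  moreover have "S \<noteq> {}" using False by (auto simp: S_def not_less)
  ultimately obtain s where s: "s \<in> S" "\<forall>u\<in>S. u \<le> s" using compact_attains_sup by blast
  have "s \<noteq> t" using s(1) assms(2) by (auto simp: S_def)
  moreover have "D u > a" if "u \<in> {s<..t}" for u
  proof (rule ccontr)
    assume "\<not> D u > a"
    then have "u \<in> S" using s(1) that by (auto simp: S_def)
    then show False using s(2) that by auto
  qed
  ultimately show ?thesis using s(1) that(2)[of s] by (auto simp: S_def)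
qed (use that in blast)

text \<open>The left endpoint is excluded because the ordering of two solutions is strict only after
  the crossing time, and because \<open>f\<close> is known to be decreasing only at positive
  times.\<close>

lemma integral_le_greaterThan:
  fixes g h :: "real \<Rightarrow> real"
  assumes "g integrable_on {s..t}" "h integrable_on {s..t}" "\<And>u. u \<in> {s<..t} \<Longrightarrow> g u \<le> h u"
  shows "integral {s..t} g \<le> integral {s..t} h"
proof -
  define g' where "g' u = (if u = s then h u else g u)" for u
  have "integral {s..t} g = integral {s..t} g'"
    by (rule integral_spike[where S="{s}"]) (auto simp: g'_def)
  moreover have "g' integrable_on {s..t}"
    by (rule integrable_spike[OF assms(1), where S="{s}"]) (auto simp: g'_def)
  ultimately show ?thesis using assms(2,3) by (auto simp: g'_def intro!: integral_le)
qed

lemma solves_compare: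
  assumes s1: "solves f x0 t b1 x1" and s2: "solves f x0 t b2 x2" and t: "0 \<le> t"
    and mono: "\<And>s x y. s > 0 \<Longrightarrow> 0 < x \<Longrightarrow> x \<le> y \<Longrightarrow> f s y \<le> f s x"
    and e: "\<And>s. s \<in> {0..t} \<Longrightarrow> \<bar>b1 s - b2 s\<bar> \<le> e"
  shows "x1 t - x2 t \<le> 2 * e"
proof (cases "x1 t - x2 t > 0")
  case True
  let ?D = "\<lambda>s. x1 s - x2 s"
  have e0: "e \<ge> 0" using e[of 0] t by auto
  have pos: "x1 u > 0" "x2 u > 0" if "u \<in> {0..t}" for u using s1 s2 that unfolding solves_def by blast+
  have c: "continuous_on {0..t} ?D" using solves_continuous[OF s1] solves_continuous[OF s2] by (intro continuous_intros)
  have le: "?D t - ?D s \<le> (b1 t - b2 t) - (b1 s - b2 s)" if "0 \<le> s" "s \<le> t" "\<forall>u\<in>{s<..t}. ?D u > 0" for s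
  proof -
    have "integral {s..t} (\<lambda>u. f u (x1 u)) \<le> integral {s..t} (\<lambda>u. f u (x2 u))"
    proof (rule integral_le_greaterThan)
      fix u assume u: "u \<in> {s<..t}"
      then show "f u (x1 u) \<le> f u (x2 u)" using that pos[of u] by (intro mono) force+
    qed (use solves_increment(1)[OF s1] solves_increment(1)[OF s2] that in auto)
    then show ?thesis using solves_increment(2)[OF s1 that(1,2)] solves_increment(2)[OF s2 that(1,2)] by simp
  qed
  from last_time_below[OF c True t] show ?thesis
  proof cases
    case 1
    have "?D t - ?D 0 \<le> (b1 t - b2 t) - (b1 0 - b2 0)" using le[of 0] 1 t by auto
    moreover have "x1 0 = x0 + b1 0" "x2 0 = x0 + b2 0" using s1 s2 t by (auto simp: solves_def)
    ultimately show ?thesis using e[of t] t e0 by auto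
  next
    case (2 s)
    \<comment> \<open>Now \<open>?D s \<le> 0\<close>, and the difference of the paths counts both
      at \<open>t\<close> and at \<open>s\<close>; this is the origin of the factor 2.\<close>
    then show ?thesis using le[of s] e[of t] e[of s] t by auto
  qed
next
  case False
  then show ?thesis using e[of 0] t by auto
qed

text \<open>After the last time at or below \<open>x0\<close> the drift is at most
  \<open>K * (1 + 1 / x0)\<close>, so the singularity at zero cannot contribute to the
  growth.\<close>

lemma solves_bound:
  assumes s: "solves f x0 t b x" and t: "0 \<le> t" and x0: "x0 > 0"
    and f: "\<And>s x. s \<in> {0..t} \<Longrightarrow> x > 0 \<Longrightarrow> f s x \<le> K * (1 + 1 / x)" and K: "K \<ge> 0"
    and c: "\<And>s. s \<in> {0..t} \<Longrightarrow> \<bar>b s\<bar> \<le> c"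
  shows "x t \<le> x0 + K * (1 + 1 / x0) * t + 2 * c"
proof (cases "x t > x0")
  case True
  have c0: "c \<ge> 0" using c[of 0] t by auto
  have le: "x t - x r \<le> K * (1 + 1 / x0) * t + (b t - b r)" if r: "0 \<le> r" "r \<le> t" "\<forall>u\<in>{r<..t}. x u > x0" for r
  proof -
    have "integral {r..t} (\<lambda>u. f u (x u)) \<le> integral {r..t} (\<lambda>u. K * (1 + 1 / x0))"
    proof (rule integral_le_greaterThan)
      fix u assume u: "u \<in> {r<..t}"
      then have "x u > x0" "u \<in> {0..t}" using r by auto
      then have "f u (x u) \<le> K * (1 + 1 / x u)" using f x0 by (meson less_trans)
      moreover have "1 / x u \<le> 1 / x0" using \<open>x u > x0\<close> x0 by (auto simp: field_simps)
      ultimately show "f u (x u) \<le> K * (1 + 1 / x0)" using mult_left_mono[of "1 + 1 / x u" "1 + 1 / x0" K] K by linarith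
    qed (use solves_increment(1)[OF s] r in auto)
    also have "\<dots> = (t - r) * (K * (1 + 1 / x0))" using r by simp
    also have "\<dots> \<le> t * (K * (1 + 1 / x0))" using r K x0 by (intro mult_right_mono) auto
    finally show ?thesis using solves_increment(2)[OF s r(1,2)] by (simp add: algebra_simps)
  qed
  from last_time_below[OF solves_continuous[OF s] True t] show ?thesis
  proof cases
    case 1
    have "x 0 = x0 + b 0" using s t by (auto simp: solves_def)
    then show ?thesis using le[of 0] 1 t c[of t] c0 by auto
  next
    case (2 r)
    then show ?thesis using le[of r] c[of t] c[of r] t by auto
  qed
next
  case False
  moreover have "0 \<le> K * (1 + 1 / x0) * t" using K x0 t by auto
  moreover have "c \<ge> 0" using c[of 0] t by auto
  ultimately show ?thesis by linarith
qed

section \<open>Sampling a path at finitely many times\<close>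

definition nearest :: "(nat \<Rightarrow> real) \<Rightarrow> nat \<Rightarrow> real \<Rightarrow> nat" where
  "nearest \<tau> n s = arg_min_on (\<lambda>i. \<bar>\<tau> i - s\<bar>) {..<n}"

lemma nearest:
  assumes "n \<ge> 1"
  shows "nearest \<tau> n s < n" "\<And>i. i < n \<Longrightarrow> \<bar>\<tau> (nearest \<tau> n s) - s\<bar> \<le> \<bar>\<tau> i - s\<bar>"
proof -
  have fin: "finite {..<n}" "{..<n} \<noteq> {}" using assms by (auto simp: lessThan_empty_iff)
  then show "nearest \<tau> n s < n" using arg_min_if_finite(1)[OF fin] by (simp add: nearest_def)
  show "\<bar>\<tau> (nearest \<tau> n s) - s\<bar> \<le> \<bar>\<tau> i - s\<bar>" if "i < n" for i
    using arg_min_least[OF fin, of i "\<lambda>i. \<bar>\<tau> i - s\<bar>"] that by (simp add: nearest_def)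
qed

text \<open>By density and compactness, finitely many balls around the \<open>\<tau> i\<close>, of
  the radius given by uniform continuity, cover the interval; once \<open>n\<close> exceeds their
  indices, every time has a sampling time within that radius.\<close>

lemma nearest_uniform:
  fixes w :: "real \<Rightarrow> real"
  assumes \<tau>: "\<And>i. \<tau> i \<in> {0..t}" "{0..t} \<subseteq> closure (range \<tau>)" and w: "continuous_on {0..t} w" and e: "e > 0"
  shows "\<exists>N. \<forall>n\<ge>N. \<forall>s\<in>{0..t}. \<bar>w s - w (\<tau> (nearest \<tau> n s))\<bar> \<le> e"
proof -
  have "uniformly_continuous_on {0..t} w" using w by (intro compact_uniformly_continuous) auto
  then obtain d where d: "d > 0" "\<And>x y. x \<in> {0..t} \<Longrightarrow> y \<in> {0..t} \<Longrightarrow> dist y x < d \<Longrightarrow> dist (w y) (w x) < e"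
    unfolding uniformly_continuous_on_def using e by metis
  have "{0..t} \<subseteq> (\<Union>i. ball (\<tau> i) d)"
  proof
    fix s assume "s \<in> {0..t}"
    then have "s \<in> closure (range \<tau>)" using \<tau>(2) by auto
    then obtain y where "y \<in> range \<tau>" "dist y s < d" using d(1) closure_approachable by metis
    then show "s \<in> (\<Union>i. ball (\<tau> i) d)" by auto
  qed
  then obtain C where C: "finite C" "{0..t} \<subseteq> (\<Union>i\<in>C. ball (\<tau> i) d)"
    using compactE_image[of "{0..t}" UNIV "\<lambda>i. ball (\<tau> i) d"] by auto
  define N where "N = Suc (Max (insert 0 C))"
  have "\<bar>w s - w (\<tau> (nearest \<tau> n s))\<bar> \<le> e" if n: "n \<ge> N" and s: "s \<in> {0..t}" for n s
  proof -
    obtain i where i: "i \<in> C" "dist (\<tau> i) s < d" using C(2) s by auto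
    have "i \<le> Max (insert 0 C)" using C(1) i(1) by (intro Max_ge) auto
    then have "i < n" "n \<ge> 1" using n by (auto simp: N_def)
    then have "dist (\<tau> (nearest \<tau> n s)) s < d" using nearest(2)[of n i \<tau> s] i(2) by (simp add: dist_real_def)
    then have "dist (w (\<tau> (nearest \<tau> n s))) (w s) < e" using d(2) s \<tau>(1) by blast
    then show ?thesis by (simp add: dist_real_def abs_minus_commute)
  qed
  then show ?thesis by blast
qed

text \<open>McShane's extension: the infimum turns the comparison estimate between two driving paths into
  a Lipschitz functional of arbitrary (step) paths, for which no solution needs to exist.\<close>

definition mcshane :: "(real \<Rightarrow> real \<Rightarrow> real) \<Rightarrow> real \<Rightarrow> real \<Rightarrow> (real \<Rightarrow> nat) \<Rightarrow> (nat \<Rightarrow> real) \<Rightarrow> real" where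
  "mcshane f x0 t j y = (INF p\<in>{(b, x). solves f x0 t b x}. snd p t + 2 * (SUP s\<in>{0..t}. \<bar>fst p s - y (j s)\<bar>))"

section \<open>Lipschitz and approximation properties of the extension\<close>

context
  fixes f :: "real \<Rightarrow> real \<Rightarrow> real" and x0 t :: real and j :: "real \<Rightarrow> nat" and n :: nat
  assumes t: "0 \<le> t" and j: "\<And>s. s \<in> {0..t} \<Longrightarrow> j s < n"
    and ex: "\<exists>b x. solves f x0 t b x"
begin

private lemma bdd: 
  assumes "solves f x0 t b x" shows "bdd_above ((\<lambda>s. \<bar>b s - y (j s)\<bar>) ` {0..t})"
proof -
  have "compact (b ` {0..t})" using assms by (intro compact_continuous_image) (auto simp: solves_def)
  then obtain K where K: "\<And>s. s \<in> {0..t} \<Longrightarrow> \<bar>b s\<bar> \<le> K"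
    using compact_imp_bounded bounded_real by (metis imageI)
  have "\<bar>b s - y (j s)\<bar> \<le> K + (\<Sum>i<n. \<bar>y i\<bar>)" if "s \<in> {0..t}" for s
    using K[OF that] member_le_sum[of "j s" "{..<n}" "\<lambda>i. \<bar>y i\<bar>"] j[OF that] by auto
  then show ?thesis by (intro bdd_aboveI2)
qed

private lemma sup_ge: "solves f x0 t b x \<Longrightarrow> s \<in> {0..t} \<Longrightarrow> \<bar>b s - y (j s)\<bar> \<le> (SUP s\<in>{0..t}. \<bar>b s - y (j s)\<bar>)"
  by (rule cSUP_upper[OF _ bdd])

private lemma val_pos: "solves f x0 t b x \<Longrightarrow> 0 \<le> x t + 2 * (SUP s\<in>{0..t}. \<bar>b s - y (j s)\<bar>)"
proof -
  assume s: "solves f x0 t b x"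
  have "t \<in> {0..t}" using t by simp
  then have "x t > 0" using s unfolding solves_def by blast
  moreover have "0 \<le> (SUP s\<in>{0..t}. \<bar>b s - y (j s)\<bar>)"
    using order_trans[OF abs_ge_zero sup_ge[OF s, of 0 y]] t by auto
  ultimately show ?thesis by linarith
qed

private lemma bdd_val: "bdd_below ((\<lambda>p. snd p t + 2 * (SUP s\<in>{0..t}. \<bar>fst p s - y (j s)\<bar>)) ` {(b, x). solves f x0 t b x})"
  using val_pos by (intro bdd_belowI2[where m=0]) (auto simp only: mem_Collect_eq case_prod_conv split_paired_all fst_conv snd_conv)

lemma mcshane_le: "solves f x0 t b x \<Longrightarrow> mcshane f x0 t j y \<le> x t + 2 * (SUP s\<in>{0..t}. \<bar>b s - y (j s)\<bar>)"
proof -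
  assume "solves f x0 t b x"
  then have "(b, x) \<in> {(b, x). solves f x0 t b x}" by simp
  from cINF_lower[OF bdd_val this] show ?thesis unfolding mcshane_def by (simp only: fst_conv snd_conv)
qed

lemma mcshane_ge:
  assumes "\<And>b x. solves f x0 t b x \<Longrightarrow> c \<le> x t + 2 * (SUP s\<in>{0..t}. \<bar>b s - y (j s)\<bar>)"
  shows "c \<le> mcshane f x0 t j y"
  unfolding mcshane_def
proof (rule cINF_greatest)
  show "{(b, x). solves f x0 t b x} \<noteq> {}" using ex by blast
  fix p assume "p \<in> {(b, x). solves f x0 t b x}"
  then show "c \<le> snd p t + 2 * (SUP s\<in>{0..t}. \<bar>fst p s - y (j s)\<bar>)"
    using assms by (cases p) (simp only: mem_Collect_eq case_prod_conv fst_conv snd_conv)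
qed

lemma mcshane_nonneg: "0 \<le> mcshane f x0 t j y"
  by (intro mcshane_ge val_pos)

lemma mcshane_lipschitz: "sup_lipschitz n 2 (mcshane f x0 t j)"
proof -
  have "mcshane f x0 t j z - 2 * e \<le> mcshane f x0 t j y" if e: "\<forall>i<n. \<bar>y i - z i\<bar> \<le> e" for y z e
  proof (rule mcshane_ge)
    fix b x assume s: "solves f x0 t b x"
    have "(SUP s\<in>{0..t}. \<bar>b s - z (j s)\<bar>) \<le> (SUP s\<in>{0..t}. \<bar>b s - y (j s)\<bar>) + e"
    proof (rule cSUP_least)
      fix r assume r: "r \<in> {0..t}"
      have "\<bar>y (j r) - z (j r)\<bar> \<le> e" using e j[OF r] by auto
      then show "\<bar>b r - z (j r)\<bar> \<le> (SUP s\<in>{0..t}. \<bar>b s - y (j s)\<bar>) + e" using sup_ge[OF s r, of y] by linarith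
    qed (use t in auto)
    then show "mcshane f x0 t j z - 2 * e \<le> x t + 2 * (SUP s\<in>{0..t}. \<bar>b s - y (j s)\<bar>)"
      using mcshane_le[OF s, of z] by linarith
  qed
  note * = this
  show ?thesis unfolding sup_lipschitz_def
  proof (intro allI impI abs_leI)
    fix y z :: "nat \<Rightarrow> real" and e assume e: "\<forall>i<n. \<bar>y i - z i\<bar> \<le> e"
    then have "\<forall>i<n. \<bar>z i - y i\<bar> \<le> e" by (simp add: abs_minus_commute)
    from *[OF this] show "mcshane f x0 t j y - mcshane f x0 t j z \<le> 2 * e" by simp
    from *[OF e] show "- (mcshane f x0 t j y - mcshane f x0 t j z) \<le> 2 * e" by simp
  qed
qed

text \<open>One inequality evaluates the infimum at the competitor \<open>(w, z)\<close>; the other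
  compares \<open>z\<close> with every competitor by \<open>solves_compare\<close> and the triangle
  inequality. So the functional reproduces the solution map up to twice the sampling error.\<close>

lemma mcshane_close:
  assumes mono: "\<And>s x y. s > 0 \<Longrightarrow> 0 < x \<Longrightarrow> x \<le> y \<Longrightarrow> f s y \<le> f s x"
    and w: "solves f x0 t w z" and e: "\<And>s. s \<in> {0..t} \<Longrightarrow> \<bar>w s - y (j s)\<bar> \<le> e"
  shows "\<bar>mcshane f x0 t j y - z t\<bar> \<le> 2 * e"
proof (rule abs_leI)
  have "(SUP s\<in>{0..t}. \<bar>w s - y (j s)\<bar>) \<le> e" using t e by (intro cSUP_least) auto
  then show "mcshane f x0 t j y - z t \<le> 2 * e" using mcshane_le[OF w, of y] by simp
  have "z t - 2 * e \<le> mcshane f x0 t j y"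
  proof (rule mcshane_ge)
    fix b x assume s: "solves f x0 t b x"
    let ?S = "SUP s\<in>{0..t}. \<bar>b s - y (j s)\<bar>"
    have "z t - x t \<le> 2 * (?S + e)"
    proof (rule solves_compare[OF w s t mono])
      fix r assume r: "r \<in> {0..t}"
      show "\<bar>w r - b r\<bar> \<le> ?S + e" using sup_ge[OF s r, of y] e[OF r] by linarith
    qed auto
    then show "z t - 2 * e \<le> x t + 2 * ?S" by simp
  qed
  then show "- (mcshane f x0 t j y - z t) \<le> 2 * e" by simp
qed

end

text \<open>The times and functionals depend on \<open>f\<close>, \<open>x0\<close> and
  \<open>t\<close> only, so one choice serves all paths at once. The last property is the domination
  needed for convergence in L^2.\<close>

lemma lipschitz_functionals:
  assumes t: "0 \<le> t" and mono: "\<And>s x y. s > 0 \<Longrightarrow> 0 < x \<Longrightarrow> x \<le> y \<Longrightarrow> f s y \<le> f s x"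
    and ex: "\<exists>b x. solves f x0 t b x"
  obtains \<tau> :: "nat \<Rightarrow> real" and \<phi> where "\<And>i. \<tau> i \<in> {0..t}" "\<And>n. n \<ge> 1 \<Longrightarrow> sup_lipschitz n 2 (\<phi> n)"
    "\<And>n y. n \<ge> 1 \<Longrightarrow> \<phi> n y \<ge> 0"
    "\<And>b x. solves f x0 t b x \<Longrightarrow> (\<lambda>n. \<phi> n (\<lambda>i. b (\<tau> i))) \<longlonglongrightarrow> x t"
    "\<And>b x c n. solves f x0 t b x \<Longrightarrow> n \<ge> 1 \<Longrightarrow> (\<And>s. s \<in> {0..t} \<Longrightarrow> \<bar>b s\<bar> \<le> c) \<Longrightarrow> \<bar>\<phi> n (\<lambda>i. b (\<tau> i)) - x t\<bar> \<le> 4 * c"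
proof -
  obtain S where S: "countable S" "S \<subseteq> {0..t}" "{0..t} \<subseteq> closure S" using separable by blast
  have "S \<noteq> {}" using S(3) t by auto
  define \<tau> where "\<tau> = from_nat_into S"
  have r: "range \<tau> = S" using S(1) \<open>S \<noteq> {}\<close> by (simp add: \<tau>_def)
  have \<tau>: "\<tau> i \<in> {0..t}" for i using S(2) r by blast
  define \<phi> where "\<phi> n = mcshane f x0 t (nearest \<tau> n)" for n
  have near: "\<bar>\<phi> n (\<lambda>i. b (\<tau> i)) - x t\<bar> \<le> 2 * e"
    if "solves f x0 t b x" "n \<ge> 1" "\<And>s. s \<in> {0..t} \<Longrightarrow> \<bar>b s - b (\<tau> (nearest \<tau> n s))\<bar> \<le> e" for b x e n
    unfolding \<phi>_def using that nearest(1) by (intro mcshane_close[OF t _ ex mono]) auto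
  show thesis
  proof (rule that)
    show "\<tau> i \<in> {0..t}" for i by (rule \<tau>)
    show "sup_lipschitz n 2 (\<phi> n)" "\<phi> n y \<ge> 0" if "n \<ge> 1" for n y
      unfolding \<phi>_def using nearest(1)[OF that] by (auto intro!: mcshane_lipschitz mcshane_nonneg t ex)
    fix b x assume s: "solves f x0 t b x"
    have cb: "continuous_on {0..t} b" using s by (simp add: solves_def)
    show "(\<lambda>n. \<phi> n (\<lambda>i. b (\<tau> i))) \<longlonglongrightarrow> x t"
    proof (rule LIMSEQ_I)
      fix r :: real assume "r > 0"
      then obtain N where N: "\<forall>n\<ge>N. \<forall>s\<in>{0..t}. \<bar>b s - b (\<tau> (nearest \<tau> n s))\<bar> \<le> r / 4"
        using nearest_uniform[of \<tau> t "\<lambda>s. b s" "r / 4", OF \<tau> _ cb] S(3) r by auto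
      have "norm (\<phi> n (\<lambda>i. b (\<tau> i)) - x t) < r" if "n \<ge> max N 1" for n
        using near[OF s, of n "r / 4"] N that \<open>r > 0\<close> by auto
      then show "\<exists>no. \<forall>n\<ge>no. norm (\<phi> n (\<lambda>i. b (\<tau> i)) - x t) < r" by blast
    qed
    show "\<bar>\<phi> n (\<lambda>i. b (\<tau> i)) - x t\<bar> \<le> 4 * c" if "n \<ge> 1" and c: "\<And>s. s \<in> {0..t} \<Longrightarrow> \<bar>b s\<bar> \<le> c" for c n
    proof -
      \<comment> \<open>Two values of a path bounded by \<open>c\<close> differ by at most
        \<open>2 * c\<close>, and the functional doubles the sampling error; hence the 4.\<close>
      have "\<bar>b s - b (\<tau> (nearest \<tau> n s))\<bar> \<le> 2 * c" if "s \<in> {0..t}" for s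
        using c[OF that] c[OF \<tau>, of "nearest \<tau> n s"] by linarith
      then show ?thesis using near[OF s \<open>n \<ge> 1\<close>, of "2 * c"] by simp
    qed
  qed
qed

section \<open>The running supremum of fractional Brownian motion\<close>


text \<open>Chaining: a dyadic point of level \<open>n\<close> is reached from \<open>0\<close> by one dyadic increment per level.\<close>

lemma dyadic_chain:
  fixes b :: "real \<Rightarrow> real"
  assumes t: "0 \<le> t" and k: "k \<le> 2 ^ n"
    and a: "\<And>m i. i < 2 ^ m \<Longrightarrow> \<bar>b (t * real (Suc i) / 2 ^ m) - b (t * real i / 2 ^ m)\<bar> \<le> a m"
  shows "\<bar>b (t * real k / 2 ^ n) - b 0\<bar> \<le> (\<Sum>m\<le>n. a m)"
  using k
proof (induction n arbitrary: k)
  case 0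
  have "a 0 \<ge> 0" using a[of 0 0] by (simp add: order_trans[OF abs_ge_zero])
  moreover have "k = 0 \<or> k = 1" using 0 by auto
  ultimately show ?case using a[of 0 0] by auto
next
  case (Suc n)
  have a0: "a (Suc n) \<ge> 0" using order_trans[OF abs_ge_zero a[of 0 "Suc n"]] by simp
  show ?case
  proof (cases "even k")
    case True
    then obtain l where l: "k = 2 * l" by blast
    then have "t * real k / 2 ^ Suc n = t * real l / 2 ^ n" by simp
    moreover have "l \<le> 2 ^ n" using Suc.prems l by simp
    ultimately show ?thesis using Suc.IH[of l] a0 by simp
  next
    case False
    \<comment> \<open>The left neighbour \<open>2 * l\<close> on level \<open>Suc n\<close> is the
      point \<open>l\<close> of level \<open>n\<close>, one increment away.\<close>
    then obtain l where l: "k = Suc (2 * l)" using oddE by fastforce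
    then have "2 * l < 2 ^ Suc n" using Suc.prems by simp
    then have "l \<le> 2 ^ n" "\<bar>b (t * real k / 2 ^ Suc n) - b (t * real (2 * l) / 2 ^ Suc n)\<bar> \<le> a (Suc n)"
      using a[of "2 * l" "Suc n"] l by auto
    moreover have "t * real (2 * l) / 2 ^ Suc n = t * real l / 2 ^ n" by simp
    ultimately have "\<bar>b (t * real k / 2 ^ Suc n) - b (t * real l / 2 ^ n)\<bar> \<le> a (Suc n)" "\<bar>b (t * real l / 2 ^ n) - b 0\<bar> \<le> (\<Sum>m\<le>n. a m)"
      using Suc.IH[of l] by (simp_all only:)
    then show ?thesis by simp
  qed
qed

text \<open>The weights trade a sum of increments for a sum of squares, whose expectation can be
  computed; the price is the sum of the geometric series.\<close>

lemma weighted_Cauchy_Schwarz: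
  fixes a :: "nat \<Rightarrow> real"
  assumes r: "0 < r" "r < 1"
  shows "(\<Sum>m\<le>n. a m)\<^sup>2 \<le> 1 / (1 - r) * (\<Sum>m\<le>n. (a m)\<^sup>2 / r ^ m)"
proof -
  have "(\<Sum>m\<le>n. a m)\<^sup>2 = (\<Sum>m\<le>n. sqrt (r ^ m) * (a m / sqrt (r ^ m)))\<^sup>2"
    using r by simp
  also have "\<dots> \<le> (\<Sum>m\<le>n. (sqrt (r ^ m))\<^sup>2) * (\<Sum>m\<le>n. (a m / sqrt (r ^ m))\<^sup>2)"
    by (rule Cauchy_Schwarz_ineq_sum)
  also have "\<dots> = (\<Sum>m\<le>n. r ^ m) * (\<Sum>m\<le>n. (a m)\<^sup>2 / r ^ m)"
    using r by (simp add: power_divide)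
  also have "\<dots> \<le> 1 / (1 - r) * (\<Sum>m\<le>n. (a m)\<^sup>2 / r ^ m)"
  proof (rule mult_right_mono)
    have "(\<Sum>m\<le>n. r ^ m) \<le> (\<Sum>m. r ^ m)" using r by (intro sum_le_suminf summable_geometric) auto
    then show "(\<Sum>m\<le>n. r ^ m) \<le> 1 / (1 - r)" using r by (simp add: suminf_geometric)
  qed (use r in \<open>auto intro!: sum_nonneg\<close>)
  finally show ?thesis .
qed

text \<open>Rounding down to the dyadic grid. For \<open>t = 0\<close> the quotient
  \<open>s / t\<close> is 0, and both claims persist since then \<open>s = 0\<close>.\<close>

lemma dyadic_approx:
  assumes "s \<in> {0..t}"
  shows "(\<lambda>n. t * real (nat \<lfloor>s / t * 2 ^ n\<rfloor>) / 2 ^ n) \<longlonglongrightarrow> s"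
    and "nat \<lfloor>s / t * 2 ^ n\<rfloor> \<le> 2 ^ n"
proof -
  have q: "0 \<le> s / t" "s / t \<le> 1" using assms by (auto simp: divide_simps)
  show "nat \<lfloor>s / t * 2 ^ n\<rfloor> \<le> 2 ^ n"
  proof -
    have "s / t * 2 ^ n \<le> 2 ^ n" using q mult_right_mono[of "s / t" 1 "2 ^ n"] by simp
    then have "\<lfloor>s / t * 2 ^ n\<rfloor> \<le> 2 ^ n" using floor_mono[of "s / t * 2 ^ n" "2 ^ n"] by simp
    then show ?thesis by simp
  qed
  have "(\<lambda>n. t * (1 / 2) ^ n) \<longlonglongrightarrow> t * 0" by (intro tendsto_intros LIMSEQ_realpow_zero) auto
  then have z: "(\<lambda>n. t * (1 / 2) ^ n) \<longlonglongrightarrow> 0" by simp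
  have "\<bar>t * real (nat \<lfloor>s / t * 2 ^ n\<rfloor>) / 2 ^ n - s\<bar> \<le> t * (1 / 2) ^ n" for n
  proof (cases "t = 0")
    case False
    then have t: "t > 0" using assms by auto
    have "0 \<le> s / t * 2 ^ n" by (rule mult_nonneg_nonneg[OF q(1)]) simp
    then have f: "real (nat \<lfloor>s / t * 2 ^ n\<rfloor>) = real_of_int \<lfloor>s / t * 2 ^ n\<rfloor>"
      by (simp only: of_nat_nat zero_le_floor)
    have "\<bar>real_of_int \<lfloor>s / t * 2 ^ n\<rfloor> - s / t * 2 ^ n\<bar> \<le> 1" by linarith
    then have "t / 2 ^ n * \<bar>real_of_int \<lfloor>s / t * 2 ^ n\<rfloor> - s / t * 2 ^ n\<bar> \<le> t / 2 ^ n * 1"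
      using t by (intro mult_left_mono) auto
    also have "t / 2 ^ n * \<bar>real_of_int \<lfloor>s / t * 2 ^ n\<rfloor> - s / t * 2 ^ n\<bar> = \<bar>t / 2 ^ n * (real_of_int \<lfloor>s / t * 2 ^ n\<rfloor> - s / t * 2 ^ n)\<bar>"
      using t by (simp add: abs_mult)
    also have "t / 2 ^ n * (F - s / t * 2 ^ n) = t * F / 2 ^ n - s" for F :: real
      using t by (simp add: field_simps)
    also have "t / 2 ^ n * 1 = t * (1 / 2) ^ n" by (simp add: power_one_over)
    finally show ?thesis unfolding f .
  qed (use assms in auto)
  then have "(\<lambda>n. t * real (nat \<lfloor>s / t * 2 ^ n\<rfloor>) / 2 ^ n - s) \<longlonglongrightarrow> 0"
    by (intro Lim_null_comparison[OF _ z]) auto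
  then show "(\<lambda>n. t * real (nat \<lfloor>s / t * 2 ^ n\<rfloor>) / 2 ^ n) \<longlonglongrightarrow> s" by (simp add: LIM_zero_iff)
qed

text \<open>Chaining in L^2: the \<open>2^n\<close> squared increments of level \<open>n\<close>
  have total mean \<open>t^(2H) * 2^n * 2^(-2Hn)\<close>, which decays since
  \<open>2 * H > 1\<close>. An integrable majorant is produced in place of the supremum, which
  sidesteps the measurability of a supremum over uncountably many times.\<close>

lemma square_integrable_running_sup:
  fixes M :: "'a measure" and B :: "real \<Rightarrow> 'a \<Rightarrow> real"
  assumes H: "1 / 2 < H" and t: "0 \<le> t"
    and meas: "\<And>s. s \<in> {0..t} \<Longrightarrow> B s \<in> borel_measurable M"
    and incr: "\<And>s r. s \<in> {0..t} \<Longrightarrow> r \<in> {0..t} \<Longrightarrow> integrable M (\<lambda>\<omega>. (B s \<omega> - B r \<omega>)\<^sup>2)"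
      "\<And>s r. s \<in> {0..t} \<Longrightarrow> r \<in> {0..t} \<Longrightarrow> (\<integral>\<omega>. (B s \<omega> - B r \<omega>)\<^sup>2 \<partial>M) = \<bar>s - r\<bar> powr (2 * H)"
    and B0: "AE \<omega> in M. B 0 \<omega> = 0"
    and cont: "\<And>\<omega>. \<omega> \<in> space M \<Longrightarrow> continuous_on {0..t} (\<lambda>s. B s \<omega>)"
  shows "\<exists>W. integrable M W \<and> (AE \<omega> in M. \<forall>s\<in>{0..t}. (B s \<omega>)\<^sup>2 \<le> W \<omega>)"
proof -
  \<comment> \<open>The square root of \<open>2 powr (1 - 2 * H)\<close>. The level sums decay like
    \<open>(r * r) ^ n\<close>; one factor is spent on the Cauchy-Schwarz weights, the other keeps
    the series of means summable.\<close>
  define r where "r = (2::real) powr ((1 - 2 * H) / 2)"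
  have r: "0 < r" "r < 1" using H by (auto simp: r_def powr_less_one)
  have r2: "2 * (1 / 2) powr (2 * H) = r * r"
  proof -
    have "(2::real) * (1 / 2) powr (2 * H) = 2 powr 1 * 2 powr (- (2 * H))" by (simp add: powr_minus_divide powr_divide)
    also have "\<dots> = 2 powr (1 + - (2 * H))" by (rule powr_add[symmetric])
    also have "1 + - (2 * H) = (1 - 2 * H) / 2 + (1 - 2 * H) / 2" by (simp add: field_simps)
    also have "2 powr ((1 - 2 * H) / 2 + (1 - 2 * H) / 2) = r * r" unfolding r_def by (rule powr_add)
    finally show ?thesis .
  qed
  define p where "p n k = t * real k / 2 ^ n" for n k :: nat
  have p: "p n k \<in> {0..t}" if "k \<le> 2 ^ n" for n k
  proof -
    have "real k \<le> 2 ^ n" using that by (metis of_nat_le_iff of_nat_numeral of_nat_power)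
    then show ?thesis using t mult_left_mono[of "real k" "2 ^ n" t] by (auto simp: p_def divide_simps)
  qed
  define A where "A n \<omega> = (\<Sum>k<2 ^ n. (B (p n (Suc k)) \<omega> - B (p n k) \<omega>)\<^sup>2)" for n \<omega>
  have A0: "A n \<omega> \<ge> 0" for n \<omega> unfolding A_def by (intro sum_nonneg) auto
  have iA: "integrable M (A n)" for n
    unfolding A_def by (intro Bochner_Integration.integrable_sum incr p) auto
  have EA: "(\<integral>\<omega>. A n \<omega> \<partial>M) = t powr (2 * H) * (r * r) ^ n" for n
  proof -
    have "(\<integral>\<omega>. A n \<omega> \<partial>M) = (\<Sum>k<2 ^ n. \<bar>p n (Suc k) - p n k\<bar> powr (2 * H))"
      unfolding A_def by (subst Bochner_Integration.integral_sum) (auto intro!: incr p sum.cong)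
    also have "\<dots> = (\<Sum>k<(2::nat) ^ n. (t * (1 / 2) ^ n) powr (2 * H))"
    proof (rule sum.cong)
      fix k
      have "p n (Suc k) - p n k = t * (1 / 2) ^ n" by (simp add: p_def field_simps power_one_over)
      then show "\<bar>p n (Suc k) - p n k\<bar> powr (2 * H) = (t * (1 / 2) ^ n) powr (2 * H)" using t by simp
    qed simp
    also have "\<dots> = 2 ^ n * (t powr (2 * H) * ((1 / 2) ^ n) powr (2 * H))" using t by (simp add: powr_mult)
    also have "((1 / 2 :: real) ^ n) powr (2 * H) = ((1 / 2) powr (2 * H)) ^ n"
      by (simp add: powr_powr mult.commute flip: powr_realpow)
    finally show ?thesis by (simp flip: r2 add: power_mult_distrib mult_ac)
  qed
  \<comment> \<open>Extended values, since the series is shown to be finite only almost surely;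
    \<open>enn2real\<close> is applied afterwards.\<close>
  define W where "W \<omega> = (\<Sum>n. ennreal (A n \<omega> / r ^ n))" for \<omega>
  have mW [measurable]: "W \<in> borel_measurable M"
    unfolding W_def by (intro borel_measurable_suminf_order measurable_compose[OF _ measurable_ennreal]
        borel_measurable_divide borel_measurable_integrable[OF iA] borel_measurable_const)
  have "(\<integral>\<^sup>+\<omega>. W \<omega> \<partial>M) = (\<Sum>n. \<integral>\<^sup>+\<omega>. ennreal (A n \<omega> / r ^ n) \<partial>M)"
    unfolding W_def by (intro nn_integral_suminf measurable_compose[OF _ measurable_ennreal]
        borel_measurable_divide borel_measurable_integrable[OF iA] borel_measurable_const)
  also have "\<dots> = (\<Sum>n. ennreal (t powr (2 * H) * r ^ n))"
  proof (intro suminf_cong)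
    fix n
    have "(\<integral>\<^sup>+\<omega>. ennreal (A n \<omega> / r ^ n) \<partial>M) = ennreal (\<integral>\<omega>. A n \<omega> / r ^ n \<partial>M)"
      using iA A0 r by (intro nn_integral_eq_integral) auto
    also have "(\<integral>\<omega>. A n \<omega> / r ^ n \<partial>M) = t powr (2 * H) * r ^ n"
      using EA[of n] r by (simp add: power_mult_distrib)
    finally show "(\<integral>\<^sup>+\<omega>. ennreal (A n \<omega> / r ^ n) \<partial>M) = ennreal (t powr (2 * H) * r ^ n)" .
  qed
  also have "\<dots> = ennreal (\<Sum>n. t powr (2 * H) * r ^ n)"
    using r by (intro suminf_ennreal2 summable_mult summable_geometric) auto
  finally have fin: "(\<integral>\<^sup>+\<omega>. W \<omega> \<partial>M) < \<infinity>" by simp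
  then have AEfin: "AE \<omega> in M. W \<omega> \<noteq> \<infinity>" by (intro nn_integral_PInf_AE) auto
  define V where "V \<omega> = 1 / (1 - r) * enn2real (W \<omega>)" for \<omega>
  have "integrable M (\<lambda>\<omega>. enn2real (W \<omega>))"
  proof (rule integrableI_nonneg)
    have "(\<integral>\<^sup>+\<omega>. ennreal (enn2real (W \<omega>)) \<partial>M) \<le> (\<integral>\<^sup>+\<omega>. W \<omega> \<partial>M)"
      by (intro nn_integral_mono) (metis ennreal_enn2real_if top_greatest order_refl zero_le)
    then show "(\<integral>\<^sup>+\<omega>. ennreal (enn2real (W \<omega>)) \<partial>M) < \<infinity>" using fin by (rule le_less_trans)
  qed auto
  then have "integrable M V" unfolding V_def by auto
  moreover have "AE \<omega> in M. \<forall>s\<in>{0..t}. (B s \<omega>)\<^sup>2 \<le> V \<omega>"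
    using AEfin B0 AE_space
  proof eventually_elim
    case (elim \<omega>)
    have dy: "(B (p n k) \<omega>)\<^sup>2 \<le> V \<omega>" if "k \<le> 2 ^ n" for n k
    proof -
      have "\<bar>B (t * real k / 2 ^ n) \<omega> - B 0 \<omega>\<bar> \<le> (\<Sum>m\<le>n. sqrt (A m \<omega>))"
      proof (rule dyadic_chain[OF t that])
        fix m i :: nat assume i: "i < 2 ^ m"
        have "(B (p m (Suc i)) \<omega> - B (p m i) \<omega>)\<^sup>2 \<le> A m \<omega>"
          unfolding A_def by (rule member_le_sum[where f="\<lambda>k. (B (p m (Suc k)) \<omega> - B (p m k) \<omega>)\<^sup>2"]) (use i in auto)
        then have "\<bar>B (p m (Suc i)) \<omega> - B (p m i) \<omega>\<bar> \<le> sqrt (A m \<omega>)" by (rule real_le_rsqrt[OF order_trans[OF eq_refl], rotated]) simp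
        then show "\<bar>B (t * real (Suc i) / 2 ^ m) \<omega> - B (t * real i / 2 ^ m) \<omega>\<bar> \<le> sqrt (A m \<omega>)" by (simp add: p_def)
      qed
      then have "(B (p n k) \<omega>)\<^sup>2 \<le> (\<Sum>m\<le>n. sqrt (A m \<omega>))\<^sup>2"
        using elim(2) by (simp add: p_def abs_le_square_iff[symmetric] sum_nonneg A0)
      also have "\<dots> \<le> 1 / (1 - r) * (\<Sum>m\<le>n. A m \<omega> / r ^ m)"
        using weighted_Cauchy_Schwarz[OF r, of "\<lambda>m. sqrt (A m \<omega>)" n] A0 by simp
      also have "\<dots> \<le> V \<omega>"
        unfolding V_def
      proof (rule mult_left_mono)
        have "ennreal (\<Sum>m\<le>n. A m \<omega> / r ^ m) = (\<Sum>m\<le>n. ennreal (A m \<omega> / r ^ m))"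
          using A0 r by (intro sum_ennreal[symmetric]) auto
        also have "\<dots> \<le> W \<omega>" unfolding W_def by (intro sum_le_suminf) auto
        finally have "enn2real (ennreal (\<Sum>m\<le>n. A m \<omega> / r ^ m)) \<le> enn2real (W \<omega>)"
          using elim(1) by (intro enn2real_mono) (auto simp: top.not_eq_extremum)
        then show "(\<Sum>m\<le>n. A m \<omega> / r ^ m) \<le> enn2real (W \<omega>)"
          using A0 r by (subst (asm) enn2real_ennreal) (auto intro!: sum_nonneg)
      qed (use r in auto)
      finally show ?thesis .
    qed
    show ?case
    proof
      fix s assume s: "s \<in> {0..t}"
      let ?q = "\<lambda>n. p n (nat \<lfloor>s / t * 2 ^ n\<rfloor>)"
      have "?q \<longlonglongrightarrow> s" unfolding p_def by (rule dyadic_approx[OF s])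
      moreover have "\<And>n. ?q n \<in> {0..t}" by (intro p dyadic_approx s)
      ultimately have "(\<lambda>n. B (?q n) \<omega>) \<longlonglongrightarrow> B s \<omega>"
        by (intro continuous_on_tendsto_compose[OF cont[OF elim(3)] _ s] always_eventually allI)
      then have "(\<lambda>n. (B (?q n) \<omega>)\<^sup>2) \<longlonglongrightarrow> (B s \<omega>)\<^sup>2" by (intro tendsto_intros)
      then show "(B s \<omega>)\<^sup>2 \<le> V \<omega>" by (rule LIMSEQ_le_const2) (use dy dyadic_approx(2)[OF s] in auto)
    qed
  qed
  ultimately show ?thesis by blast
qed

section \<open>Uniqueness of finite-dimensional laws\<close>


lemma borel_measurable_cos_sin [measurable (raw)]:
  fixes Y :: "'a \<Rightarrow> real"
  assumes "Y \<in> borel_measurable M"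
  shows "(\<lambda>\<omega>. cos (Y \<omega>)) \<in> borel_measurable M" "(\<lambda>\<omega>. sin (Y \<omega>)) \<in> borel_measurable M"
  using assms by (auto intro!: borel_measurable_continuous_on[where f=cos] borel_measurable_continuous_on[where f=sin] continuous_intros)

text \<open>The law of \<open>Y\<close> under the measure reweighted by \<open>w\<close>, normalised
  because uniqueness for characteristic functions is a statement about probability measures.\<close>

definition tilted :: "'a measure \<Rightarrow> ('a \<Rightarrow> real) \<Rightarrow> ('a \<Rightarrow> real) \<Rightarrow> real measure" where
  "tilted M w Y = distr (density M (\<lambda>\<omega>. ennreal (w \<omega> / (\<integral>\<omega>. w \<omega> \<partial>M)))) borel Y"

lemma tilted_integral:
  fixes g :: "real \<Rightarrow> real"
  assumes "w \<in> borel_measurable M" "\<And>\<omega>. 0 \<le> w \<omega>" "Y \<in> borel_measurable M" "g \<in> borel_measurable borel"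
  shows "(\<integral>x. g x \<partial>tilted M w Y) = (\<integral>\<omega>. w \<omega> * g (Y \<omega>) \<partial>M) / (\<integral>\<omega>. w \<omega> \<partial>M)"
proof -
  have "(\<integral>x. g x \<partial>tilted M w Y) = (\<integral>\<omega>. (w \<omega> / (\<integral>\<omega>. w \<omega> \<partial>M)) *\<^sub>R g (Y \<omega>) \<partial>M)"
    unfolding tilted_def using assms
    by (subst integral_distr, simp, simp, subst integral_density)
      (auto intro!: divide_nonneg_nonneg integral_nonneg_AE)
  then show ?thesis by (simp only: real_scaleR_def times_divide_eq_left integral_divide_zero)
qed

lemma tilted_real_distribution:
  assumes "integrable M w" "\<And>\<omega>. 0 \<le> w \<omega>" "Y \<in> borel_measurable M" "(\<integral>\<omega>. w \<omega> \<partial>M) \<noteq> 0"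
  shows "real_distribution (tilted M w Y)"
proof -
  let ?m = "\<integral>\<omega>. w \<omega> \<partial>M"
  have m: "?m > 0" using assms by (metis integral_nonneg_AE AE_I2 order_le_less)
  have "prob_space (density M (\<lambda>\<omega>. ennreal (w \<omega> / ?m)))"
  proof (rule prob_spaceI)
    have "emeasure (density M (\<lambda>\<omega>. ennreal (w \<omega> / ?m))) (space M) = (\<integral>\<^sup>+\<omega>. ennreal (w \<omega> / ?m) \<partial>M)"
      using assms(1) by (subst emeasure_density) (auto intro!: nn_integral_cong simp: indicator_def)
    also have "\<dots> = ennreal (\<integral>\<omega>. w \<omega> / ?m \<partial>M)"
      using assms m by (intro nn_integral_eq_integral) auto
    also have "\<dots> = 1" using m by simp
    finally show "emeasure (density M (\<lambda>\<omega>. ennreal (w \<omega> / ?m))) (space (density M (\<lambda>\<omega>. ennreal (w \<omega> / ?m)))) = 1" by simp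
  qed
  then interpret prob_space "density M (\<lambda>\<omega>. ennreal (w \<omega> / ?m))" .
  have "prob_space (tilted M w Y)" unfolding tilted_def using assms(3) by (intro prob_space_distr) simp
  then show ?thesis by (simp add: real_distribution_def real_distribution_axioms_def tilted_def)
qed

text \<open>Splitting into cosine and sine keeps the weighted arguments below within real
  integrals.\<close>

lemma char_eqI:
  assumes "real_distribution \<mu>" "real_distribution \<nu>"
    and "\<And>u. (\<integral>x. cos (u * x) \<partial>\<mu>) = (\<integral>x. cos (u * x) \<partial>\<nu>)" "\<And>u. (\<integral>x. sin (u * x) \<partial>\<mu>) = (\<integral>x. sin (u * x) \<partial>\<nu>)"
  shows "\<mu> = \<nu>"
proof (rule Levy_uniqueness[OF assms(1,2)])
  have c: "char \<rho> u = Complex (\<integral>x. cos (u * x) \<partial>\<rho>) (\<integral>x. sin (u * x) \<partial>\<rho>)" if "real_distribution \<rho>" for \<rho> u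
  proof -
    interpret real_distribution \<rho> by fact
    have i: "integrable \<rho> (\<lambda>x. iexp (u * x))" by (rule integrable_iexp) auto
    have "Re (char \<rho> u) = (\<integral>x. Re (iexp (u * x)) \<partial>\<rho>)" "Im (char \<rho> u) = (\<integral>x. Im (iexp (u * x)) \<partial>\<rho>)"
      unfolding char_def using integral_Re[OF i] integral_Im[OF i] by auto
    then show ?thesis by (simp add: complex_eq_iff Re_exp Im_exp)
  qed
  show "char \<mu> = char \<nu>" using assms by (auto simp: c fun_eq_iff)
qed

text \<open>The frequency \<open>u = 0\<close> shows that both weights have the same mass. If it is
  positive, the tilted laws have equal characteristic functions; if it is zero, both weights vanish
  almost everywhere.\<close>

lemma weighted_uniqueness:
  fixes w1 Y1 :: "'a \<Rightarrow> real" and w2 Y2 :: "'b \<Rightarrow> real" and K :: real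
  assumes M: "prob_space M1" "prob_space M2"
    and w1: "w1 \<in> borel_measurable M1" "\<And>\<omega>. 0 \<le> w1 \<omega>" "\<And>\<omega>. w1 \<omega> \<le> K"
    and w2: "w2 \<in> borel_measurable M2" "\<And>\<omega>. 0 \<le> w2 \<omega>" "\<And>\<omega>. w2 \<omega> \<le> K"
    and Y: "Y1 \<in> borel_measurable M1" "Y2 \<in> borel_measurable M2"
    and c: "\<And>u. (\<integral>\<omega>. w1 \<omega> * cos (u * Y1 \<omega>) \<partial>M1) = (\<integral>\<omega>. w2 \<omega> * cos (u * Y2 \<omega>) \<partial>M2)"
    and s: "\<And>u. (\<integral>\<omega>. w1 \<omega> * sin (u * Y1 \<omega>) \<partial>M1) = (\<integral>\<omega>. w2 \<omega> * sin (u * Y2 \<omega>) \<partial>M2)"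
    and A: "A \<in> sets borel"
  shows "(\<integral>\<omega>. w1 \<omega> * indicator A (Y1 \<omega>) \<partial>M1) = (\<integral>\<omega>. w2 \<omega> * indicator A (Y2 \<omega>) \<partial>M2)"
proof -
  interpret P1: prob_space M1 by fact
  interpret P2: prob_space M2 by fact
  have i1: "integrable M1 w1" using w1 by (intro P1.integrable_const_bound[where B=K]) auto
  have i2: "integrable M2 w2" using w2 by (intro P2.integrable_const_bound[where B=K]) auto
  have m: "(\<integral>\<omega>. w1 \<omega> \<partial>M1) = (\<integral>\<omega>. w2 \<omega> \<partial>M2)" using c[of 0] by simp
  show ?thesis
  proof (cases "(\<integral>\<omega>. w1 \<omega> \<partial>M1) = 0")
    case True
    then have "AE \<omega> in M1. w1 \<omega> = 0" "AE \<omega> in M2. w2 \<omega> = 0"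
      using m integral_nonneg_eq_0_iff_AE[OF i1] integral_nonneg_eq_0_iff_AE[OF i2] w1 w2 by auto
    then have "AE \<omega> in M1. w1 \<omega> * indicator A (Y1 \<omega>) = 0" "AE \<omega> in M2. w2 \<omega> * indicator A (Y2 \<omega>) = 0"
      by (auto elim!: eventually_mono)
    then show ?thesis by (simp add: integral_eq_zero_AE)
  next
    case False
    have "tilted M1 w1 Y1 = tilted M2 w2 Y2"
      by (rule char_eqI) (use False m c s w1 w2 Y i1 i2 in \<open>auto intro!: tilted_real_distribution simp: tilted_integral\<close>)
    then have "(\<integral>x. indicator A x \<partial>tilted M1 w1 Y1) = (\<integral>x. indicator A x \<partial>tilted M2 w2 Y2 :: real)" by simp
    then show ?thesis
      using False m tilted_integral[OF w1(1,2) Y(1) borel_measurable_indicator[OF A]] tilted_integral[OF w2(1,2) Y(2) borel_measurable_indicator[OF A]]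
      by (simp only:) simp
  qed
qed

text \<open>The Levy uniqueness theorem in several variables follows from the one-dimensional one by
  freezing the coordinates one at a time: the weights \<open>1 + cos\<close> and \<open>1 + sin\<close> carry the
  characteristic function of the coordinates which are not yet frozen.\<close>

lemma joint_uniqueness:
  fixes Y1 :: "'i \<Rightarrow> 'a \<Rightarrow> real" and Y2 :: "'i \<Rightarrow> 'b \<Rightarrow> real" and A :: "'i \<Rightarrow> real set"
  assumes M: "prob_space M1" "prob_space M2" and J: "finite J"
    and Y1 [measurable]: "\<And>i. i \<in> J \<Longrightarrow> Y1 i \<in> borel_measurable M1"
    and Y2 [measurable]: "\<And>i. i \<in> J \<Longrightarrow> Y2 i \<in> borel_measurable M2"
    and c: "\<And>c. (\<integral>\<omega>. cos (\<Sum>i\<in>J. c i * Y1 i \<omega>) \<partial>M1) = (\<integral>\<omega>. cos (\<Sum>i\<in>J. c i * Y2 i \<omega>) \<partial>M2)"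
    and s: "\<And>c. (\<integral>\<omega>. sin (\<Sum>i\<in>J. c i * Y1 i \<omega>) \<partial>M1) = (\<integral>\<omega>. sin (\<Sum>i\<in>J. c i * Y2 i \<omega>) \<partial>M2)"
    and A: "\<And>i. i \<in> J \<Longrightarrow> A i \<in> sets borel"
  shows "(\<integral>\<omega>. (\<Prod>i\<in>J. indicator (A i) (Y1 i \<omega>)) \<partial>M1) = (\<integral>\<omega>. (\<Prod>i\<in>J. indicator (A i) (Y2 i \<omega>) :: real) \<partial>M2)"
proof -
  interpret P1: prob_space M1 by fact
  interpret P2: prob_space M2 by fact
  define T1 where "T1 c \<omega> = (\<Sum>i\<in>J. c i * Y1 i \<omega>)" for c \<omega>
  define T2 where "T2 c \<omega> = (\<Sum>i\<in>J. c i * Y2 i \<omega>)" for c \<omega>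
  define P1 where "P1 K \<omega> = (\<Prod>i\<in>K. indicator (A i) (Y1 i \<omega>) :: real)" for K \<omega>
  define P2 where "P2 K \<omega> = (\<Prod>i\<in>K. indicator (A i) (Y2 i \<omega>) :: real)" for K \<omega>
  have mT [measurable]: "T1 c \<in> borel_measurable M1" "T2 c \<in> borel_measurable M2" for c
    unfolding T1_def T2_def using Y1 Y2 by measurable
  have mP: "P1 K \<in> borel_measurable M1" "P2 K \<in> borel_measurable M2" if "K \<subseteq> J" for K
    unfolding P1_def P2_def using that A Y1 Y2
    by (intro borel_measurable_prod, force intro!: measurable_compose[OF _ borel_measurable_indicator, of _ _ borel])+
  have bP: "0 \<le> P1 K \<omega>" "P1 K \<omega> \<le> 1" "0 \<le> P2 K \<omega>'" "P2 K \<omega>' \<le> 1" for K \<omega> \<omega>'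
    unfolding P1_def P2_def by (auto intro!: prod_nonneg prod_le_1)
  have int1: "integrable M1 (\<lambda>\<omega>. P1 K \<omega> * g \<omega>)" if "K \<subseteq> J" "g \<in> borel_measurable M1" "\<And>\<omega>. \<bar>g \<omega>\<bar> \<le> 1" for K g
    using that mP[OF that(1)] bP by (intro P1.integrable_const_bound[where B=1]) (auto simp: abs_mult intro!: mult_le_one)
  have int2: "integrable M2 (\<lambda>\<omega>. P2 K \<omega> * g \<omega>)" if "K \<subseteq> J" "g \<in> borel_measurable M2" "\<And>\<omega>. \<bar>g \<omega>\<bar> \<le> 1" for K g
    using that mP[OF that(1)] bP by (intro P2.integrable_const_bound[where B=1]) (auto simp: abs_mult intro!: mult_le_one)
  define E1 where "E1 K g = (\<integral>\<omega>. P1 K \<omega> * g \<omega> \<partial>M1)" for K g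
  define E2 where "E2 K g = (\<integral>\<omega>. P2 K \<omega> * g \<omega> \<partial>M2)" for K g
  have lin1: "E1 K (\<lambda>\<omega>. f \<omega> + a * g \<omega> + b * h \<omega>) = E1 K f + a * E1 K g + b * E1 K h"
    if "K \<subseteq> J" "f \<in> borel_measurable M1" "g \<in> borel_measurable M1" "h \<in> borel_measurable M1" 
      "\<And>\<omega>. \<bar>f \<omega>\<bar> \<le> 1" "\<And>\<omega>. \<bar>g \<omega>\<bar> \<le> 1" "\<And>\<omega>. \<bar>h \<omega>\<bar> \<le> 1" for K f g h a b
  proof -
    have "E1 K (\<lambda>\<omega>. f \<omega> + a * g \<omega> + b * h \<omega>) = (\<integral>\<omega>. P1 K \<omega> * f \<omega> + a * (P1 K \<omega> * g \<omega>) + b * (P1 K \<omega> * h \<omega>) \<partial>M1)"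
      unfolding E1_def by (intro Bochner_Integration.integral_cong refl) (simp add: algebra_simps)
    then show ?thesis unfolding E1_def
      using int1[OF that(1,2,5)] int1[OF that(1,3,6)] int1[OF that(1,4,7)] by simp
  qed
  have lin2: "E2 K (\<lambda>\<omega>. f \<omega> + a * g \<omega> + b * h \<omega>) = E2 K f + a * E2 K g + b * E2 K h"
    if "K \<subseteq> J" "f \<in> borel_measurable M2" "g \<in> borel_measurable M2" "h \<in> borel_measurable M2" 
      "\<And>\<omega>. \<bar>f \<omega>\<bar> \<le> 1" "\<And>\<omega>. \<bar>g \<omega>\<bar> \<le> 1" "\<And>\<omega>. \<bar>h \<omega>\<bar> \<le> 1" for K f g h a b
  proof -
    have "E2 K (\<lambda>\<omega>. f \<omega> + a * g \<omega> + b * h \<omega>) = (\<integral>\<omega>. P2 K \<omega> * f \<omega> + a * (P2 K \<omega> * g \<omega>) + b * (P2 K \<omega> * h \<omega>) \<partial>M2)"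
      unfolding E2_def by (intro Bochner_Integration.integral_cong refl) (simp add: algebra_simps)
    then show ?thesis unfolding E2_def
      using int2[OF that(1,2,5)] int2[OF that(1,3,6)] int2[OF that(1,4,7)] by simp
  qed
  \<comment> \<open>Induction on the set \<open>K\<close> of frozen coordinates: \<open>P1 K\<close>
    and \<open>P2 K\<close> carry their indicators, and arbitrary frequencies are still allowed on
    all of \<open>J\<close>. For empty \<open>K\<close> this is the hypothesis; for
    \<open>K = J\<close> and zero frequencies it is the claim.\<close>
  have "E1 K (\<lambda>\<omega>. cos (T1 c \<omega>)) = E2 K (\<lambda>\<omega>. cos (T2 c \<omega>)) \<and> E1 K (\<lambda>\<omega>. sin (T1 c \<omega>)) = E2 K (\<lambda>\<omega>. sin (T2 c \<omega>))"
    if "finite K" "K \<subseteq> J" for K c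
    using that
  proof (induction K arbitrary: c rule: finite_induct)
    case empty
    show ?case using assms(6)[of c] assms(7)[of c] by (simp add: E1_def E2_def P1_def P2_def T1_def T2_def)
  next
    case (insert k K)
    have k: "k \<in> J" "K \<subseteq> J" using insert.prems by auto
    note IHc = insert.IH[OF k(2), THEN conjunct1] and IHs = insert.IH[OF k(2), THEN conjunct2]
    define d where "d u = (\<lambda>i. if i = k then u else 0 :: real)" for u
    define a where "a c u = (\<lambda>i. c i + d u i)" for c :: "'i \<Rightarrow> real" and u
    have d0: "(\<Sum>i\<in>J. d u i * y i) = u * y k" for u y
      using J k(1) by (simp add: d_def if_distrib[of "\<lambda>x. x * _"] sum.delta' cong: if_cong)
    have D: "T1 (d u) \<omega> = u * Y1 k \<omega>" "T2 (d u) \<omega>' = u * Y2 k \<omega>'" for u \<omega> \<omega>'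
      unfolding T1_def T2_def by (rule d0)+
    have TA: "T1 (a c u) \<omega> = T1 c \<omega> + u * Y1 k \<omega>" "T2 (a c u) \<omega>' = T2 c \<omega>' + u * Y2 k \<omega>'" for c u \<omega> \<omega>'
      unfolding T1_def T2_def a_def by (simp_all add: distrib_right sum.distrib d0)
    \<comment> \<open>Product-to-sum formulas: a weight times a test function in coordinate
      \<open>k\<close> is a combination of cosines and sines of linear forms, to which the induction
      hypothesis applies.\<close>
    have e1: 
      "(1 + cos (T1 c \<omega>)) * cos (u * Y1 k \<omega>) = cos (T1 (d u) \<omega>) + 1/2 * cos (T1 (a c u) \<omega>) + 1/2 * cos (T1 (a c (- u)) \<omega>)"
      "(1 + cos (T1 c \<omega>)) * sin (u * Y1 k \<omega>) = sin (T1 (d u) \<omega>) + 1/2 * sin (T1 (a c u) \<omega>) + (- 1/2) * sin (T1 (a c (- u)) \<omega>)"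
      "(1 + sin (T1 c \<omega>)) * cos (u * Y1 k \<omega>) = cos (T1 (d u) \<omega>) + 1/2 * sin (T1 (a c u) \<omega>) + 1/2 * sin (T1 (a c (- u)) \<omega>)"
      "(1 + sin (T1 c \<omega>)) * sin (u * Y1 k \<omega>) = sin (T1 (d u) \<omega>) + (- 1/2) * cos (T1 (a c u) \<omega>) + 1/2 * cos (T1 (a c (- u)) \<omega>)"
      for c u \<omega>
      by (simp_all add: D TA cos_add sin_add cos_diff sin_diff field_simps)
    have e2: 
      "(1 + cos (T2 c \<omega>)) * cos (u * Y2 k \<omega>) = cos (T2 (d u) \<omega>) + 1/2 * cos (T2 (a c u) \<omega>) + 1/2 * cos (T2 (a c (- u)) \<omega>)"
      "(1 + cos (T2 c \<omega>)) * sin (u * Y2 k \<omega>) = sin (T2 (d u) \<omega>) + 1/2 * sin (T2 (a c u) \<omega>) + (- 1/2) * sin (T2 (a c (- u)) \<omega>)"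
      "(1 + sin (T2 c \<omega>)) * cos (u * Y2 k \<omega>) = cos (T2 (d u) \<omega>) + 1/2 * sin (T2 (a c u) \<omega>) + 1/2 * sin (T2 (a c (- u)) \<omega>)"
      "(1 + sin (T2 c \<omega>)) * sin (u * Y2 k \<omega>) = sin (T2 (d u) \<omega>) + (- 1/2) * cos (T2 (a c u) \<omega>) + 1/2 * cos (T2 (a c (- u)) \<omega>)"
      for c u \<omega>
      by (simp_all add: D TA cos_add sin_add cos_diff sin_diff field_simps)
    have lin: 
      "E1 K (\<lambda>\<omega>. cos (T1 c \<omega>) + r * cos (T1 c' \<omega>) + r' * cos (T1 c'' \<omega>)) = E2 K (\<lambda>\<omega>. cos (T2 c \<omega>) + r * cos (T2 c' \<omega>) + r' * cos (T2 c'' \<omega>))"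
      "E1 K (\<lambda>\<omega>. cos (T1 c \<omega>) + r * sin (T1 c' \<omega>) + r' * sin (T1 c'' \<omega>)) = E2 K (\<lambda>\<omega>. cos (T2 c \<omega>) + r * sin (T2 c' \<omega>) + r' * sin (T2 c'' \<omega>))"
      "E1 K (\<lambda>\<omega>. sin (T1 c \<omega>) + r * cos (T1 c' \<omega>) + r' * cos (T1 c'' \<omega>)) = E2 K (\<lambda>\<omega>. sin (T2 c \<omega>) + r * cos (T2 c' \<omega>) + r' * cos (T2 c'' \<omega>))"
      "E1 K (\<lambda>\<omega>. sin (T1 c \<omega>) + r * sin (T1 c' \<omega>) + r' * sin (T1 c'' \<omega>)) = E2 K (\<lambda>\<omega>. sin (T2 c \<omega>) + r * sin (T2 c' \<omega>) + r' * sin (T2 c'' \<omega>))"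
      for c c' c'' r r'
      using IHc IHs by (simp_all add: lin1[OF k(2)] lin2[OF k(2)])
    \<comment> \<open>The summand 1 makes the weight nonnegative, as
      \<open>weighted_uniqueness\<close> demands. The case of the zero functions isolates its
      contribution, which is subtracted afterwards.\<close>
    have main: "E1 (insert k K) (\<lambda>\<omega>. 1 + g1 \<omega>) = E2 (insert k K) (\<lambda>\<omega>. 1 + g2 \<omega>)"
      if g: "(\<exists>c. g1 = (\<lambda>\<omega>. cos (T1 c \<omega>)) \<and> g2 = (\<lambda>\<omega>. cos (T2 c \<omega>))) \<or> (\<exists>c. g1 = (\<lambda>\<omega>. sin (T1 c \<omega>)) \<and> g2 = (\<lambda>\<omega>. sin (T2 c \<omega>))) \<or> g1 = (\<lambda>_. 0) \<and> g2 = (\<lambda>_. 0)"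
      for g1 g2
    proof -
      have mg: "g1 \<in> borel_measurable M1" "g2 \<in> borel_measurable M2" using g by auto
      have bg: "\<bar>g1 \<omega>\<bar> \<le> 1" "\<bar>g2 \<omega>'\<bar> \<le> 1" for \<omega> \<omega>' using g by auto
      have bg': "- 1 \<le> g1 \<omega>" "g1 \<omega> \<le> 1" "- 1 \<le> g2 \<omega>'" "g2 \<omega>' \<le> 1" for \<omega> \<omega>' using bg(1)[of \<omega>] bg(2)[of \<omega>'] by auto
      have cc: "E1 K (\<lambda>\<omega>. (1 + g1 \<omega>) * cos (u * Y1 k \<omega>)) = E2 K (\<lambda>\<omega>. (1 + g2 \<omega>) * cos (u * Y2 k \<omega>))" for u
        using g
      proof (elim disjE exE conjE)
        fix c assume "g1 = (\<lambda>\<omega>. cos (T1 c \<omega>))" "g2 = (\<lambda>\<omega>. cos (T2 c \<omega>))"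
        then show ?thesis by (simp only: e1 e2) (simp only: lin)
      next
        fix c assume "g1 = (\<lambda>\<omega>. sin (T1 c \<omega>))" "g2 = (\<lambda>\<omega>. sin (T2 c \<omega>))"
        then show ?thesis by (simp only: e1 e2) (simp only: lin)
      next
        assume "g1 = (\<lambda>_. 0)" "g2 = (\<lambda>_. 0)"
        then show ?thesis using IHc[of "d u"] IHs[of "d u"] by (simp add: D)
      qed
      have ss: "E1 K (\<lambda>\<omega>. (1 + g1 \<omega>) * sin (u * Y1 k \<omega>)) = E2 K (\<lambda>\<omega>. (1 + g2 \<omega>) * sin (u * Y2 k \<omega>))" for u
        using g
      proof (elim disjE exE conjE)
        fix c assume "g1 = (\<lambda>\<omega>. cos (T1 c \<omega>))" "g2 = (\<lambda>\<omega>. cos (T2 c \<omega>))"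
        then show ?thesis by (simp only: e1 e2) (simp only: lin)
      next
        fix c assume "g1 = (\<lambda>\<omega>. sin (T1 c \<omega>))" "g2 = (\<lambda>\<omega>. sin (T2 c \<omega>))"
        then show ?thesis by (simp only: e1 e2) (simp only: lin)
      next
        assume "g1 = (\<lambda>_. 0)" "g2 = (\<lambda>_. 0)"
        then show ?thesis using IHc[of "d u"] IHs[of "d u"] by (simp add: D)
      qed
      have "(\<integral>\<omega>. (P1 K \<omega> * (1 + g1 \<omega>)) * indicator (A k) (Y1 k \<omega>) \<partial>M1) = (\<integral>\<omega>. (P2 K \<omega> * (1 + g2 \<omega>)) * indicator (A k) (Y2 k \<omega>) \<partial>M2)"
      proof (rule weighted_uniqueness[OF M, where K=2])
        show "P1 K \<omega> * (1 + g1 \<omega>) \<le> 2" "0 \<le> P1 K \<omega> * (1 + g1 \<omega>)" "P2 K \<omega>' * (1 + g2 \<omega>') \<le> 2" "0 \<le> P2 K \<omega>' * (1 + g2 \<omega>')" for \<omega> \<omega>'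
          using mult_mono[of "P1 K \<omega>" 1 "1 + g1 \<omega>" 2] mult_mono[of "P2 K \<omega>'" 1 "1 + g2 \<omega>'" 2] bP(1)[of K \<omega>] bP(2)[of K \<omega>] bP(3)[of K \<omega>'] bP(4)[of K \<omega>'] bg'(1,2)[of \<omega>] bg'(3,4)[of \<omega>']
          by auto
        show "(\<integral>\<omega>. P1 K \<omega> * (1 + g1 \<omega>) * cos (u * Y1 k \<omega>) \<partial>M1) = (\<integral>\<omega>. P2 K \<omega> * (1 + g2 \<omega>) * cos (u * Y2 k \<omega>) \<partial>M2)" for u
          using cc[of u] unfolding E1_def E2_def by (simp add: mult.assoc)
        show "(\<integral>\<omega>. P1 K \<omega> * (1 + g1 \<omega>) * sin (u * Y1 k \<omega>) \<partial>M1) = (\<integral>\<omega>. P2 K \<omega> * (1 + g2 \<omega>) * sin (u * Y2 k \<omega>) \<partial>M2)" for u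
          using ss[of u] unfolding E1_def E2_def by (simp add: mult.assoc)
      qed (use mP[OF k(2)] mg Y1[OF k(1)] Y2[OF k(1)] A[OF k(1)] in auto)
      then show ?thesis using insert.hyps unfolding E1_def E2_def P1_def P2_def by (simp add: mult_ac)
    qed
    have sub: "E1 (insert k K) g1 = E1 (insert k K) (\<lambda>\<omega>. 1 + g1 \<omega>) - E1 (insert k K) (\<lambda>\<omega>. 1 + 0)"
      if "g1 \<in> borel_measurable M1" "\<And>\<omega>. \<bar>g1 \<omega>\<bar> \<le> 1" for g1
      using lin1[OF insert.prems, of "\<lambda>_. 1" g1 g1 1 0] that by simp
    have sub2: "E2 (insert k K) g1 = E2 (insert k K) (\<lambda>\<omega>. 1 + g1 \<omega>) - E2 (insert k K) (\<lambda>\<omega>. 1 + 0)"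
      if "g1 \<in> borel_measurable M2" "\<And>\<omega>. \<bar>g1 \<omega>\<bar> \<le> 1" for g1
      using lin2[OF insert.prems, of "\<lambda>_. 1" g1 g1 1 0] that by simp
    have 0: "E1 (insert k K) (\<lambda>\<omega>. 1 + 0) = E2 (insert k K) (\<lambda>\<omega>. 1 + 0)" by (rule main) auto
    have 1: "E1 (insert k K) (\<lambda>\<omega>. 1 + cos (T1 c \<omega>)) = E2 (insert k K) (\<lambda>\<omega>. 1 + cos (T2 c \<omega>))" for c by (rule main) auto
    have 2: "E1 (insert k K) (\<lambda>\<omega>. 1 + sin (T1 c \<omega>)) = E2 (insert k K) (\<lambda>\<omega>. 1 + sin (T2 c \<omega>))" for c by (rule main) auto
    show ?case using 0 1[of c] 2[of c] sub[of "\<lambda>\<omega>. cos (T1 c \<omega>)"] sub[of "\<lambda>\<omega>. sin (T1 c \<omega>)"]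
       sub2[of "\<lambda>\<omega>. cos (T2 c \<omega>)"] sub2[of "\<lambda>\<omega>. sin (T2 c \<omega>)"] by simp
  qed
  from this[OF J order_refl, of "\<lambda>_. 0"] show ?thesis
    by (simp add: E1_def E2_def P1_def P2_def T1_def T2_def)
qed

section \<open>Laws on the product space of paths\<close>

lemma emeasure_distr_rectangle:
  fixes Y :: "'i \<Rightarrow> 'a \<Rightarrow> real"
  assumes N: "prob_space N" and Y: "\<And>i. i \<in> I \<Longrightarrow> Y i \<in> borel_measurable N"
    and J: "finite J" "J \<subseteq> I" and A: "\<And>i. i \<in> J \<Longrightarrow> A i \<in> sets borel"
  shows "emeasure (distr N (PiM I (\<lambda>_. borel)) (\<lambda>\<omega>. \<lambda>i\<in>I. Y i \<omega>)) (prod_emb I (\<lambda>_. borel) J (Pi\<^sub>E J A))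
    = ennreal (\<integral>\<omega>. (\<Prod>i\<in>J. indicator (A i) (Y i \<omega>) :: real) \<partial>N)"
proof -
  interpret N: prob_space N by fact
  let ?X = "prod_emb I (\<lambda>_. borel :: real measure) J (Pi\<^sub>E J A)"
  have X: "?X \<in> sets (PiM I (\<lambda>_. borel))" using J A by (intro sets_PiM_I) auto
  have m: "(\<lambda>\<omega>. \<lambda>i\<in>I. Y i \<omega>) \<in> measurable N (PiM I (\<lambda>_. borel))" using Y by (rule measurable_restrict)
  have "emeasure (distr N (PiM I (\<lambda>_. borel)) (\<lambda>\<omega>. \<lambda>i\<in>I. Y i \<omega>)) ?X = emeasure N ((\<lambda>\<omega>. \<lambda>i\<in>I. Y i \<omega>) -` ?X \<inter> space N)"
    by (rule emeasure_distr[OF m X])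
  also have "\<dots> = ennreal (\<integral>\<omega>. indicator ((\<lambda>\<omega>. \<lambda>i\<in>I. Y i \<omega>) -` ?X \<inter> space N) \<omega> \<partial>N :: real)"
    using measurable_sets[OF m X] by (simp add: N.emeasure_eq_measure)
  also have "(\<integral>\<omega>. indicator ((\<lambda>\<omega>. \<lambda>i\<in>I. Y i \<omega>) -` ?X \<inter> space N) \<omega> \<partial>N :: real) = (\<integral>\<omega>. (\<Prod>i\<in>J. indicator (A i) (Y i \<omega>) :: real) \<partial>N)"
  proof (intro Bochner_Integration.integral_cong refl)
    fix \<omega> assume w: "\<omega> \<in> space N"
    have "(\<lambda>i\<in>I. Y i \<omega>) \<in> ?X \<longleftrightarrow> (\<forall>i\<in>J. Y i \<omega> \<in> A i)"
      using J(2) by (auto simp: prod_emb_iff restrict_def PiE_iff extensional_def)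
    moreover have "(\<Prod>i\<in>J. indicator (A i) (Y i \<omega>)) = (if \<forall>i\<in>J. Y i \<omega> \<in> A i then 1 else 0 :: real)"
      using J(1) by (auto simp: indicator_def)
    ultimately show "indicator ((\<lambda>\<omega>. \<lambda>i\<in>I. Y i \<omega>) -` ?X \<inter> space N) \<omega> = (\<Prod>i\<in>J. indicator (A i) (Y i \<omega>) :: real)"
      using w by (simp add: indicator_def)
  qed
  finally show ?thesis .
qed

text \<open>Finite-dimensional rectangles form an intersection-stable generator of the product
  sigma-algebra, so agreement on them is enough for finite measures.\<close>

lemma distr_PiM_eqI:
  fixes Y1 :: "'i \<Rightarrow> 'a \<Rightarrow> real" and Y2 :: "'i \<Rightarrow> 'b \<Rightarrow> real"
  assumes M: "prob_space M1" "prob_space M2"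
    and Y1: "\<And>i. i \<in> I \<Longrightarrow> Y1 i \<in> borel_measurable M1"
    and Y2: "\<And>i. i \<in> I \<Longrightarrow> Y2 i \<in> borel_measurable M2"
    and c: "\<And>J c. finite J \<Longrightarrow> J \<subseteq> I \<Longrightarrow> (\<integral>\<omega>. cos (\<Sum>i\<in>J. c i * Y1 i \<omega>) \<partial>M1) = (\<integral>\<omega>. cos (\<Sum>i\<in>J. c i * Y2 i \<omega>) \<partial>M2)"
    and s: "\<And>J c. finite J \<Longrightarrow> J \<subseteq> I \<Longrightarrow> (\<integral>\<omega>. sin (\<Sum>i\<in>J. c i * Y1 i \<omega>) \<partial>M1) = (\<integral>\<omega>. sin (\<Sum>i\<in>J. c i * Y2 i \<omega>) \<partial>M2)"
  shows "distr M1 (PiM I (\<lambda>_. borel)) (\<lambda>\<omega>. \<lambda>i\<in>I. Y1 i \<omega>) = distr M2 (PiM I (\<lambda>_. borel)) (\<lambda>\<omega>. \<lambda>i\<in>I. Y2 i \<omega>)"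
proof (rule measure_eqI_PiM_infinite[where M="\<lambda>_. borel" and I=I])
  interpret P1: prob_space M1 by fact
  show "finite_measure (distr M1 (PiM I (\<lambda>_. borel)) (\<lambda>\<omega>. \<lambda>i\<in>I. Y1 i \<omega>))"
    using Y1 by (intro P1.finite_measure_distr measurable_restrict)
  fix A :: "'i \<Rightarrow> real set" and J assume J: "finite J" "J \<subseteq> I" and A: "\<And>i. i \<in> J \<Longrightarrow> A i \<in> sets borel"
  have "(\<integral>\<omega>. (\<Prod>i\<in>J. indicator (A i) (Y1 i \<omega>)) \<partial>M1) = (\<integral>\<omega>. (\<Prod>i\<in>J. indicator (A i) (Y2 i \<omega>) :: real) \<partial>M2)"
    by (rule joint_uniqueness[OF M J(1)]) (use J Y1 Y2 c s A in auto)
  then show "emeasure (distr M1 (PiM I (\<lambda>_. borel)) (\<lambda>\<omega>. \<lambda>i\<in>I. Y1 i \<omega>)) (prod_emb I (\<lambda>_. borel) J (Pi\<^sub>E J A))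
      = emeasure (distr M2 (PiM I (\<lambda>_. borel)) (\<lambda>\<omega>. \<lambda>i\<in>I. Y2 i \<omega>)) (prod_emb I (\<lambda>_. borel) J (Pi\<^sub>E J A))"
    using emeasure_distr_rectangle[OF M(1) Y1 J A] emeasure_distr_rectangle[OF M(2) Y2 J A] by simp
qed simp_all

section \<open>Resampling the endpoint of the path\<close>


text \<open>Expressing the characteristic function through the second moment covers the degenerate
  and the normal case by one formula.\<close>

lemma gaussian_rv_facts:
  assumes M: "prob_space M" and g: "gaussian_rv M L" and m: "(\<integral>\<omega>. L \<omega> \<partial>M) = 0"
  shows "square_integrable M L"
    and "(\<integral>\<omega>. cos (L \<omega>) \<partial>M) = exp (- (\<integral>\<omega>. (L \<omega>)\<^sup>2 \<partial>M) / 2)" and "(\<integral>\<omega>. sin (L \<omega>) \<partial>M) = 0"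
proof -
  interpret prob_space M by fact
  have mL [measurable]: "L \<in> borel_measurable M" using g by (simp add: gaussian_rv_def)
  obtain \<mu> \<sigma> where "(\<sigma> = 0 \<and> (AE \<omega> in M. L \<omega> = \<mu>)) \<or> (\<sigma> > 0 \<and> distributed M lborel L (normal_density \<mu> \<sigma>))"
    using g unfolding gaussian_rv_def by blast
  then have "square_integrable M L \<and> (\<integral>\<omega>. cos (L \<omega>) \<partial>M) = exp (- (\<integral>\<omega>. (L \<omega>)\<^sup>2 \<partial>M) / 2) \<and> (\<integral>\<omega>. sin (L \<omega>) \<partial>M) = 0"
  proof (elim disjE conjE)
    assume L: "AE \<omega> in M. L \<omega> = \<mu>"
    have "(\<integral>\<omega>. L \<omega> \<partial>M) = (\<integral>\<omega>. \<mu> \<partial>M)" by (rule integral_cong_AE) (use L in auto)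
    then have "\<mu> = 0" using m by (simp add: prob_space)
    then have L0: "AE \<omega> in M. L \<omega> = 0" using L by simp
    have "integrable M (\<lambda>\<omega>. (L \<omega>)\<^sup>2) \<longleftrightarrow> integrable M (\<lambda>\<omega>. 0 :: real)"
      by (rule integrable_cong_AE) (use L0 in auto)
    moreover have "(\<integral>\<omega>. (L \<omega>)\<^sup>2 \<partial>M) = (\<integral>\<omega>. 0 \<partial>M)" by (rule integral_cong_AE) (use L0 in auto)
    moreover have "(\<integral>\<omega>. cos (L \<omega>) \<partial>M) = (\<integral>\<omega>. 1 \<partial>M)" by (rule integral_cong_AE) (use L0 in auto)
    moreover have "(\<integral>\<omega>. sin (L \<omega>) \<partial>M) = (\<integral>\<omega>. 0 \<partial>M)" by (rule integral_cong_AE) (use L0 in auto)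
    ultimately show ?thesis by (simp add: square_integrable_def prob_space)
  next
    assume s: "\<sigma> > 0" and D: "distributed M lborel L (normal_density \<mu> \<sigma>)"
    have "\<mu> = 0" using normal_distributed_expectation[OF s D] m by simp
    then have D0: "distributed M lborel L (normal_density 0 \<sigma>)" using D by simp
    have v: "(\<integral>\<omega>. (L \<omega>)\<^sup>2 \<partial>M) = \<sigma>\<^sup>2" using normal_distributed_variance[OF s D0] m by simp
    have "integrable M (\<lambda>\<omega>. (L \<omega>)\<^sup>2)"
      using integrable_normal_moment[OF s, of 0 2] by (subst distributed_integrable[OF D0, symmetric]) auto
    then have 1: "square_integrable M L" by (simp add: square_integrable_def)
    have "distributed M lborel (\<lambda>x. L x / \<sigma>) std_normal_density"
      using D0 normal_standard_normal_convert[OF s, of L 0] by simp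
    then have d: "distr M lborel (\<lambda>x. L x / \<sigma>) = std_normal_distribution"
      by (simp add: distributed_def)
    have "(\<integral>\<omega>. cos (L \<omega>) \<partial>M) = (\<integral>x. cos (\<sigma> * x) \<partial>distr M lborel (\<lambda>x. L x / \<sigma>))"
      using s by (subst integral_distr) auto
    also have "\<dots> = Re (char std_normal_distribution \<sigma>)"
      unfolding d char_def using real_dist_normal_dist
      by (subst integral_Re[symmetric]) (auto intro!: prob_space.integrable_iexp simp: real_distribution_def Re_exp)
    also have "\<dots> = exp (- \<sigma>\<^sup>2 / 2)" by (simp add: char_std_normal_distribution)
    finally have 2: "(\<integral>\<omega>. cos (L \<omega>) \<partial>M) = exp (- \<sigma>\<^sup>2 / 2)" .
    have "(\<integral>\<omega>. sin (L \<omega>) \<partial>M) = (\<integral>x. sin (\<sigma> * x) \<partial>distr M lborel (\<lambda>x. L x / \<sigma>))"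
      using s by (subst integral_distr) auto
    also have "\<dots> = Im (char std_normal_distribution \<sigma>)"
      unfolding d char_def using real_dist_normal_dist
      by (subst integral_Im[symmetric]) (auto intro!: prob_space.integrable_iexp simp: real_distribution_def Im_exp)
    also have "\<dots> = 0" by (simp add: char_std_normal_distribution)
    finally show ?thesis using 1 2 v by simp
  qed
  then show "square_integrable M L" "(\<integral>\<omega>. cos (L \<omega>) \<partial>M) = exp (- (\<integral>\<omega>. (L \<omega>)\<^sup>2 \<partial>M) / 2)" "(\<integral>\<omega>. sin (L \<omega>) \<partial>M) = 0"
    by auto
qed

lemma std_normal_cos_sin:
  "(\<integral>z. cos (a * z) \<partial>std_normal_distribution) = exp (- a\<^sup>2 / 2)" "(\<integral>z. sin (a * z) \<partial>std_normal_distribution) = 0"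
proof -
  have i: "integrable std_normal_distribution (\<lambda>x. iexp (a * x))"
    using real_dist_normal_dist by (intro prob_space.integrable_iexp) (auto simp: real_distribution_def)
  have "char std_normal_distribution a = complex_of_real (exp (- a\<^sup>2 / 2))" by (simp add: char_std_normal_distribution)
  then show "(\<integral>z. cos (a * z) \<partial>std_normal_distribution) = exp (- a\<^sup>2 / 2)" "(\<integral>z. sin (a * z) \<partial>std_normal_distribution) = 0"
    using integral_Re[OF i] integral_Im[OF i] unfolding char_def by (auto simp: Re_exp Im_exp)
qed

section \<open>Consequences of Gaussianity and of the covariance\<close>

locale fbm = prob_space M for M :: "'a measure" +
  fixes H :: real and I :: "real set" and B :: "real \<Rightarrow> 'a \<Rightarrow> real"
  assumes fbm: "is_fbm M H I B"
begin

lemma fbm_gaussian: "finite A \<Longrightarrow> A \<subseteq> I \<Longrightarrow> gaussian_rv M (\<lambda>\<omega>. \<Sum>t\<in>A. c t * B t \<omega>)"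
  using fbm by (simp add: is_fbm_def gaussian_process_def)

lemma fbm_mean: "s \<in> I \<Longrightarrow> (\<integral>\<omega>. B s \<omega> \<partial>M) = 0"
  using fbm by (simp add: is_fbm_def)

lemma fbm_covariance: "s \<in> I \<Longrightarrow> r \<in> I \<Longrightarrow> (\<integral>\<omega>. B s \<omega> * B r \<omega> \<partial>M) = fbm_cov H s r"
  using fbm by (simp add: is_fbm_def)

lemma fbm_continuous: "\<omega> \<in> space M \<Longrightarrow> continuous_on I (\<lambda>t. B t \<omega>)"
  using fbm by (simp add: is_fbm_def)

lemma fbm_square_integrable: "s \<in> I \<Longrightarrow> square_integrable M (B s)"
  using gaussian_rv_facts(1)[OF prob_space_axioms fbm_gaussian[of "{s}" "\<lambda>_. 1"]] fbm_mean by simp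

lemma fbm_measurable: "s \<in> I \<Longrightarrow> B s \<in> borel_measurable M"
  using fbm_square_integrable by (simp add: square_integrable_def)

lemma fbm_integrable: "s \<in> I \<Longrightarrow> integrable M (B s)"
  using fbm_square_integrable square_integrable_mult[of M "B s" "\<lambda>_. 1"] by (auto simp: square_integrable_def)

lemma fbm_lincomb:
  fixes c :: "real \<Rightarrow> real"
  assumes "finite A" "A \<subseteq> I"
  defines "V \<equiv> \<Sum>s\<in>A. \<Sum>r\<in>A. c s * c r * fbm_cov H s r"
  shows "(\<integral>\<omega>. cos (\<Sum>t\<in>A. c t * B t \<omega>) \<partial>M) = exp (- V / 2)" "(\<integral>\<omega>. sin (\<Sum>t\<in>A. c t * B t \<omega>) \<partial>M) = 0"
proof -
  have m: "(\<integral>\<omega>. (\<Sum>t\<in>A. c t * B t \<omega>) \<partial>M) = 0"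
    using assms fbm_mean fbm_integrable by (subst Bochner_Integration.integral_sum) (auto intro!: sum.neutral)
  have i: "integrable M (\<lambda>\<omega>. B s \<omega> * B r \<omega>)" if "s \<in> A" "r \<in> A" for s r
    using that assms(2) by (intro square_integrable_mult fbm_square_integrable) auto
  have "(\<integral>\<omega>. (\<Sum>t\<in>A. c t * B t \<omega>)\<^sup>2 \<partial>M) = (\<integral>\<omega>. (\<Sum>s\<in>A. \<Sum>r\<in>A. c s * c r * (B s \<omega> * B r \<omega>)) \<partial>M)"
    unfolding power2_eq_square sum_product by (simp add: mult_ac)
  also have "\<dots> = (\<Sum>s\<in>A. \<Sum>r\<in>A. c s * c r * (\<integral>\<omega>. B s \<omega> * B r \<omega> \<partial>M))"
    using i by (simp add: Bochner_Integration.integral_sum Bochner_Integration.integrable_sum)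
  also have "\<dots> = V" unfolding V_def using assms(2) by (intro sum.cong refl) (auto simp: fbm_covariance subset_iff)
  finally have v: "(\<integral>\<omega>. (\<Sum>t\<in>A. c t * B t \<omega>)\<^sup>2 \<partial>M) = V" .
  show "(\<integral>\<omega>. cos (\<Sum>t\<in>A. c t * B t \<omega>) \<partial>M) = exp (- V / 2)" "(\<integral>\<omega>. sin (\<Sum>t\<in>A. c t * B t \<omega>) \<partial>M) = 0"
    using gaussian_rv_facts(2,3)[OF prob_space_axioms fbm_gaussian[OF assms(1,2)] m] unfolding v by auto
qed

lemma fbm_cov_self: "t \<ge> 0 \<Longrightarrow> fbm_cov H t t = (t powr H)\<^sup>2"
  by (simp add: fbm_cov_def power2_eq_square flip: powr_add)

lemma fbm_cov_commute: "fbm_cov H s t = fbm_cov H t s"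
  by (simp add: fbm_cov_def abs_minus_commute)

text \<open>The reason is that \<open>B\<^sub>t\<close> is uncorrelated with the residuals \<open>B\<^sub>s - h(s) B\<^sub>t / t\<^sup>H\<close>, hence
  independent of them.\<close>

lemma fbm_resample:
  assumes t: "t > 0" "{0..t} \<subseteq> I"
  defines "h \<equiv> \<lambda>s. fbm_cov H s t / t powr H"
  shows "distr M (PiM {0..t} (\<lambda>_. borel)) (\<lambda>\<omega>. \<lambda>s\<in>{0..t}. B s \<omega>) =
    distr (M \<Otimes>\<^sub>M std_normal_distribution) (PiM {0..t} (\<lambda>_. borel))
      (\<lambda>p. \<lambda>s\<in>{0..t}. B s (fst p) + (snd p - B t (fst p) / t powr H) * h s)"
proof -
  let ?N = std_normal_distribution
  interpret N: real_distribution ?N by (rule real_dist_normal_dist)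
  interpret P: pair_prob_space M ?N ..
  have sub: "s \<in> I" if "s \<in> {0..t}" for s using t(2) that by auto
  have tI: "t \<in> I" using t by auto
  have p: "t powr H > 0" using t by simp
  have mB: "B s \<in> borel_measurable M" if "s \<in> {0..t}" for s by (rule fbm_measurable[OF sub[OF that]])
  have mY: "(\<lambda>p. B s (fst p) + (snd p - B t (fst p) / t powr H) * h s) \<in> borel_measurable (M \<Otimes>\<^sub>M ?N)" if "s \<in> {0..t}" for s
  proof -
    have [measurable]: "B s \<in> borel_measurable M" "B t \<in> borel_measurable M" using mB that t by auto
    have [measurable]: "snd \<in> borel_measurable (M \<Otimes>\<^sub>M ?N)" 
      using measurable_snd[of M ?N] by (simp cong: measurable_cong_sets)
    show ?thesis by measurable
  qed
  have key: "(\<integral>p. cos (\<Sum>s\<in>J. c s * (B s (fst p) + (snd p - B t (fst p) / t powr H) * h s)) \<partial>(M \<Otimes>\<^sub>M ?N)) = (\<integral>\<omega>. cos (\<Sum>s\<in>J. c s * B s \<omega>) \<partial>M)"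
     "(\<integral>p. sin (\<Sum>s\<in>J. c s * (B s (fst p) + (snd p - B t (fst p) / t powr H) * h s)) \<partial>(M \<Otimes>\<^sub>M ?N)) = (\<integral>\<omega>. sin (\<Sum>s\<in>J. c s * B s \<omega>) \<partial>M)"
    if J: "finite J" "J \<subseteq> {0..t}" for J c
  proof -
    \<comment> \<open>The coefficient of the new Gaussian variable in the linear form; what remains
      is a combination \<open>L\<close> of values of \<open>B\<close>.\<close>
    define a where "a = (\<Sum>s\<in>J. c s * h s)"
    \<comment> \<open>The endpoint \<open>t\<close> may or may not belong to \<open>J\<close>, so
      its two contributions are added on \<open>K = insert t J\<close>.\<close>
    define c' where "c' s = (if s \<in> J then c s else 0) + (if s = t then - (a / t powr H) else 0)" for s
    define K where "K = insert t J"
    have K: "finite K" "K \<subseteq> I" "t \<in> K" "J \<subseteq> K" using J sub tI by (auto simp: K_def)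
    have sumK: "(\<Sum>s\<in>K. c' s * y s) = (\<Sum>s\<in>J. c s * y s) - a / t powr H * y t" for y
    proof -
      have "(\<Sum>s\<in>K. c' s * y s) = (\<Sum>s\<in>K. if s \<in> J then c s * y s else 0) + (\<Sum>s\<in>K. if s = t then - (a / t powr H) * y t else 0)"
        unfolding sum.distrib[symmetric] c'_def by (intro sum.cong) (auto simp: algebra_simps)
      also have "(\<Sum>s\<in>K. if s \<in> J then c s * y s else 0) = (\<Sum>s\<in>J. c s * y s)"
        using K by (simp add: sum.If_cases Int_absorb1)
      also have "(\<Sum>s\<in>K. if s = t then - (a / t powr H) * y t else 0) = - (a / t powr H) * y t"
        using K by simp
      finally show ?thesis by simp
    qed
    define L where "L \<omega> = (\<Sum>s\<in>K. c' s * B s \<omega>)" for \<omega>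
    have split: "(\<Sum>s\<in>J. c s * (B s \<omega> + (z - B t \<omega> / t powr H) * h s)) = L \<omega> + a * z" for \<omega> z
    proof -
      have "(\<Sum>s\<in>J. c s * (B s \<omega> + (z - B t \<omega> / t powr H) * h s)) = (\<Sum>s\<in>J. c s * B s \<omega> + (z - B t \<omega> / t powr H) * (c s * h s))"
        by (intro sum.cong) (auto simp: algebra_simps)
      also have "\<dots> = (\<Sum>s\<in>J. c s * B s \<omega>) + (z - B t \<omega> / t powr H) * a"
        by (simp add: sum.distrib a_def sum_distrib_left)
      finally show ?thesis unfolding L_def sumK by (simp add: algebra_simps)
    qed
    define V where "V = (\<Sum>s\<in>J. \<Sum>r\<in>J. c s * c r * fbm_cov H s r)"
    have cross: "(\<Sum>s\<in>J. c s * fbm_cov H s t) = a * t powr H"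
      unfolding a_def h_def using p by (simp add: sum_distrib_right)
    have "(\<Sum>s\<in>K. \<Sum>r\<in>K. c' s * c' r * fbm_cov H s r) = (\<Sum>s\<in>K. c' s * (\<Sum>r\<in>K. c' r * fbm_cov H s r))"
      by (simp add: sum_distrib_left mult.assoc)
    also have "\<dots> = (\<Sum>s\<in>K. c' s * ((\<Sum>r\<in>J. c r * fbm_cov H s r) - a / t powr H * fbm_cov H s t))"
      unfolding sumK ..
    also have "\<dots> = (\<Sum>s\<in>J. c s * ((\<Sum>r\<in>J. c r * fbm_cov H s r) - a / t powr H * fbm_cov H s t)) 
        - a / t powr H * ((\<Sum>r\<in>J. c r * fbm_cov H t r) - a / t powr H * fbm_cov H t t)"
      unfolding sumK ..
    also have "(\<Sum>r\<in>J. c r * fbm_cov H t r) = a * t powr H" using cross by (simp add: fbm_cov_commute[of t])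
    also have "(\<Sum>s\<in>J. c s * ((\<Sum>r\<in>J. c r * fbm_cov H s r) - a / t powr H * fbm_cov H s t)) = V - a / t powr H * (a * t powr H)"
      unfolding V_def cross[symmetric] by (simp add: right_diff_distrib sum_subtractf sum_distrib_left mult_ac)
    also have "V - a / t powr H * (a * t powr H) - a / t powr H * (a * t powr H - a / t powr H * fbm_cov H t t) = V - a\<^sup>2"
      using p t by (simp add: fbm_cov_self power2_eq_square)
    \<comment> \<open>Removing the part along \<open>B t\<close> lowers the variance by
      \<open>a\<^sup>2\<close>, which is exactly the variance of the independent term
      \<open>a * z\<close>; the product of the two characteristic functions restores
      \<open>exp (- V / 2)\<close>.\<close>
    finally have VK: "(\<Sum>s\<in>K. \<Sum>r\<in>K. c' s * c' r * fbm_cov H s r) = V - a\<^sup>2" .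
    have Lcs: "(\<integral>\<omega>. cos (L \<omega>) \<partial>M) = exp (- (V - a\<^sup>2) / 2)" "(\<integral>\<omega>. sin (L \<omega>) \<partial>M) = 0"
      using fbm_lincomb[OF K(1,2), of c'] unfolding VK L_def by auto
    have mL [measurable]: "L \<in> borel_measurable M"
      unfolding L_def using K fbm_measurable by (intro borel_measurable_sum borel_measurable_times) auto
    have [measurable]: "snd \<in> borel_measurable (M \<Otimes>\<^sub>M ?N)" 
      using measurable_snd[of M ?N] by (simp cong: measurable_cong_sets)
    have ip: "integrable (M \<Otimes>\<^sub>M ?N) (\<lambda>p. g (L (fst p) + a * snd p))" if "g = cos \<or> g = sin" for g :: "real \<Rightarrow> real"
      by (rule P.integrable_const_bound[where B=1]) (use that in auto)
    have iN: "integrable ?N (\<lambda>z. cos (a * z))" "integrable ?N (\<lambda>z. sin (a * z))"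
      by (auto intro!: N.integrable_const_bound[where B=1])
    have iL: "integrable M (\<lambda>\<omega>. cos (L \<omega>))" "integrable M (\<lambda>\<omega>. sin (L \<omega>))"
      by (auto intro!: integrable_const_bound[where B=1])
    have "(\<integral>p. cos (L (fst p) + a * snd p) \<partial>(M \<Otimes>\<^sub>M ?N)) = (\<integral>\<omega>. (\<integral>z. cos (L \<omega> + a * z) \<partial>?N) \<partial>M)"
      using P.integral_fst'[OF ip[of cos]] by simp
    also have "\<dots> = (\<integral>\<omega>. cos (L \<omega>) * exp (- a\<^sup>2 / 2) \<partial>M)"
      using iN by (simp add: cos_add std_normal_cos_sin)
    also have "\<dots> = exp (- V / 2)" using Lcs by (simp flip: exp_add add: field_simps)
    finally have C: "(\<integral>p. cos (L (fst p) + a * snd p) \<partial>(M \<Otimes>\<^sub>M ?N)) = exp (- V / 2)" .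
    have "(\<integral>p. sin (L (fst p) + a * snd p) \<partial>(M \<Otimes>\<^sub>M ?N)) = (\<integral>\<omega>. (\<integral>z. sin (L \<omega> + a * z) \<partial>?N) \<partial>M)"
      using P.integral_fst'[OF ip[of sin]] by simp
    also have "\<dots> = (\<integral>\<omega>. sin (L \<omega>) * exp (- a\<^sup>2 / 2) \<partial>M)"
      using iN by (simp add: sin_add std_normal_cos_sin)
    also have "\<dots> = 0" using Lcs by simp
    finally have S: "(\<integral>p. sin (L (fst p) + a * snd p) \<partial>(M \<Otimes>\<^sub>M ?N)) = 0" .
    have JI: "J \<subseteq> I" using J sub by auto
    show "(\<integral>p. cos (\<Sum>s\<in>J. c s * (B s (fst p) + (snd p - B t (fst p) / t powr H) * h s)) \<partial>(M \<Otimes>\<^sub>M ?N)) = (\<integral>\<omega>. cos (\<Sum>s\<in>J. c s * B s \<omega>) \<partial>M)"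
     "(\<integral>p. sin (\<Sum>s\<in>J. c s * (B s (fst p) + (snd p - B t (fst p) / t powr H) * h s)) \<partial>(M \<Otimes>\<^sub>M ?N)) = (\<integral>\<omega>. sin (\<Sum>s\<in>J. c s * B s \<omega>) \<partial>M)"
      unfolding split C S fbm_lincomb[OF J(1) JI] V_def by auto
  qed
  show ?thesis
    by (rule distr_PiM_eqI[OF prob_space_axioms P.prob_space_axioms mB mY]) (auto simp: key)
qed

end

section \<open>The Euler scheme\<close>


text \<open>The iterates approximate the solution minus the path. So \<open>b\<close> is only
  evaluated at grid points, and the scheme makes sense for every function \<open>b\<close>.\<close>

primrec euler :: "(real \<Rightarrow> real \<Rightarrow> real) \<Rightarrow> real \<Rightarrow> real \<Rightarrow> nat \<Rightarrow> (real \<Rightarrow> real) \<Rightarrow> nat \<Rightarrow> real" where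
  "euler F x0 t n b 0 = x0"
| "euler F x0 t n b (Suc k) = euler F x0 t n b k + t / n * F (t * k / n) (euler F x0 t n b k + b (t * k / n))"

text \<open>With the limit superior, nothing has to be known about solutions along shifted paths. The
  sequence is bounded for the drifts considered below, so \<open>real_of_ereal\<close> loses nothing.\<close>

definition euler_limit :: "(real \<Rightarrow> real \<Rightarrow> real) \<Rightarrow> real \<Rightarrow> real \<Rightarrow> (real \<Rightarrow> real) \<Rightarrow> real" where
  "euler_limit F x0 t b = real_of_ereal (limsup (\<lambda>n. ereal (euler F x0 t n b n + b t)))"

locale euler_drift =
  fixes F :: "real \<Rightarrow> real \<Rightarrow> real" and x0 t A C :: real
  assumes t: "t > 0" and A: "A \<ge> 0"
    and lip: "\<And>s x y. s \<in> {0..t} \<Longrightarrow> \<bar>F s x - F s y\<bar> \<le> A * \<bar>x - y\<bar>"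
    and bd: "\<And>s x. s \<in> {0..t} \<Longrightarrow> \<bar>F s x\<bar> \<le> C"
begin

lemma grid: "k \<le> n \<Longrightarrow> t * real k / real n \<in> {0..t}"
  using t by (cases "n = 0") (auto simp: field_simps)

lemma euler_bound: "k \<le> n \<Longrightarrow> \<bar>euler F x0 t n b k - x0\<bar> \<le> k * (t / n * C)"
proof (induction k)
  case (Suc k)
  have "\<bar>t / n * F (t * k / n) (euler F x0 t n b k + b (t * k / n))\<bar> \<le> t / n * C"
    using t bd[OF grid, of k n] Suc.prems unfolding abs_mult by (intro mult_mono) auto
  moreover have "\<bar>(a + u) - x0\<bar> \<le> real (Suc k) * w" if "\<bar>a - x0\<bar> \<le> k * w" "\<bar>u\<bar> \<le> w" for a u w :: real
  proof -
    have "real (Suc k) * w = k * w + w" by (simp add: distrib_right)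
    then show ?thesis using that by linarith
  qed
  ultimately show ?case using Suc unfolding euler.simps by (meson Suc_leD)
qed simp

lemma euler_bound': "\<bar>euler F x0 t n b n + b t\<bar> \<le> \<bar>x0\<bar> + t * \<bar>C\<bar> + \<bar>b t\<bar>"
proof -
  have "\<bar>euler F x0 t n b n - x0\<bar> \<le> n * (t / n * C)" by (rule euler_bound) simp
  also have "\<dots> \<le> t * \<bar>C\<bar>" using t by (cases "n = 0") auto
  finally show ?thesis by linarith
qed

lemma continuous_drift: "s \<in> {0..t} \<Longrightarrow> continuous_on UNIV (F s)"
  using lip A by (intro lipschitz_on_continuous_on[of A]) (auto simp: lipschitz_on_def dist_real_def)

lemma euler_measurable:
  assumes "k \<le> n"
  shows "(\<lambda>b. euler F x0 t n b k) \<in> borel_measurable (PiM {0..t} (\<lambda>_. borel))"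
  using assms
proof (induction k)
  case (Suc k)
  have g: "t * k / n \<in> {0..t}" using grid[of k n] Suc.prems by simp
  have "F (t * k / n) \<in> borel_measurable borel"
    by (rule borel_measurable_continuous_onI[OF continuous_drift[OF g]])
  moreover have "(\<lambda>b. b (t * k / n)) \<in> borel_measurable (PiM {0..t} (\<lambda>_. borel))"
    by (rule measurable_component_singleton[OF g])
  moreover have e: "(\<lambda>b. euler F x0 t n b k) \<in> borel_measurable (PiM {0..t} (\<lambda>_. borel))"
    using Suc by simp
  ultimately have "(\<lambda>b. F (t * k / n) (euler F x0 t n b k + b (t * k / n))) \<in> borel_measurable (PiM {0..t} (\<lambda>_. borel))"
    using measurable_compose[OF borel_measurable_add] by blast
  then show ?case unfolding euler.simps
    by (intro borel_measurable_add borel_measurable_times borel_measurable_const e)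
qed simp

text \<open>Each iterate is a measurable function of finitely many coordinates, and a limit superior
  over a sequence preserves measurability for the product sigma-algebra.\<close>

lemma euler_limit_measurable: "euler_limit F x0 t \<in> borel_measurable (PiM {0..t} (\<lambda>_. borel))"
proof -
  have "(\<lambda>b. b t) \<in> borel_measurable (PiM {0..t} (\<lambda>_. borel))"
    by (rule measurable_component_singleton) (use t in auto)
  then show ?thesis unfolding euler_limit_def[abs_def] using euler_measurable[OF order_refl] by measurable
qed

lemma euler_cong: "(\<And>s. s \<in> {0..t} \<Longrightarrow> b s = b' s) \<Longrightarrow> k \<le> n \<Longrightarrow> euler F x0 t n b k = euler F x0 t n b' k"
  using grid by (induction k) auto

lemma euler_limit_cong: "(\<And>s. s \<in> {0..t} \<Longrightarrow> b s = b' s) \<Longrightarrow> euler_limit F x0 t b = euler_limit F x0 t b'"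
  using euler_cong[of b b' n n for n] t by (simp add: euler_limit_def)

text \<open>The lower bound tends to a positive multiple of \<open>\<delta>\<close> as the mesh tends to \<open>0\<close>, hence it survives
  the limit superior.\<close>

lemma euler_shift:
  assumes b: "\<And>s. s \<in> {0..t} \<Longrightarrow> b1 s = b2 s + \<delta> * h s" and \<delta>: "\<delta> \<ge> 0"
    and h: "\<And>s r. 0 \<le> s \<Longrightarrow> s \<le> r \<Longrightarrow> r \<le> t \<Longrightarrow> h s \<le> h r" "h 0 \<ge> 0"
    and n: "n > 0" "A * (t / n) \<le> 1" and k: "k \<le> n"
  shows "(euler F x0 t n b1 k + b1 (t * k / n)) - (euler F x0 t n b2 k + b2 (t * k / n)) \<ge> \<delta> * (1 - A * (t / n)) ^ k * h (t * k / n)"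
  using k
proof (induction k)
  case 0
  then show ?case using b[of 0] t by simp
next
  case (Suc k)
  let ?q = "1 - A * (t / n)"
  let ?X1 = "euler F x0 t n b1 k + b1 (t * k / n)" and ?X2 = "euler F x0 t n b2 k + b2 (t * k / n)"
  have q: "0 \<le> ?q" "?q \<le> 1" using n A t by auto
  have g: "t * k / n \<in> {0..t}" "t * Suc k / n \<in> {0..t}" using grid[of k n] grid[of "Suc k" n] Suc.prems by auto
  have le: "t * k / n \<le> t * Suc k / n" using t by (intro divide_right_mono mult_left_mono) auto
  have hk: "0 \<le> h (t * k / n)" "h (t * k / n) \<le> h (t * Suc k / n)"
    using h(1)[of 0 "t * k / n"] h(1)[OF _ le] h(2) g by auto
  have IH: "\<delta> * ?q ^ k * h (t * k / n) \<le> ?X1 - ?X2" using Suc by simp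
  have D0: "0 \<le> ?X1 - ?X2" using IH \<delta> q hk by (meson mult_nonneg_nonneg order_trans zero_le_power)
  have "\<bar>F (t * k / n) ?X1 - F (t * k / n) ?X2\<bar> \<le> A * (?X1 - ?X2)" using lip[OF g(1), of ?X1 ?X2] D0 by simp
  then have "- (A * (?X1 - ?X2)) \<le> F (t * k / n) ?X1 - F (t * k / n) ?X2" by linarith
  then have "t / n * (- (A * (?X1 - ?X2))) \<le> t / n * (F (t * k / n) ?X1 - F (t * k / n) ?X2)"
    using t by (intro mult_left_mono) auto
  \<comment> \<open>By the Lipschitz bound, one step of the drift can shrink the gap by the factor
    \<open>?q\<close> at most.\<close>
  then have "?q * (?X1 - ?X2) \<le> (?X1 - ?X2) + (t / n * F (t * k / n) ?X1 - t / n * F (t * k / n) ?X2)"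
    by (simp add: algebra_simps)
  moreover have "(euler F x0 t n b1 (Suc k) + b1 (t * Suc k / n)) - (euler F x0 t n b2 (Suc k) + b2 (t * Suc k / n))
     = (?X1 - ?X2) + (t / n * F (t * k / n) ?X1 - t / n * F (t * k / n) ?X2) + \<delta> * (h (t * Suc k / n) - h (t * k / n))"
    using b[OF g(1)] b[OF g(2)] by (simp only: euler.simps) (simp add: algebra_simps)
  moreover have "?q * (\<delta> * ?q ^ k * h (t * k / n)) \<le> ?q * (?X1 - ?X2)" using IH q by (intro mult_left_mono) auto
  \<comment> \<open>Monotonicity of \<open>h\<close> enters here: the newly added increment is
    nonnegative, so it may be damped by the same factor as the rest.\<close>
  moreover have "\<delta> * ?q ^ Suc k * (h (t * Suc k / n) - h (t * k / n)) \<le> \<delta> * (h (t * Suc k / n) - h (t * k / n))"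
    using \<delta> q hk power_le_one[OF q, of "Suc k"] by (intro mult_right_mono) (auto intro: mult_left_le)
  moreover have "\<delta> * q ^ Suc k * y = q * (\<delta> * q ^ k * x) + \<delta> * q ^ Suc k * (y - x)" for q x y :: real
    by (simp add: algebra_simps)
  note this[of ?q "h (t * Suc k / n)" "h (t * k / n)"]
  ultimately show ?case by linarith
qed

lemma euler_limit_shift:
  assumes b: "\<And>s. s \<in> {0..t} \<Longrightarrow> b1 s = b2 s + \<delta> * h s" and \<delta>: "\<delta> \<ge> 0"
    and h: "\<And>s r. 0 \<le> s \<Longrightarrow> s \<le> r \<Longrightarrow> r \<le> t \<Longrightarrow> h s \<le> h r" "h 0 \<ge> 0"
  shows "euler_limit F x0 t b1 - euler_limit F x0 t b2 \<ge> \<delta> * (exp (- A * t) / 2 * h t)"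
proof -
  define c where "c = \<delta> * (exp (- A * t) / 2 * h t)"
  define g1 where "g1 n = euler F x0 t n b1 n + b1 t" for n
  define g2 where "g2 n = euler F x0 t n b2 n + b2 t" for n
  have ht: "h t \<ge> 0" using h(1)[of 0 t] h(2) t by simp
  \<comment> \<open>The damping factor of the discrete estimate tends to
    \<open>exp (- A * t)\<close>; half of this limit is a lower bound for all large
    \<open>n\<close>.\<close>
  have "(\<lambda>n. (1 + (- A * t) / real n) ^ n) \<longlonglongrightarrow> exp (- A * t)" by (rule tendsto_exp_limit_sequentially)
  moreover have "exp (- A * t) / 2 < exp (- A * t)" by simp
  ultimately have "\<forall>\<^sub>F n in sequentially. exp (- A * t) / 2 < (1 + (- A * t) / real n) ^ n" by (rule order_tendstoD)
  moreover have "\<forall>\<^sub>F n in sequentially. A * t < real n"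
    using filterlim_real_sequentially unfolding filterlim_at_top_dense by blast
  ultimately have ev: "\<forall>\<^sub>F n in sequentially. ereal (g2 n) + ereal c \<le> ereal (g1 n)"
    using eventually_gt_at_top[of 0]
  proof eventually_elim
    case (elim n)
    have "A * (t / n) \<le> 1" using elim by (simp add: field_simps)
    from euler_shift[of b1 b2 \<delta> h n n, OF b \<delta> h elim(3) this order_refl]
    have "\<delta> * (1 - A * (t / n)) ^ n * h t \<le> g1 n - g2 n" using elim(3) by (simp add: g1_def g2_def)
    moreover have "exp (- A * t) / 2 \<le> (1 - A * (t / n)) ^ n" using elim(1) by simp
    then have "c \<le> \<delta> * (1 - A * (t / n)) ^ n * h t"
      unfolding c_def mult.assoc using \<delta> ht by (intro mult_left_mono mult_right_mono)
    ultimately show ?case by simp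
  qed
  \<comment> \<open>Finiteness makes \<open>real_of_ereal\<close> faithful, so that the inequality
    between limits superior becomes one between reals.\<close>
  have fin: "\<exists>r. limsup (\<lambda>n. ereal (g n)) = ereal r" if "\<And>n. \<bar>g n\<bar> \<le> K" for g :: "nat \<Rightarrow> real" and K
  proof -
    have "limsup (\<lambda>n. ereal (g n)) \<le> ereal K"
      using that by (intro Limsup_bounded always_eventually allI) (auto simp: abs_le_iff)
    moreover have "ereal (- K) \<le> limsup (\<lambda>n. ereal (g n))"
    proof -
      have "ereal (- K) = limsup (\<lambda>n::nat. ereal (- K))" by (rule Limsup_const[symmetric]) simp
      also have "\<dots> \<le> limsup (\<lambda>n. ereal (g n))"
        using that by (intro Limsup_mono always_eventually allI) (auto simp: abs_le_iff minus_le_iff)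
      finally show ?thesis .
    qed
    ultimately show ?thesis by (cases "limsup (\<lambda>n. ereal (g n))") auto
  qed
  obtain r1 where r1: "limsup (\<lambda>n. ereal (g1 n)) = ereal r1"
    using fin[of g1, unfolded g1_def, OF euler_bound'[of _ b1]] unfolding g1_def by blast
  obtain r2 where r2: "limsup (\<lambda>n. ereal (g2 n)) = ereal r2"
    using fin[of g2, unfolded g2_def, OF euler_bound'[of _ b2]] unfolding g2_def by blast
  note r = r1 r2
  have "limsup (\<lambda>n. ereal (g2 n) + ereal c) \<le> limsup (\<lambda>n. ereal (g1 n))" by (rule Limsup_mono[OF ev])
  moreover have "limsup (\<lambda>n. ereal (g2 n) + ereal c) = limsup (\<lambda>n. ereal (g2 n)) + ereal c"
    by (rule Limsup_add_ereal_right) auto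
  ultimately have "r2 + c \<le> r1" using r by simp
  then show ?thesis unfolding euler_limit_def g1_def[symmetric] g2_def[symmetric] r c_def[symmetric] by simp
qed

text \<open>The map \<open>G\<close> expands distances by at least the factor \<open>c\<close>,
  hence is injective with a Lipschitz inverse on its range. The set in question is the image under
  this inverse of a subset of \<open>N\<close>, and Lipschitz images of negligible sets are
  negligible.\<close>

lemma euler_limit_null:
  assumes h: "\<And>s r. 0 \<le> s \<Longrightarrow> s \<le> r \<Longrightarrow> r \<le> t \<Longrightarrow> h s \<le> h r" "h 0 \<ge> 0" "h t > 0"
    and N: "N \<in> null_sets lborel"
  shows "negligible {z. euler_limit F x0 t (\<lambda>s. b s + z * h s) \<in> N}"
proof -
  define G where "G z = euler_limit F x0 t (\<lambda>s. b s + z * h s)" for z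
  define c where "c = exp (- A * t) / 2 * h t"
  have c: "c > 0" using h(3) by (simp add: c_def)
  have G: "c * (z1 - z2) \<le> G z1 - G z2" if "z2 \<le> z1" for z1 z2
    using euler_limit_shift[of "\<lambda>s. b s + z1 * h s" "\<lambda>s. b s + z2 * h s" "z1 - z2" h] that h(1,2)
    by (simp add: G_def c_def algebra_simps)
  have G': "c * \<bar>z1 - z2\<bar> \<le> \<bar>G z1 - G z2\<bar>" for z1 z2
  proof (cases "z2 \<le> z1")
    case True
    then show ?thesis using G[OF True] by simp
  next
    case False
    then show ?thesis using G[of z1 z2] by (simp add: abs_minus_commute)
  qed
  have inj: "inj G"
  proof (rule injI)
    fix x y assume "G x = G y"
    then have "c * \<bar>x - y\<bar> \<le> 0" using G'[of x y] by simp
    then show "x = y" using c by (simp add: mult_le_0_iff)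
  qed
  define S where "S = {z. G z \<in> N}"
  have "N \<in> null_sets lebesgue" using N by (rule null_sets_completionI)
  then have "negligible N" by (simp add: negligible_iff_null_sets)
  then have nG: "negligible (G ` S)" by (rule negligible_subset) (auto simp: S_def)
  have "negligible (inv G ` (G ` S))"
  proof (rule negligible_locally_Lipschitz_image[OF _ nG])
    fix x assume "x \<in> G ` S"
    have "norm (inv G y - inv G x) \<le> 1 / c * norm (y - x)" if "y \<in> G ` S" for y
      using that \<open>x \<in> G ` S\<close> G' c by (auto simp: inv_f_f[OF inj] field_simps)
    then show "\<exists>T B. open T \<and> x \<in> T \<and> (\<forall>y\<in>G ` S \<inter> T. norm (inv G y - inv G x) \<le> B * norm (y - x))"
      by (intro exI[of _ UNIV] exI[of _ "1 / c"]) auto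
  qed simp
  also have "inv G ` (G ` S) = S" using inv_f_f[OF inj] by (auto simp: image_image)
  finally show ?thesis by (simp add: S_def G_def)
qed

text \<open>The classical error recursion: uniform continuity of the drift along the solution bounds
  the consistency error of a step by \<open>t / n * e\<close>, and the Lipschitz bound amplifies the
  accumulated error by at most \<open>exp (A * t)\<close>.\<close>

lemma euler_converges:
  assumes x: "solves F x0 t b x" and c: "continuous_on {0..t} (\<lambda>s. F s (x s))"
  shows "euler_limit F x0 t b = x t"
proof -
  define \<phi> where "\<phi> s = F s (x s)" for s
  define Y where "Y s = x s - b s" for s
  have uc: "uniformly_continuous_on {0..t} \<phi>" using c unfolding \<phi>_def by (intro compact_uniformly_continuous) auto
  have "(\<lambda>n. euler F x0 t n b n + b t) \<longlonglongrightarrow> x t"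
  proof (rule LIMSEQ_I)
    fix r :: real assume r: "r > 0"
    \<comment> \<open>Chosen so that the final bound \<open>t * e * exp (A * t)\<close> equals
      \<open>r / 2\<close>.\<close>
    define e where "e = r / (t * exp (A * t)) / 2"
    have e: "e > 0" using r t by (simp add: e_def)
    obtain d where d: "d > 0" "\<And>s u. s \<in> {0..t} \<Longrightarrow> u \<in> {0..t} \<Longrightarrow> dist u s < d \<Longrightarrow> dist (\<phi> u) (\<phi> s) < e"
      using uc e unfolding uniformly_continuous_on_def by metis
    obtain N where N: "t / d < real N" using reals_Archimedean2 by blast
    have "norm (euler F x0 t n b n + b t - x t) < r" if n: "n \<ge> N" for n
    proof -
      have "0 < t / d" using t d by simp
      then have n0: "n > 0" using N n by (metis gr0I less_asym of_nat_0 order_le_less_trans le_0_eq less_irrefl)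
      have "t / d < n" using N n by linarith
      then have dn: "t / n < d" using d n0 by (simp add: field_simps)
      have key: "\<bar>euler F x0 t n b k - Y (t * k / n)\<bar> \<le> k * (t / n * e) * (1 + A * (t / n)) ^ k" if "k \<le> n" for k
        using that
      proof (induction k)
        case 0
        have "x 0 = x0 + b 0" using x t unfolding solves_def by auto
        then show ?case by (simp add: Y_def)
      next
        case (Suc k)
        let ?s = "t * k / n" and ?r = "t * Suc k / n"
        have g: "?s \<in> {0..t}" "?r \<in> {0..t}" using grid[of k n] grid[of "Suc k" n] Suc.prems by auto
        have sr: "?s \<le> ?r" "?r - ?s = t / n" using t n0 by (auto simp: field_simps)
        note inc = solves_increment[OF x _ sr(1)]
        have Yinc: "Y ?r - Y ?s = integral {?s..?r} \<phi>" using inc(2) g unfolding Y_def \<phi>_def by simp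
        have "\<bar>integral {?s..?r} (\<lambda>u. \<phi> ?s - \<phi> u)\<bar> \<le> e * (?r - ?s)"
        proof -
          have "norm (integral {?s..?r} (\<lambda>u. \<phi> ?s - \<phi> u)) \<le> e * (?r - ?s)"
          proof (rule integral_bound[OF sr(1)])
            show "continuous_on {?s..?r} (\<lambda>u. \<phi> ?s - \<phi> u)"
              using c g unfolding \<phi>_def by (intro continuous_intros) (auto intro: continuous_on_subset)
            fix u assume u: "u \<in> {?s..?r}"
            then have "u \<in> {0..t}" "dist u ?s < d" using g sr dn by (auto simp: dist_real_def)
            from d(2)[OF g(1) this] show "norm (\<phi> ?s - \<phi> u) \<le> e" by (simp add: dist_real_def abs_minus_commute)
          qed
          then show ?thesis by simp
        qed
        moreover have "integral {?s..?r} (\<lambda>u. \<phi> ?s - \<phi> u) = t / n * \<phi> ?s - (Y ?r - Y ?s)"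
        proof -
          have "\<phi> integrable_on {?s..?r}" using inc(1) g unfolding \<phi>_def by auto
          then show ?thesis unfolding Yinc using sr by (subst Henstock_Kurzweil_Integration.integral_diff) auto
        qed
        ultimately have 1: "\<bar>t / n * \<phi> ?s - (Y ?r - Y ?s)\<bar> \<le> t / n * e" using sr by (simp add: mult.commute)
        let ?E = "euler F x0 t n b k"
        have xs: "Y ?s + b ?s = x ?s" by (simp add: Y_def)
        have "\<bar>F ?s (?E + b ?s) - F ?s (Y ?s + b ?s)\<bar> \<le> A * \<bar>?E - Y ?s\<bar>" using lip[OF g(1), of "?E + b ?s" "Y ?s + b ?s"] by simp
        then have "\<bar>F ?s (?E + b ?s) - \<phi> ?s\<bar> \<le> A * \<bar>?E - Y ?s\<bar>" unfolding xs \<phi>_def .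
        then have 2: "\<bar>t / n * (F ?s (?E + b ?s) - \<phi> ?s)\<bar> \<le> t / n * (A * \<bar>?E - Y ?s\<bar>)"
          using t unfolding abs_mult by (intro mult_mono) auto
        have split: "euler F x0 t n b (Suc k) - Y ?r = (?E - Y ?s) + t / n * (F ?s (?E + b ?s) - \<phi> ?s) + (t / n * \<phi> ?s - (Y ?r - Y ?s))"
          by (simp add: right_diff_distrib)
        have "\<bar>euler F x0 t n b (Suc k) - Y ?r\<bar> \<le> \<bar>?E - Y ?s\<bar> + t / n * (A * \<bar>?E - Y ?s\<bar>) + t / n * e"
        proof -
          have "\<bar>a + u + v\<bar> \<le> \<bar>a\<bar> + p + q" if "\<bar>u\<bar> \<le> p" "\<bar>v\<bar> \<le> q" for a u v p q :: real
            using that by linarith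
          from this[OF 2 1] show ?thesis unfolding split .
        qed
        also have "\<dots> = (1 + A * (t / n)) * \<bar>?E - Y ?s\<bar> + t / n * e" by (simp add: algebra_simps)
        also have "\<dots> \<le> (1 + A * (t / n)) * (k * (t / n * e) * (1 + A * (t / n)) ^ k) + t / n * e * (1 + A * (t / n)) ^ Suc k"
        proof (intro add_mono mult_left_mono)
          show "\<bar>?E - Y ?s\<bar> \<le> k * (t / n * e) * (1 + A * (t / n)) ^ k" using Suc by simp
          have "1 \<le> (1 + A * (t / n)) ^ Suc k" using A t by (intro one_le_power) auto
          then have "t / n * e * 1 \<le> t / n * e * (1 + A * (t / n)) ^ Suc k" using t e by (intro mult_left_mono) auto
          then show "t / n * e \<le> t / n * e * (1 + A * (t / n)) ^ Suc k" by simp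
        qed (use A t in auto)
        also have "\<dots> = Suc k * (t / n * e) * (1 + A * (t / n)) ^ Suc k"
        proof -
          have "q * (k * w * q ^ k) + w * q ^ Suc k = Suc k * w * q ^ Suc k" for q w :: real by (simp add: algebra_simps)
          then show ?thesis .
        qed
        finally show ?case .
      qed
      have "\<bar>euler F x0 t n b n - Y t\<bar> \<le> t * e * (1 + A * t / n) ^ n" using key[OF order_refl] n0 by simp
      also have "(1 + A * t / n) ^ n \<le> exp (A * t)"
      proof -
        have "(1 + A * t / n) ^ n \<le> exp (A * t / n) ^ n" using A t by (intro power_mono exp_ge_add_one_self) auto
        also have "\<dots> = exp (A * t)" using n0 by (simp flip: exp_of_nat_mult)
        finally show ?thesis .
      qed
      then have "t * e * (1 + A * t / n) ^ n \<le> t * e * exp (A * t)" using t e by (intro mult_left_mono) auto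
      also have "\<dots> = r / 2" using t by (simp add: e_def)
      finally have "\<bar>euler F x0 t n b n - Y t\<bar> \<le> r / 2" .
      then have "\<bar>euler F x0 t n b n - Y t\<bar> < r" using r by linarith
      then show ?thesis by (simp add: Y_def algebra_simps)
    qed
    then show "\<exists>N. \<forall>n\<ge>N. norm (euler F x0 t n b n + b t - x t) < r" by blast
  qed
  then have "limsup (\<lambda>n. ereal (euler F x0 t n b n + b t)) = ereal (x t)" by (intro lim_imp_Limsup) auto
  then show ?thesis by (simp add: euler_limit_def)
qed

end

section \<open>The solution of the equation\<close>


lemma drift_i_mono:
  assumes "drift_i f" "s > 0" "0 < x" "x \<le> y"
  shows "f s y \<le> f s x"
proof -
  obtain f' where f': "\<And>t x. t \<ge> 0 \<Longrightarrow> x > 0 \<Longrightarrow> ((\<lambda>y. f t y) has_real_derivative f' t x) (at x)"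
     "\<And>t x. t > 0 \<Longrightarrow> x > 0 \<Longrightarrow> f' t x \<le> 0"
    using assms(1) unfolding drift_i_def by blast
  show ?thesis
  proof (rule DERIV_nonpos_imp_nonincreasing[OF assms(4)])
    fix z assume "x \<le> z"
    then have "z > 0" using assms(3) by linarith
    then show "\<exists>d. ((\<lambda>y. f s y) has_real_derivative d) (at z) \<and> d \<le> 0" using f' assms(2) by (meson less_imp_le)
  qed
qed

lemma drift_iii_bound:
  assumes "drift_iii f" "t \<ge> 0"
  obtains K where "K \<ge> 0" "\<And>s x. s \<in> {0..t} \<Longrightarrow> x > 0 \<Longrightarrow> f s x \<le> K * (1 + 1 / x)"
proof -
  from assms(1) obtain h where h: "\<forall>t\<ge>0. h t \<ge> 0" "\<forall>T\<ge>0. bounded (h ` {0..T})" "\<forall>t\<ge>0. \<forall>x>0. f t x \<le> h t * (1 + 1 / x)"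
    unfolding drift_iii_def by (elim exE conjE)
  from h(2) assms(2) have "bounded (h ` {0..t})" by simp
  then obtain K where "\<forall>y\<in>h ` {0..t}. \<bar>y\<bar> \<le> K" unfolding bounded_real by (elim exE)
  then have K: "\<And>s. s \<in> {0..t} \<Longrightarrow> \<bar>h s\<bar> \<le> K" by simp
  have "f s x \<le> K * (1 + 1 / x)" if "s \<in> {0..t}" "x > 0" for s x
  proof -
    have "f s x \<le> h s * (1 + 1 / x)" using h(3) that by simp
    also have "\<dots> \<le> K * (1 + 1 / x)" using K[OF that(1)] that(2) by (intro mult_right_mono) auto
    finally show ?thesis .
  qed
  moreover have "K \<ge> 0" using K[of 0] assms(2) by simp
  ultimately show ?thesis using that by blast
qed

text \<open>Truncating the argument does not increase distances, and on the compact rectangle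
  \<open>{0..t} \<times> {lo..hi}\<close> both \<open>f\<close> and its derivative are bounded by
  continuity; these bounds are the constants.\<close>

lemma truncated_drift:
  assumes f: "drift_i f" and t: "t > 0" and lo: "0 < lo" "lo \<le> hi"
  shows "\<exists>A C. euler_drift (\<lambda>s x. f s (max lo (min hi x))) t A C"
proof -
  obtain f' where f': "\<And>t x. t \<ge> 0 \<Longrightarrow> x > 0 \<Longrightarrow> ((\<lambda>y. f t y) has_real_derivative f' t x) (at x)"
     "continuous_on ({0..} \<times> {0<..}) (\<lambda>(t, x). f' t x)" and cf: "continuous_on ({0..} \<times> {0<..}) (\<lambda>(t, x). f t x)"
    using f unfolding drift_i_def by blast
  have K: "compact ({0..t} \<times> {lo..hi})" by (intro compact_Times) auto
  have sub: "{0..t} \<times> {lo..hi} \<subseteq> {0..} \<times> {0<..}" using lo by auto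
  have "bounded ((\<lambda>(t, x). f' t x) ` ({0..t} \<times> {lo..hi}))" "bounded ((\<lambda>(t, x). f t x) ` ({0..t} \<times> {lo..hi}))"
    using K sub f'(2) cf by (auto intro!: compact_imp_bounded compact_continuous_image elim: continuous_on_subset)
  then obtain A C where "\<forall>y\<in>(\<lambda>(t, x). f' t x) ` ({0..t} \<times> {lo..hi}). \<bar>y\<bar> \<le> A" "\<forall>y\<in>(\<lambda>(t, x). f t x) ` ({0..t} \<times> {lo..hi}). \<bar>y\<bar> \<le> C"
    unfolding bounded_real by (elim exE)
  then have A: "\<And>s x. s \<in> {0..t} \<Longrightarrow> x \<in> {lo..hi} \<Longrightarrow> \<bar>f' s x\<bar> \<le> A" and C: "\<And>s x. s \<in> {0..t} \<Longrightarrow> x \<in> {lo..hi} \<Longrightarrow> \<bar>f s x\<bar> \<le> C"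
    by force+
  have A0: "A \<ge> 0" using A[of 0 lo] lo t by auto
  have cl: "max lo (min hi x) \<in> {lo..hi}" for x using lo by auto
  have "\<bar>f s (max lo (min hi x)) - f s (max lo (min hi y))\<bar> \<le> A * \<bar>x - y\<bar>" if s: "s \<in> {0..t}" for s x y
  proof -
    have "norm (f s (max lo (min hi x)) - f s (max lo (min hi y))) \<le> A * norm (max lo (min hi x) - max lo (min hi y))"
    proof (rule field_differentiable_bound[where S="{lo..hi}" and f'="f' s"])
      fix z assume z: "z \<in> {lo..hi}"
      show "((f s) has_field_derivative f' s z) (at z within {lo..hi})"
        by (rule has_field_derivative_at_within, rule f'(1)) (use s z lo in auto)
      show "norm (f' s z) \<le> A" using A[OF s z] by simp
    qed (use cl in auto)
    also have "\<dots> \<le> A * \<bar>x - y\<bar>"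
    proof (rule mult_left_mono[OF _ A0])
      show "norm (max lo (min hi x) - max lo (min hi y)) \<le> \<bar>x - y\<bar>" unfolding real_norm_def by linarith
    qed
    finally show ?thesis by simp
  qed
  then have "euler_drift (\<lambda>s x. f s (max lo (min hi x))) t A C"
    using t A0 C[OF _ cl] by unfold_locales
  then show ?thesis by blast
qed

lemma solves_truncated:
  assumes x: "solves f x0 t b x" and f: "drift_i f" and lo: "\<And>s. s \<in> {0..t} \<Longrightarrow> lo \<le> x s \<and> x s \<le> hi"
  defines "F \<equiv> \<lambda>s x. f s (max lo (min hi x))"
  shows "solves F x0 t b x" "continuous_on {0..t} (\<lambda>s. F s (x s))"
proof -
  have eq: "F s (x s) = f s (x s)" if "s \<in> {0..t}" for s using lo[OF that] by (simp add: F_def)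
  have pos: "x s > 0" if "s \<in> {0..t}" for s using x that unfolding solves_def by blast
  show "solves F x0 t b x"
    unfolding solves_def
  proof (intro conjI ballI)
    fix s assume s: "s \<in> {0..t}"
    have e: "f r (x r) = F r (x r)" if "r \<in> {0..s}" for r using eq[of r] that s by simp
    have i: "(\<lambda>r. f r (x r)) integrable_on {0..s}" and v: "x s = x0 + integral {0..s} (\<lambda>r. f r (x r)) + b s"
      using x s unfolding solves_def by blast+
    show "(\<lambda>r. F r (x r)) integrable_on {0..s}" by (rule integrable_eq[OF i e])
    have "integral {0..s} (\<lambda>r. f r (x r)) = integral {0..s} (\<lambda>r. F r (x r))"
      by (rule Henstock_Kurzweil_Integration.integral_cong[OF e])
    then show "x s = x0 + integral {0..s} (\<lambda>r. F r (x r)) + b s" using v by simp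
  qed (use x pos in \<open>auto simp: solves_def\<close>)
  have "continuous_on {0..t} (\<lambda>s. (\<lambda>(t, x). f t x) (s, x s))"
  proof (rule continuous_on_compose2[where t="{0..} \<times> {0<..}"])
    show "continuous_on ({0..} \<times> {0<..}) (\<lambda>(t, x). f t x)" using f unfolding drift_i_def by blast
    show "continuous_on {0..t} (\<lambda>s. (s, x s))" by (intro continuous_intros solves_continuous[OF x])
  qed (use pos in auto)
  then show "continuous_on {0..t} (\<lambda>s. F s (x s))"
    by (rule continuous_on_eq) (use eq in auto)
qed

section \<open>Transfer from paths to the law of the solution\<close>

context fbm
begin

text \<open>Fubini for the resampled path: the exceptional set is null in the new variable for each
  fixed \<open>\<omega>\<close>, hence null in the product, and the equality of laws carries this
  back to \<open>B\<close>. Lebesgue null sets are null for the normal law because it has a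
  density.\<close>

lemma AE_resample:
  assumes t: "t > 0" "{0..t} \<subseteq> I" and S: "S \<in> sets (PiM {0..t} (\<lambda>_. borel))"
    and AE: "\<And>\<omega>. \<omega> \<in> space M \<Longrightarrow>
      AE z in lborel. (\<lambda>s\<in>{0..t}. B s \<omega> + (z - B t \<omega> / t powr H) * (fbm_cov H s t / t powr H)) \<notin> S"
  shows "AE \<omega> in M. (\<lambda>s\<in>{0..t}. B s \<omega>) \<notin> S"
proof -
  let ?N = std_normal_distribution
  let ?P = "PiM {0..t} (\<lambda>_. borel) :: (real \<Rightarrow> real) measure"
  define g where "g p = (\<lambda>s\<in>{0..t}. B s (fst p) + (snd p - B t (fst p) / t powr H) * (fbm_cov H s t / t powr H))" for p
  interpret N: real_distribution ?N by (rule real_dist_normal_dist)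
  interpret P: pair_prob_space M ?N ..
  have mB: "B s \<in> borel_measurable M" if "s \<in> {0..t}" for s using fbm_measurable t(2) that by blast
  have mb: "(\<lambda>\<omega>. \<lambda>s\<in>{0..t}. B s \<omega>) \<in> measurable M ?P" using mB by (rule measurable_restrict)
  have mg: "g \<in> measurable (M \<Otimes>\<^sub>M ?N) ?P"
    unfolding g_def
  proof (rule measurable_restrict)
    fix s assume s: "s \<in> {0..t}"
    have [measurable]: "B s \<in> borel_measurable M" "B t \<in> borel_measurable M" using mB s t by auto
    have [measurable]: "snd \<in> borel_measurable (M \<Otimes>\<^sub>M ?N)" 
      using measurable_snd[of M ?N] by (simp cong: measurable_cong_sets)
    show "(\<lambda>p. B s (fst p) + (snd p - B t (fst p) / t powr H) * (fbm_cov H s t / t powr H)) \<in> borel_measurable (M \<Otimes>\<^sub>M ?N)"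
      by measurable
  qed
  have S': "{x \<in> space ?P. x \<notin> S} \<in> sets ?P" using S by auto
  have "AE p in M \<Otimes>\<^sub>M ?N. g p \<notin> S"
  proof (rule P.AE_pair_measure)
    have "{p \<in> space (M \<Otimes>\<^sub>M ?N). g p \<notin> S} = g -` {x \<in> space ?P. x \<notin> S} \<inter> space (M \<Otimes>\<^sub>M ?N)"
      using measurable_space[OF mg] by auto
    then show "{p \<in> space (M \<Otimes>\<^sub>M ?N). g p \<notin> S} \<in> sets (M \<Otimes>\<^sub>M ?N)" using measurable_sets[OF mg S'] by simp
    show "AE \<omega> in M. AE z in ?N. g (\<omega>, z) \<notin> S"
    proof (rule AE_I2)
      fix \<omega> assume "\<omega> \<in> space M"
      from AE[OF this] show "AE z in ?N. g (\<omega>, z) \<notin> S"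
        unfolding g_def fst_conv snd_conv by (subst AE_density) (auto elim!: eventually_mono)
    qed
  qed
  then have "AE x in distr (M \<Otimes>\<^sub>M ?N) ?P g. x \<notin> S" by (subst AE_distr_iff[OF mg S'])
  also have "distr (M \<Otimes>\<^sub>M ?N) ?P g = distr M ?P (\<lambda>\<omega>. \<lambda>s\<in>{0..t}. B s \<omega>)"
    unfolding g_def by (rule fbm_resample[OF t, symmetric])
  finally show ?thesis by (subst (asm) AE_distr_iff[OF mb S'])
qed

text \<open>Up to time \<open>t\<close> the first power grows while the power of the distance to
  \<open>t\<close> decreases. This is what makes the shift direction increasing.\<close>

lemma fbm_cov_mono:
  assumes "H > 0" "0 \<le> s" "s \<le> r" "r \<le> t"
  shows "fbm_cov H s t \<le> fbm_cov H r t"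
proof -
  have "s powr (2 * H) \<le> r powr (2 * H)" "\<bar>r - t\<bar> powr (2 * H) \<le> \<bar>s - t\<bar> powr (2 * H)"
    using assms by (auto intro!: powr_mono2)
  then show ?thesis by (simp add: fbm_cov_def)
qed

lemma AE_euler_limit_not_null:
  assumes H: "H > 0" and t: "t > 0" "{0..t} \<subseteq> I" and F: "euler_drift F t A C" and N: "N \<in> null_sets lborel"
  shows "AE \<omega> in M. euler_limit F x0 t (\<lambda>s. B s \<omega>) \<notin> N"
proof -
  interpret euler_drift F x0 t A C by fact
  note t = assms(2,3)
  let ?P = "PiM {0..t} (\<lambda>_. borel) :: (real \<Rightarrow> real) measure"
  define h where "h s = fbm_cov H s t / t powr H" for s
  define S where "S = euler_limit F x0 t -` N \<inter> space ?P"
  have S: "S \<in> sets ?P" unfolding S_def using N by (intro measurable_sets[OF euler_limit_measurable]) auto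
  have "AE \<omega> in M. (\<lambda>s\<in>{0..t}. B s \<omega>) \<notin> S"
  proof (rule AE_resample[OF t S])
    fix \<omega>
    \<comment> \<open>The residual path, uncorrelated with \<open>B t\<close>: for fixed
      \<open>\<omega>\<close> the resampled path is \<open>b\<close> plus \<open>z\<close> times
      \<open>h\<close>.\<close>
    define b where "b s = B s \<omega> - B t \<omega> / t powr H * h s" for s
    have "negligible {z. euler_limit F x0 t (\<lambda>s. b s + z * h s) \<in> N}"
    proof (rule euler_limit_null[OF _ _ _ N])
      show "h s \<le> h r" if "0 \<le> s" "s \<le> r" "r \<le> t" for s r
        unfolding h_def using fbm_cov_mono[OF H that] by (simp add: divide_right_mono)
      show "h 0 \<ge> 0" using t by (simp add: h_def fbm_cov_def)
      show "h t > 0" using t by (simp add: h_def fbm_cov_self)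
    qed
    then have "AE z in lebesgue. z \<notin> {z. euler_limit F x0 t (\<lambda>s. b s + z * h s) \<in> N}"
      unfolding negligible_iff_null_sets by (rule AE_not_in)
    then have "AE z in lborel. z \<notin> {z. euler_limit F x0 t (\<lambda>s. b s + z * h s) \<in> N}"
      by (simp add: AE_completion_iff)
    then show "AE z in lborel. (\<lambda>s\<in>{0..t}. B s \<omega> + (z - B t \<omega> / t powr H) * (fbm_cov H s t / t powr H)) \<notin> S"
    proof (rule eventually_mono)
      fix z assume "z \<notin> {z. euler_limit F x0 t (\<lambda>s. b s + z * h s) \<in> N}"
      moreover have "euler_limit F x0 t (\<lambda>s\<in>{0..t}. B s \<omega> + (z - B t \<omega> / t powr H) * (fbm_cov H s t / t powr H)) = euler_limit F x0 t (\<lambda>s. b s + z * h s)"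
        by (rule euler_limit_cong) (simp add: b_def h_def algebra_simps diff_divide_distrib)
      ultimately show "(\<lambda>s\<in>{0..t}. B s \<omega> + (z - B t \<omega> / t powr H) * (fbm_cov H s t / t powr H)) \<notin> S"
        by (simp add: S_def)
    qed
  qed
  moreover have "(\<lambda>s\<in>{0..t}. B s \<omega>) \<in> S \<longleftrightarrow> euler_limit F x0 t (\<lambda>s. B s \<omega>) \<in> N" for \<omega>
    using euler_limit_cong[of "\<lambda>s\<in>{0..t}. B s \<omega>" "\<lambda>s. B s \<omega>"] by (simp add: S_def space_PiM)
  ultimately show ?thesis by simp
qed

lemma fbm_running_sup:
  assumes H: "1 / 2 < H" and t: "0 \<le> t" "{0..t} \<subseteq> I"
  shows "\<exists>W. integrable M W \<and> (AE \<omega> in M. \<forall>s\<in>{0..t}. (B s \<omega>)\<^sup>2 \<le> W \<omega>)"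
proof (rule square_integrable_running_sup[OF H t(1)])
  have sI: "s \<in> I" if "s \<in> {0..t}" for s using t(2) that by blast
  show "B s \<in> borel_measurable M" if "s \<in> {0..t}" for s using fbm_measurable sI that by blast
  show "integrable M (\<lambda>\<omega>. (B s \<omega> - B r \<omega>)\<^sup>2)" "(\<integral>\<omega>. (B s \<omega> - B r \<omega>)\<^sup>2 \<partial>M) = \<bar>s - r\<bar> powr (2 * H)"
    if sr: "s \<in> {0..t}" "r \<in> {0..t}" for s r
  proof -
    have i: "integrable M (\<lambda>\<omega>. B u \<omega> * B v \<omega>)" if "u \<in> {0..t}" "v \<in> {0..t}" for u v
      using that sI by (intro square_integrable_mult fbm_square_integrable)
    have e: "(B s \<omega> - B r \<omega>)\<^sup>2 = B s \<omega> * B s \<omega> - 2 * (B s \<omega> * B r \<omega>) + B r \<omega> * B r \<omega>" for \<omega>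
      by (simp add: power2_eq_square algebra_simps)
    show "integrable M (\<lambda>\<omega>. (B s \<omega> - B r \<omega>)\<^sup>2)" unfolding e using i sr by auto
    have "(\<integral>\<omega>. (B s \<omega> - B r \<omega>)\<^sup>2 \<partial>M) = fbm_cov H s s - 2 * fbm_cov H s r + fbm_cov H r r"
      unfolding e using i sr sI by (simp add: fbm_covariance)
    also have "\<dots> = \<bar>s - r\<bar> powr (2 * H)" by (simp add: fbm_cov_def field_simps)
    finally show "(\<integral>\<omega>. (B s \<omega> - B r \<omega>)\<^sup>2 \<partial>M) = \<bar>s - r\<bar> powr (2 * H)" .
  qed
  have "0 \<in> I" using sI t(1) by simp
  then have "(\<integral>\<omega>. (B 0 \<omega>)\<^sup>2 \<partial>M) = 0" "integrable M (\<lambda>\<omega>. (B 0 \<omega>)\<^sup>2)"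
    using fbm_covariance[of 0 0] fbm_square_integrable[of 0] by (auto simp: power2_eq_square fbm_cov_def square_integrable_def)
  then have "AE \<omega> in M. (B 0 \<omega>)\<^sup>2 = 0" by (subst (asm) integral_nonneg_eq_0_iff_AE) auto
  then show "AE \<omega> in M. B 0 \<omega> = 0" by simp
  show "continuous_on {0..t} (\<lambda>s. B s \<omega>)" if "\<omega> \<in> space M" for \<omega>
    using fbm_continuous[OF that] t(2) by (rule continuous_on_subset)
qed

text \<open>The passage from the Lebesgue integral of \<open>positive_solution\<close> to the gauge
  integral of the deterministic part.\<close>

lemma AE_solves:
  assumes X: "positive_solution M I B f x0 X" and t: "{0..t} \<subseteq> I"
  shows "AE \<omega> in M. solves f x0 t (\<lambda>s. B s \<omega>) (\<lambda>s. X s \<omega>)"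
proof -
  have "AE \<omega> in M. \<forall>t\<in>I. X t \<omega> > 0 \<and> set_integrable lborel {0..t} (\<lambda>s. f s (X s \<omega>)) \<and>
        X t \<omega> = x0 + (LINT s:{0..t}|lborel. f s (X s \<omega>)) + B t \<omega>"
    using X by (simp add: positive_solution_def)
  then show ?thesis
    using AE_space
  proof eventually_elim
    case (elim \<omega>)
    have "continuous_on {0..t} (\<lambda>s. B s \<omega>)" using fbm_continuous[OF elim(2)] t by (rule continuous_on_subset)
    moreover have "X s \<omega> > 0 \<and> (\<lambda>r. f r (X r \<omega>)) integrable_on {0..s} \<and> X s \<omega> = x0 + integral {0..s} (\<lambda>r. f r (X r \<omega>)) + B s \<omega>"
      if "s \<in> {0..t}" for s
    proof -
      have s: "X s \<omega> > 0" "set_integrable lborel {0..s} (\<lambda>s. f s (X s \<omega>))" "X s \<omega> = x0 + (LINT s:{0..s}|lborel. f s (X s \<omega>)) + B s \<omega>"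
        using elim(1) t that by blast+
      show ?thesis using s(1) set_borel_integral_eq_integral[OF s(2)] s(3) by simp
    qed
    ultimately show ?case unfolding solves_def by blast
  qed
qed

text \<open>A continuous positive path on a compact interval stays between some \<open>lo j\<close>
  and \<open>hi j\<close>, where \<open>j\<close> depends on \<open>\<omega>\<close>. Countably many
  truncation levels suffice, each with its own null event.\<close>

lemma absolutely_continuous_solution:
  assumes H: "H > 0" and t: "t > 0" "{0..t} \<subseteq> I" and f: "drift_i f" and X: "positive_solution M I B f x0 X"
  shows "absolutely_continuous lborel (distr M borel (X t))"
proof -
  have tI: "t \<in> I" using t by auto
  have mX: "X t \<in> borel_measurable M" using X tI by (simp add: positive_solution_def)
  have "N \<in> null_sets (distr M borel (X t))" if N: "N \<in> null_sets lborel" for N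
  proof -
    define lo where "lo j = 1 / real (Suc j)" for j
    define hi where "hi j = real (Suc j)" for j
    define F where "F j s x = f s (max (lo j) (min (hi j) x))" for j s x
    have lohi: "0 < lo j" "lo j \<le> hi j" for j by (auto simp: lo_def hi_def field_simps)
    have "AE \<omega> in M. euler_limit (F j) x0 t (\<lambda>s. B s \<omega>) \<notin> N" for j
    proof -
      obtain A C where "euler_drift (F j) t A C" unfolding F_def[abs_def] using truncated_drift[OF f t(1) lohi] by blast
      then show ?thesis by (rule AE_euler_limit_not_null[OF H t _ N])
    qed
    then have "AE \<omega> in M. \<forall>j. euler_limit (F j) x0 t (\<lambda>s. B s \<omega>) \<notin> N" by (simp add: AE_all_countable)
    then have "AE \<omega> in M. X t \<omega> \<notin> N"
      using AE_solves[OF X t(2)]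
    proof eventually_elim
      case (elim \<omega>)
      let ?x = "\<lambda>s. X s \<omega>"
      have cx: "continuous_on {0..t} ?x" by (rule solves_continuous[OF elim(2)])
      obtain s0 where s0: "s0 \<in> {0..t}" "\<And>s. s \<in> {0..t} \<Longrightarrow> ?x s0 \<le> ?x s"
        using continuous_attains_inf[OF _ _ cx] t(1) by auto
      obtain s1 where s1: "s1 \<in> {0..t}" "\<And>s. s \<in> {0..t} \<Longrightarrow> ?x s \<le> ?x s1"
        using continuous_attains_sup[OF _ _ cx] t(1) by auto
      have pos: "?x s0 > 0" using elim(2) s0(1) unfolding solves_def by blast
      obtain j1 where j1: "inverse (real (Suc j1)) < ?x s0" using reals_Archimedean[OF pos] by blast
      obtain j2 :: nat where j2: "?x s1 < real j2" using reals_Archimedean2 by blast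
      define j where "j = max j1 j2"
      have "lo j \<le> inverse (real (Suc j1))" "real j2 \<le> hi j" by (auto simp: j_def lo_def hi_def field_simps)
      then have "lo j \<le> ?x s \<and> ?x s \<le> hi j" if "s \<in> {0..t}" for s
        using s0(2)[OF that] s1(2)[OF that] j1 j2 by linarith
      note tr = solves_truncated[OF elim(2) f this]
      obtain A C where "euler_drift (F j) t A C" unfolding F_def[abs_def] using truncated_drift[OF f t(1) lohi] by blast
      then interpret euler_drift "F j" x0 t A C .
      have "euler_limit (F j) x0 t (\<lambda>s. B s \<omega>) = X t \<omega>"
        by (rule euler_converges) (use tr in \<open>simp_all add: F_def[abs_def]\<close>)
      then show ?case using elim(1) by metis
    qed
    then have "AE x in distr M borel (X t). x \<notin> N" using N by (subst AE_distr_iff[OF mX]) auto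
    moreover have "N \<in> sets (distr M borel (X t))" using N by auto
    ultimately show ?thesis using AE_iff_null_sets by blast
  qed
  then show ?thesis unfolding absolutely_continuous_def by blast
qed

section \<open>Approximation of the solution in L^2 by smooth functionals\<close>

lemma Malliavin_differentiable_solution:
  assumes H: "1 / 2 < H" and t: "0 \<le> t" "t \<le> T" "{0..T} \<subseteq> I" and x0: "x0 > 0"
    and f: "drift_i f" "drift_iii f" and X: "positive_solution M I B f x0 X"
  shows "X t \<in> D_1_2 M H T B"
proof -
  have sub: "{0..t} \<subseteq> I" using t by auto
  have tI: "t \<in> I" using t by auto
  have mX [measurable]: "X t \<in> borel_measurable M" using X tI by (simp add: positive_solution_def)
  have mono: "\<And>s x y. s > 0 \<Longrightarrow> 0 < x \<Longrightarrow> x \<le> y \<Longrightarrow> f s y \<le> f s x" by (rule drift_i_mono[OF f(1)])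
  have sol: "AE \<omega> in M. solves f x0 t (\<lambda>s. B s \<omega>) (\<lambda>s. X s \<omega>)" by (rule AE_solves[OF X sub])
  \<comment> \<open>The infimum in \<open>mcshane\<close> needs a competitor; an event of full
    probability is nonempty and supplies one.\<close>
  have ex: "\<exists>b x. solves f x0 t b x"
  proof (rule ccontr)
    assume "\<nexists>b x. solves f x0 t b x"
    then have "AE \<omega> in M. False" using sol by simp
    then show False by (simp add: AE_False)
  qed
  obtain \<tau> \<phi> where \<tau>: "\<And>i. \<tau> i \<in> {0..t}"
    and \<phi>: "\<And>n. n \<ge> 1 \<Longrightarrow> sup_lipschitz n 2 (\<phi> n)" "\<And>n y. n \<ge> 1 \<Longrightarrow> \<phi> n y \<ge> 0"
      "\<And>b x. solves f x0 t b x \<Longrightarrow> (\<lambda>n. \<phi> n (\<lambda>i. b (\<tau> i))) \<longlonglongrightarrow> x t"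
      "\<And>b x c n. solves f x0 t b x \<Longrightarrow> n \<ge> 1 \<Longrightarrow> (\<And>s. s \<in> {0..t} \<Longrightarrow> \<bar>b s\<bar> \<le> c) \<Longrightarrow> \<bar>\<phi> n (\<lambda>i. b (\<tau> i)) - x t\<bar> \<le> 4 * c"
  proof (rule lipschitz_functionals[OF t(1) _ ex], goal_cases)
    case (1 s x y)
    then show ?case using mono by blast
  next
    case (2 \<tau> \<phi>)
    show ?case by (rule that[of \<tau> \<phi>]) (fact 2)+
  qed
  obtain W where W: "integrable M W" "AE \<omega> in M. \<forall>s\<in>{0..t}. (B s \<omega>)\<^sup>2 \<le> W \<omega>" using fbm_running_sup[OF H t(1) sub] by blast
  obtain K where K: "K \<ge> 0" "\<And>s x. s \<in> {0..t} \<Longrightarrow> x > 0 \<Longrightarrow> f s x \<le> K * (1 + 1 / x)" using drift_iii_bound[OF f(2) t(1)] by metis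
  define D where "D = x0 + K * (1 + 1 / x0) * t"
  have D0: "D \<ge> 0" using x0 K(1) t(1) by (simp add: D_def)
  \<comment> \<open>Truncation at height \<open>n\<close> makes the functional bounded, as
    \<open>Cb_smooth\<close> demands, without raising the Lipschitz constant; along a path with a
    solution it is inactive for large \<open>n\<close>. The shift to \<open>Suc n\<close> avoids the
    excluded index 0.\<close>
  define \<Phi> where "\<Phi> n y = min (real n) (\<phi> (Suc n) y)" for n y
  have \<Phi>L: "sup_lipschitz (Suc n) 2 (\<Phi> n)" for n
    unfolding sup_lipschitz_def
  proof (intro allI impI)
    fix y z :: "nat \<Rightarrow> real" and e assume e: "\<forall>i<Suc n. \<bar>y i - z i\<bar> \<le> e"
    have "\<bar>\<phi> (Suc n) y - \<phi> (Suc n) z\<bar> \<le> 2 * e" using \<phi>(1)[of "Suc n"] e unfolding sup_lipschitz_def by auto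
    then show "\<bar>\<Phi> n y - \<Phi> n z\<bar> \<le> 2 * e" unfolding \<Phi>_def by linarith
  qed
  have "\<bar>\<Phi> n y\<bar> \<le> real n" for n y using \<phi>(2)[of "Suc n" y] by (simp add: \<Phi>_def)
  then have "\<exists>\<psi>. Cb_smooth (Suc n) \<psi> \<and> (\<forall>x. (\<Sum>i<Suc n. \<bar>partial i \<psi> x\<bar>) \<le> 2) \<and> (\<forall>x. \<bar>\<psi> x - \<Phi> n x\<bar> \<le> 1 / real (Suc n))" for n
    by (intro smooth_approx[OF \<Phi>L]) auto
  then obtain \<psi> where \<psi>: "\<And>n. Cb_smooth (Suc n) (\<psi> n)" "\<And>n x. (\<Sum>i<Suc n. \<bar>partial i (\<psi> n) x\<bar>) \<le> 2"
     "\<And>n x. \<bar>\<psi> n x - \<Phi> n x\<bar> \<le> 1 / real (Suc n)" by metis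
  define bt where "bt \<omega> = (\<lambda>i. B (\<tau> i) \<omega>)" for \<omega>
  have btm [measurable]: "bt \<in> borel_measurable M"
    unfolding bt_def using fbm_measurable \<tau> sub by (intro measurable_coordinatewise_then_product) blast
  have m\<psi> [measurable]: "\<psi> n \<in> borel_measurable borel" for n
    using Cb_smooth_partial(1)[OF \<psi>(1)] by (auto simp: bcont_def intro: borel_measurable_continuous_onI)
  \<comment> \<open>Since \<open>sqrt (W \<omega>)\<close> bounds the path up to time
    \<open>t\<close>, the growth bound and the domination of the functionals are both linear in
    it.\<close>
  have good: "AE \<omega> in M. 0 < X t \<omega> \<and> X t \<omega> \<le> D + 2 * sqrt (W \<omega>) \<and> 0 \<le> W \<omega> \<and> (\<forall>n. \<bar>\<phi> (Suc n) (bt \<omega>) - X t \<omega>\<bar> \<le> 4 * sqrt (W \<omega>)) \<and> (\<lambda>n. \<phi> n (bt \<omega>)) \<longlonglongrightarrow> X t \<omega>"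
    using sol W(2)
  proof eventually_elim
    case (elim \<omega>)
    have c: "\<bar>B s \<omega>\<bar> \<le> sqrt (W \<omega>)" if "s \<in> {0..t}" for s using elim(2) that by (simp add: real_le_rsqrt)
    have "(B 0 \<omega>)\<^sup>2 \<le> W \<omega>" using elim(2) t(1) by simp
    then have "0 \<le> W \<omega>" by (rule order_trans[OF zero_le_power2])
    moreover have "0 < X t \<omega>" using elim(1) t(1) unfolding solves_def by (metis atLeastAtMost_iff order_refl)
    moreover have "X t \<omega> \<le> D + 2 * sqrt (W \<omega>)"
      unfolding D_def by (rule solves_bound[OF elim(1) t(1) x0 K(2,1) c])
    moreover have "\<bar>\<phi> (Suc n) (bt \<omega>) - X t \<omega>\<bar> \<le> 4 * sqrt (W \<omega>)" for n
      unfolding bt_def by (rule \<phi>(4)[OF elim(1) _ c]) auto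
    moreover have "(\<lambda>n. \<phi> n (bt \<omega>)) \<longlonglongrightarrow> X t \<omega>" unfolding bt_def by (rule \<phi>(3)[OF elim(1)])
    ultimately show ?case by blast
  qed
  have sq2: "(a + b * sqrt w)\<^sup>2 \<le> 2 * a\<^sup>2 + 2 * b\<^sup>2 * w" if "w \<ge> 0" for a b w :: real
  proof -
    have "(a + b * sqrt w)\<^sup>2 + (a - b * sqrt w)\<^sup>2 = 2 * a\<^sup>2 + 2 * b\<^sup>2 * (sqrt w)\<^sup>2"
      by (simp add: power2_eq_square algebra_simps)
    also have "\<dots> = 2 * a\<^sup>2 + 2 * b\<^sup>2 * w" using that by simp
    finally show ?thesis using zero_le_power2[of "a - b * sqrt w"] by linarith
  qed
  have "integrable M (\<lambda>\<omega>. (X t \<omega>)\<^sup>2)"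
  proof (rule Bochner_Integration.integrable_bound[where f="\<lambda>\<omega>. 2 * D\<^sup>2 + 2 * 2\<^sup>2 * W \<omega>"])
    show "AE \<omega> in M. norm ((X t \<omega>)\<^sup>2) \<le> norm (2 * D\<^sup>2 + 2 * 2\<^sup>2 * W \<omega>)"
      using good
    proof eventually_elim
      case (elim \<omega>)
      have "(X t \<omega>)\<^sup>2 \<le> (D + 2 * sqrt (W \<omega>))\<^sup>2" using elim by (intro power_mono) auto
      also have "\<dots> \<le> 2 * D\<^sup>2 + 2 * 2\<^sup>2 * W \<omega>" by (rule sq2) (use elim in auto)
      finally show ?case by simp
    qed
  qed (use W(1) in auto)
  then have sqX: "square_integrable M (X t)" by (simp add: square_integrable_def)
  have lim: "(\<lambda>n. \<integral>\<omega>. (\<psi> n (bt \<omega>) - X t \<omega>)\<^sup>2 \<partial>M) \<longlonglongrightarrow> (\<integral>\<omega>. 0 \<partial>M)"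
  \<comment> \<open>The distance is at most 1 for the mollification,
    \<open>4 * sqrt (W \<omega>)\<close> for the functional and
    \<open>D + 2 * sqrt (W \<omega>)\<close> for the truncation, in total
    \<open>(1 + D) + 6 * sqrt (W \<omega>)\<close>.\<close>
  proof (rule integral_dominated_convergence[where w="\<lambda>\<omega>. 2 * (1 + D)\<^sup>2 + 2 * 6\<^sup>2 * W \<omega>"])
    show "integrable M (\<lambda>\<omega>. 2 * (1 + D)\<^sup>2 + 2 * 6\<^sup>2 * W \<omega>)" using W(1) by auto
    show "AE \<omega> in M. norm ((\<psi> n (bt \<omega>) - X t \<omega>)\<^sup>2) \<le> 2 * (1 + D)\<^sup>2 + 2 * 6\<^sup>2 * W \<omega>" for n
      using good
    proof eventually_elim
      case (elim \<omega>)
      have "\<bar>\<psi> n (bt \<omega>) - \<Phi> n (bt \<omega>)\<bar> \<le> 1" using \<psi>(3)[of n "bt \<omega>"] by (rule order_trans) simp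
      moreover have "\<bar>\<Phi> n (bt \<omega>) - min (real n) (X t \<omega>)\<bar> \<le> 4 * sqrt (W \<omega>)"
        using elim[THEN conjunct2, THEN conjunct2, THEN conjunct2, THEN conjunct1, THEN spec, of n] unfolding \<Phi>_def by linarith
      moreover have "\<bar>min (real n) (X t \<omega>) - X t \<omega>\<bar> \<le> D + 2 * sqrt (W \<omega>)" using elim by auto
      ultimately have "\<bar>\<psi> n (bt \<omega>) - X t \<omega>\<bar> \<le> (1 + D) + 6 * sqrt (W \<omega>)" by linarith
      then have "\<bar>\<psi> n (bt \<omega>) - X t \<omega>\<bar>\<^sup>2 \<le> ((1 + D) + 6 * sqrt (W \<omega>))\<^sup>2" by (intro power_mono) auto
      also have "\<dots> \<le> 2 * (1 + D)\<^sup>2 + 2 * 6\<^sup>2 * W \<omega>" by (rule sq2) (use elim in auto)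
      finally show ?case by simp
    qed
    show "AE \<omega> in M. (\<lambda>n. (\<psi> n (bt \<omega>) - X t \<omega>)\<^sup>2) \<longlonglongrightarrow> 0"
      using good
    proof eventually_elim
      case (elim \<omega>)
      have "(\<lambda>n. \<phi> (Suc n) (bt \<omega>)) \<longlonglongrightarrow> X t \<omega>" using elim LIMSEQ_Suc by blast
      moreover obtain N :: nat where N: "X t \<omega> < real N" using reals_Archimedean2 by blast
      ultimately have "\<forall>\<^sub>F n in sequentially. \<phi> (Suc n) (bt \<omega>) < real N" by (intro order_tendstoD)
      then have "\<forall>\<^sub>F n in sequentially. \<phi> (Suc n) (bt \<omega>) = \<Phi> n (bt \<omega>)"
        using eventually_ge_at_top[of N] by eventually_elim (simp add: \<Phi>_def)
      then have "(\<lambda>n. \<Phi> n (bt \<omega>)) \<longlonglongrightarrow> X t \<omega>"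
        by (rule Lim_transform_eventually[OF \<open>(\<lambda>n. \<phi> (Suc n) (bt \<omega>)) \<longlonglongrightarrow> X t \<omega>\<close>])
      moreover have "(\<lambda>n. \<psi> n (bt \<omega>) - \<Phi> n (bt \<omega>)) \<longlonglongrightarrow> 0"
        by (rule Lim_null_comparison[OF _ lim_1_over_n[THEN LIMSEQ_Suc]]) (use \<psi>(3) in auto)
      ultimately have "(\<lambda>n. (\<psi> n (bt \<omega>) - \<Phi> n (bt \<omega>)) + \<Phi> n (bt \<omega>) - X t \<omega>) \<longlonglongrightarrow> 0 + X t \<omega> - X t \<omega>"
        by (intro tendsto_intros)
      then have "(\<lambda>n. \<psi> n (bt \<omega>) - X t \<omega>) \<longlonglongrightarrow> 0" by simp
      from tendsto_power[OF this, of 2] show ?case by simp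
    qed
  qed measurable
  show ?thesis
  proof (rule D_1_2_criterion[OF prob_space_axioms])
    show "H > 0" using H by simp
    show "\<tau> i \<in> {0..T}" for i using \<tau>[of i] t by auto
    show "square_integrable M (B s)" if "s \<in> {0..T}" for s using fbm_square_integrable t(3) that by blast
    show "(\<integral>\<omega>. B s \<omega> * B r \<omega> \<partial>M) = fbm_cov H s r" if "s \<in> {0..T}" "r \<in> {0..T}" for s r
      using fbm_covariance t(3) that by blast
    show "square_integrable M (X t)" by (rule sqX)
    fix e :: real assume "e > 0"
    then have "\<forall>\<^sub>F n in sequentially. (\<integral>\<omega>. (\<psi> n (bt \<omega>) - X t \<omega>)\<^sup>2 \<partial>M) < e" using lim by (intro order_tendstoD(2)) auto
    then obtain n where "(\<integral>\<omega>. (\<psi> n (bt \<omega>) - X t \<omega>)\<^sup>2 \<partial>M) < e" by (auto simp: eventually_sequentially)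
    then show "\<exists>n\<ge>1. \<exists>\<psi>. Cb_smooth n \<psi> \<and> (\<forall>x. (\<Sum>i<n. \<bar>partial i \<psi> x\<bar>) \<le> 2) \<and> (\<integral>\<omega>. (\<psi> (\<lambda>i. B (\<tau> i) \<omega>) - X t \<omega>)\<^sup>2 \<partial>M) \<le> e"
      using \<psi>(1,2) unfolding bt_def by (intro exI[of _ "Suc n"] conjI exI[of _ "\<psi> n"]) auto
  qed
qed

end

theorem theorem3p3:
  fixes M :: "'a measure" and H x0 :: real and I :: "real set"
    and B X :: "real \<Rightarrow> 'a \<Rightarrow> real" and f :: "real \<Rightarrow> real \<Rightarrow> real"
  assumes "prob_space M"
    and "1 / 2 < H" and "H < 1"
    and "I = {0..} \<or> (\<exists>S>0. I = {0..S})"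
    and "is_fbm M H I B"
    and "x0 > 0"
    and "drift_i f" and "drift_ii H f" and "drift_iii f"
    and "positive_solution M I B f x0 X"
  shows "(\<forall>t\<in>I. \<forall>T>0. t \<le> T \<and> T \<in> I \<longrightarrow> X t \<in> D_1_2 M H T B) \<and>
         (\<forall>t\<in>I. t > 0 \<longrightarrow> absolutely_continuous lborel (distr M borel (X t)))"
proof -
  interpret prob_space M by fact
  interpret fbm M H I B by unfold_locales fact
  have I: "{0..t} \<subseteq> I" "0 \<le> t" if "t \<in> I" for t using assms(4) that by auto
  show ?thesis
  proof (intro conjI ballI allI impI)
    fix t T assume "t \<in> I" "0 < T" "t \<le> T \<and> T \<in> I"
    then show "X t \<in> D_1_2 M H T B"
      using I by (intro Malliavin_differentiable_solution[OF assms(2) _ _ _ assms(6,7,9,10)]) auto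
  next
    fix t assume "t \<in> I" "0 < t"
    then show "absolutely_continuous lborel (distr M borel (X t))"
      using I assms(2) by (intro absolutely_continuous_solution[OF _ _ _ assms(7,10)]) auto
  qed
qed

end
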